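(* Let $T$ be a maximal torus of $G_2\times G_2$. The torus $T$ acts on $DG$ with exactly $36$ fixed points, all contained in the closed $(G_2\times G_2)$-orbit $\mathbb{Q}_5\times \mathbb{Q}_5$.
   Context: We work over $\mathbb{C}$. $DG$ (the double Cayley Grassmannian) is the unique smooth projective $(G_2\times G_2)$-equivariant completion with Picard number one of the group $G_2$, on which $G_2\times G_2$ acts by left and right multiplication. Under $G_2\times G_2$ it has exactly three orbits: the open one, one of codimension one, and a closed one isomorphic to $\mathbb{Q}_5\times\mathbb{Q}_5$, where $\mathbb{Q}_5=G_2/P_1$ is the five-dimensional quadric. Concretely: let $\Delta$ be a half-spin representation of $Spin_{14}$ (dimension $64$) and $\mathbb{S}_{14}\subset\mathbb{P}(\Delta)$ the spinor variety (closed orbit); a general $z\in\Delta$ has stabilizer locally isomorphic to $G_2\times G_2$, under which $\Delta\simeq (V_7\otimes V'_7)\oplus V_7\oplus V'_7\oplus\mathbb{C}$ with $V_7,V_7'$ the natural representations of the two factors, and $DG=\mathbb{S}_{14}\cap\mathbb{P}((V_7\otimes V'_7)\oplus\mathbb{C})$ as a set, with reduced structure. *)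

theory Defs
  imports "HOL-Analysis.Analysis"
begin

section \<open>The complex octonions and \<open>G\<^sub>2\<close>\<close>

text \<open>
  The complex octonion algebra, as Zorn's vector matrices with rows \<open>(a, u)\<close> and \<open>(v, b)\<close>, where
  \<open>a, b\<close> are complex numbers and \<open>u, v\<close> complex 3-vectors,
  with coordinates \<open>x$1 = a\<close>, \<open>(x$2, x$3, x$4) = u\<close>, \<open>(x$5, x$6, x$7) = v\<close>, \<open>x$8 = b\<close>.
  The product of \<open>(a, u, v, b)\<close> and \<open>(a', u', v', b')\<close> is
  \<open>(aa' + u.v', au' + b'u - v \<times> v', a'v + bv' + u \<times> u', bb' + v.u')\<close>.
\<close>

type_synonym octonion = "complex^8"

definition omul :: "octonion \<Rightarrow> octonion \<Rightarrow> octonion" where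
  "omul x y = vector [
     x$1 * y$1 + (x$2 * y$5 + x$3 * y$6 + x$4 * y$7),
     x$1 * y$2 + x$2 * y$8 - (x$6 * y$7 - x$7 * y$6),
     x$1 * y$3 + x$3 * y$8 - (x$7 * y$5 - x$5 * y$7),
     x$1 * y$4 + x$4 * y$8 - (x$5 * y$6 - x$6 * y$5),
     x$5 * y$1 + x$8 * y$5 + (x$3 * y$4 - x$4 * y$3),
     x$6 * y$1 + x$8 * y$6 + (x$4 * y$2 - x$2 * y$4),
     x$7 * y$1 + x$8 * y$7 + (x$2 * y$3 - x$3 * y$2),
     x$8 * y$8 + (x$5 * y$2 + x$6 * y$3 + x$7 * y$4)]"

definition oone :: octonion where
  "oone = vector [1, 0, 0, 0, 0, 0, 0, 1]"

definition onorm2 :: "octonion \<Rightarrow> complex" where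
  "onorm2 x = x$1 * x$8 - (x$2 * x$5 + x$3 * x$6 + x$4 * x$7)"

definition V7 :: "octonion set" where
  "V7 = {x. x$1 + x$8 = 0}"

definition G2 :: "(complex^8^8) set" where
  "G2 = {A. invertible A \<and> (\<forall>x y. A *v omul x y = omul (A *v x) (A *v y))}"

lemma exhaust_8:
  fixes i :: 8
  shows "i = 1 \<or> i = 2 \<or> i = 3 \<or> i = 4 \<or> i = 5 \<or> i = 6 \<or> i = 7 \<or> i = 8"
proof (induct i)
  case (of_int z)
  then have "z = 0 \<or> z = 1 \<or> z = 2 \<or> z = 3 \<or> z = 4 \<or> z = 5 \<or> z = 6 \<or> z = 7"
    by fastforce
  then show ?case by auto
qed

lemma forall_8:
  "(\<forall>i::8. P i) \<longleftrightarrow> P 1 \<and> P 2 \<and> P 3 \<and> P 4 \<and> P 5 \<and> P 6 \<and> P 7 \<and> P 8"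
  by (metis exhaust_8)

lemma UNIV_8: "UNIV = {1, 2, 3, 4, 5, 6, 7, 8 :: 8}"
  using exhaust_8 by auto

lemma sum_8: "sum f (UNIV :: 8 set) = f 1 + f 2 + f 3 + f 4 + f 5 + f 6 + f 7 + f 8"
  unfolding UNIV_8 by (simp add: add.assoc)

lemma vector_8 [simp]:
  "(vector [a, b, c, d, e, f, g, h] :: 'a::zero^8)$1 = a"
  "(vector [a, b, c, d, e, f, g, h] :: 'a::zero^8)$2 = b"
  "(vector [a, b, c, d, e, f, g, h] :: 'a::zero^8)$3 = c"
  "(vector [a, b, c, d, e, f, g, h] :: 'a::zero^8)$4 = d"
  "(vector [a, b, c, d, e, f, g, h] :: 'a::zero^8)$5 = e"
  "(vector [a, b, c, d, e, f, g, h] :: 'a::zero^8)$6 = f"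
  "(vector [a, b, c, d, e, f, g, h] :: 'a::zero^8)$7 = g"
  "(vector [a, b, c, d, e, f, g, h] :: 'a::zero^8)$8 = h"
  by (simp_all add: vector_def)

lemma omul_oone: "omul oone x = x" "omul x oone = x"
  by (simp_all add: vec_eq_iff forall_8 omul_def oone_def)

lemma onorm2_omul: "onorm2 (omul x y) = onorm2 x * onorm2 y"
  by (simp add: onorm2_def omul_def) algebra


section \<open>The half-spin representation of \<open>Spin\<^sub>1\<^sub>4\<close>\<close>

text \<open>
  \<open>V\<^sub>1\<^sub>4 = V7 \<oplus> V7\<close> carries the nondegenerate quadratic form \<open>quad14\<close>.  Both half-spin spaces are
  modelled by the tensor square of the octonions, written as 8 by 8 matrices; the two
  factors are the 8-dimensional spin representations of the two copies of \<open>Spin\<^sub>7\<close>,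
  on which \<open>V7\<close> acts by octonionic left multiplication.  Clifford multiplication by a vector of
  \<open>V\<^sub>1\<^sub>4\<close> is the pair of maps \<open>cliff_plus\<close> (from the even to the odd half) and \<open>cliff_minus\<close>
  (back); these satisfy the Clifford relation, so by dimension (\<open>64 + 64 = 2^7\<close>) they define the
  irreducible spin module.
\<close>

type_synonym spinor = "complex^8^8"

definition cscale :: "complex \<Rightarrow> spinor \<Rightarrow> spinor" where
  "cscale c M = (\<chi> i j. c * M$i$j)"

interpretation Delta: vector_space cscale
  by unfold_locales (simp_all add: cscale_def vec_eq_iff algebra_simps)

definition tensor :: "octonion \<Rightarrow> octonion \<Rightarrow> spinor" where
  "tensor x y = (\<chi> i j. x$i * y$j)"

definition quad14 :: "octonion \<times> octonion \<Rightarrow> complex" where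
  "quad14 v = onorm2 (fst v) + onorm2 (snd v)"

definition cliff_plus :: "octonion \<times> octonion \<Rightarrow> spinor \<Rightarrow> spinor" where
  "cliff_plus v M =
     matrix (omul (fst v)) ** M + cscale \<i> (M ** transpose (matrix (omul (snd v))))"

definition cliff_minus :: "octonion \<times> octonion \<Rightarrow> spinor \<Rightarrow> spinor" where
  "cliff_minus v M =
     matrix (omul (fst v)) ** M - cscale \<i> (M ** transpose (matrix (omul (snd v))))"

text \<open>
  The image of \<open>Spin\<^sub>1\<^sub>4\<close> in the general linear group of the even half: products of an even number
  of unit vectors.
\<close>

inductive_set spin14 :: "(spinor \<Rightarrow> spinor) set" where
  spin14_id: "id \<in> spin14"
| spin14_mult:
    "\<lbrakk>v \<in> V7 \<times> V7; w \<in> V7 \<times> V7; quad14 v = 1; quad14 w = 1; g \<in> spin14\<rbrakk>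
      \<Longrightarrow> cliff_minus v \<circ> cliff_plus w \<circ> g \<in> spin14"


section \<open>Projective space, orbits, Zariski closed sets\<close>

text \<open>Points of the projective space of spinors are the lines \<open>Delta.span {M}\<close>.\<close>

definition proj :: "spinor set \<Rightarrow> spinor set set" where
  "proj W = {Delta.span {M} | M. M \<in> W \<and> M \<noteq> 0}"

definition orbits :: "(spinor \<Rightarrow> spinor) set \<Rightarrow> spinor set set \<Rightarrow> spinor set set set" where
  "orbits H X = {{g ` p | g. g \<in> H} | p. p \<in> X}"

text \<open>The algebra of functions generated by the functions in \<open>S\<close>.\<close>

inductive_set fun_algebra :: "('a \<Rightarrow> complex) set \<Rightarrow> ('a \<Rightarrow> complex) set"
  for S :: "('a \<Rightarrow> complex) set" where
  fun_algebra_gen: "f \<in> S \<Longrightarrow> f \<in> fun_algebra S"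
| fun_algebra_const: "(\<lambda>_. c) \<in> fun_algebra S"
| fun_algebra_add: "\<lbrakk>f \<in> fun_algebra S; g \<in> fun_algebra S\<rbrakk> \<Longrightarrow> (\<lambda>x. f x + g x) \<in> fun_algebra S"
| fun_algebra_mult: "\<lbrakk>f \<in> fun_algebra S; g \<in> fun_algebra S\<rbrakk> \<Longrightarrow> (\<lambda>x. f x * g x) \<in> fun_algebra S"

text \<open>
  Homogeneity of the equations need not be demanded: all homogeneous components of a
  polynomial vanishing on a cone vanish on it too.
\<close>

definition zariski_closed :: "spinor set set \<Rightarrow> bool" where
  "zariski_closed Y \<longleftrightarrow> Y \<subseteq> proj UNIV \<and>
     (\<exists>F. F \<subseteq> fun_algebra {(\<lambda>M. M$i$j) | i j. True} \<and>
       (\<forall>M. M \<noteq> 0 \<longrightarrow> (Delta.span {M} \<in> Y \<longleftrightarrow> (\<forall>f\<in>F. f M = 0))))"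


section \<open>The double Cayley Grassmannian\<close>

definition spinor_variety :: "spinor set set" where
  "spinor_variety = (THE Y. Y \<in> orbits spin14 (proj UNIV) \<and> zariski_closed Y)"

text \<open>
  The general spinor used to cut out the double Cayley Grassmannian.  By \<open>general_zspin\<close> below
  the tangent space of its orbit under \<open>Spin\<^sub>1\<^sub>4\<close> and scalars is the whole space, so this orbit is
  open and every general spinor lies in it.
\<close>

definition zspin :: spinor where
  "zspin = tensor oone oone"

definition act :: "(complex^8^8) \<times> (complex^8^8) \<Rightarrow> spinor \<Rightarrow> spinor" where
  "act t M = fst t ** M ** transpose (snd t)"

definition DG :: "spinor set set" where
  "DG = spinor_variety \<inter>
     proj (Delta.span ({tensor x y | x y. x \<in> V7 \<and> y \<in> V7} \<union> {zspin}))"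

text \<open>The quadric of null lines in \<open>V7\<close>, and its square in the Segre embedding.\<close>

definition Q5xQ5 :: "spinor set set" where
  "Q5xQ5 = {Delta.span {tensor x y} | x y.
     x \<in> V7 \<and> x \<noteq> 0 \<and> onorm2 x = 0 \<and> y \<in> V7 \<and> y \<noteq> 0 \<and> onorm2 y = 0}"


section \<open>Maximal tori\<close>

text \<open>The elements of the standard torus of rank \<open>n\<close>; coordinates of index at least \<open>n\<close> are padding.\<close>

definition Gm :: "nat \<Rightarrow> (nat \<Rightarrow> complex) set" where
  "Gm n = {t. (\<forall>i<n. t i \<noteq> 0) \<and> (\<forall>i\<ge>n. t i = 1)}"

definition laurent :: "nat \<Rightarrow> ((nat \<Rightarrow> complex) \<Rightarrow> complex) set" where
  "laurent n = fun_algebra ({(\<lambda>t. t i) | i. i < n} \<union> {(\<lambda>t. inverse (t i)) | i. i < n})"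

definition pair_poly :: "((complex^8^8) \<times> (complex^8^8) \<Rightarrow> complex) set" where
  "pair_poly = fun_algebra
     ({(\<lambda>t. fst t $ i $ j) | i j. True} \<union> {(\<lambda>t. snd t $ i $ j) | i j. True})"

text \<open>
  \<open>T\<close> is a torus in \<open>G2 \<times> G2\<close> if some \<open>\<phi>\<close> is an isomorphism of algebraic groups from a standard
  torus onto \<open>T\<close>.  The last conjunct says that the inverse of \<open>\<phi>\<close> is regular (in particular \<open>\<phi>\<close> is
  injective); polynomials in the matrix entries suffice there, because elements of \<open>G2\<close> have
  determinant 1.
\<close>

definition torus_in_G2xG2 :: "((complex^8^8) \<times> (complex^8^8)) set \<Rightarrow> bool" where
  "torus_in_G2xG2 T \<longleftrightarrow> T \<subseteq> G2 \<times> G2 \<and>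
     (\<exists>n \<phi>. \<phi> ` Gm n = T \<and>
       (\<forall>s\<in>Gm n. \<forall>t\<in>Gm n.
          \<phi> (\<lambda>i. s i * t i) = (fst (\<phi> s) ** fst (\<phi> t), snd (\<phi> s) ** snd (\<phi> t))) \<and>
       (\<forall>f\<in>pair_poly. \<exists>g\<in>laurent n. \<forall>t\<in>Gm n. f (\<phi> t) = g t) \<and>
       (\<forall>i<n. \<exists>f\<in>pair_poly. \<forall>t\<in>Gm n. f (\<phi> t) = t i))"

definition maximal_torus_in_G2xG2 :: "((complex^8^8) \<times> (complex^8^8)) set \<Rightarrow> bool" where
  "maximal_torus_in_G2xG2 T \<longleftrightarrow> torus_in_G2xG2 T \<and>
     (\<forall>T'. torus_in_G2xG2 T' \<and> T \<subseteq> T' \<longrightarrow> T' = T)"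


section \<open>Checks on the model\<close>

lemma omul_column:
  "(matrix (omul x) ** M)$i$j = omul x (column j M)$i"
proof -
  have "\<forall>i. (matrix (omul x) ** M)$i$j = omul x (column j M)$i"
    by (simp add: forall_8 matrix_matrix_mult_def matrix_def sum_8 omul_def column_def axis_def)
  then show ?thesis by blast
qed

lemma omul_row:
  "(M ** transpose (matrix (omul y)))$i$j = omul y (row i M)$j"
proof -
  have "\<forall>j. (M ** transpose (matrix (omul y)))$i$j = omul y (row i M)$j"
    by (simp add: forall_8 matrix_matrix_mult_def matrix_def transpose_def sum_8 omul_def
        row_def axis_def mult.commute)
  then show ?thesis by blast
qed

lemma omul_imaginary:
  assumes "x \<in> V7"
  shows "omul x (omul x y) = (\<chi> i. - onorm2 x * y$i)"
proof -
  have *: "x$8 = - x$1"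
    using assms by (simp add: V7_def add_eq_0_iff)
  show ?thesis
    by (simp add: vec_eq_iff forall_8 omul_def onorm2_def *) (simp add: algebra_simps)
qed

lemma matrix_omul_sq:
  assumes "x \<in> V7"
  shows "matrix (omul x) ** matrix (omul x) = mat (- onorm2 x)"
proof -
  have "(matrix (omul x) ** matrix (omul x))$i$j = mat (- onorm2 x)$i$j" for i j
  proof -
    have "column j (matrix (omul x)) = omul x (axis j 1)"
      by (simp add: column_def matrix_def vec_eq_iff)
    then show ?thesis
      by (simp add: omul_column omul_imaginary[OF assms] axis_def mat_def)
  qed
  then show ?thesis by (simp add: vec_eq_iff)
qed

lemma matrix_add_rdistrib: "(A + B) ** (C :: spinor) = A ** C + B ** C"
  by (simp add: matrix_matrix_mult_def vec_eq_iff sum.distrib algebra_simps)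

lemma matrix_diff_distrib:
  "(A - B) ** (C :: spinor) = A ** C - B ** C" "(C :: spinor) ** (A - B) = C ** A - C ** B"
  by (simp_all add: matrix_matrix_mult_def vec_eq_iff sum_subtractf algebra_simps)

lemma cscale_matrix:
  "cscale c M ** N = cscale c (M ** N)" "N ** cscale c M = cscale c (N ** M)"
  by (simp_all add: cscale_def matrix_matrix_mult_def vec_eq_iff sum_distrib_left mult_ac)

lemma mat_matrix:
  "mat c ** M = cscale c M" "M ** mat c = cscale c M"
proof -
  have "mat c = cscale c (mat 1)"
    by (simp add: cscale_def mat_def vec_eq_iff)
  then show "mat c ** M = cscale c M" "M ** mat c = cscale c M"
    by (simp_all add: cscale_matrix)
qed

lemma cliff_relation:
  assumes "v \<in> V7 \<times> V7"
  shows "cliff_minus v (cliff_plus v M) = cscale (- quad14 v) M"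
    and "cliff_plus v (cliff_minus v M) = cscale (- quad14 v) M"
proof -
  obtain a b where v: "v = (a, b)" "a \<in> V7" "b \<in> V7"
    using assms by auto
  define A where "A = matrix (omul a)"
  define B where "B = transpose (matrix (omul b))"
  have A: "A ** (A ** N) = cscale (- onorm2 a) N" for N
    by (simp add: matrix_mul_assoc A_def matrix_omul_sq[OF v(2)] mat_matrix)
  have "B ** B = mat (- onorm2 b)"
    by (simp add: B_def flip: matrix_transpose_mul)
      (simp add: matrix_omul_sq[OF v(3)] transpose_mat)
  then have B: "(N ** B) ** B = cscale (- onorm2 b) N" for N
    by (simp add: mat_matrix flip: matrix_mul_assoc)
  have AB: "A ** (N ** B) = (A ** N) ** B" for N
    by (simp add: matrix_mul_assoc)
  have ii: "cscale \<i> (cscale \<i> N) = - N" for N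
    by (simp add: cscale_def vec_eq_iff flip: mult.assoc)
  have neg: "cscale (- c) N = - cscale c N" for c N
    by (simp add: cscale_def vec_eq_iff)
  show "cliff_minus v (cliff_plus v M) = cscale (- quad14 v) M"
    unfolding cliff_plus_def cliff_minus_def v quad14_def fst_conv snd_conv
      A_def[symmetric] B_def[symmetric]
    by (simp add: matrix_add_ldistrib matrix_add_rdistrib cscale_matrix A AB B ii neg
        Delta.scale_right_distrib Delta.scale_left_distrib
        Delta.scale_right_diff_distrib Delta.scale_left_diff_distrib)
  show "cliff_plus v (cliff_minus v M) = cscale (- quad14 v) M"
    unfolding cliff_plus_def cliff_minus_def v quad14_def fst_conv snd_conv
      A_def[symmetric] B_def[symmetric]
    by (simp add: matrix_diff_distrib cscale_matrix A AB B ii neg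
        Delta.scale_right_distrib Delta.scale_left_distrib
        Delta.scale_right_diff_distrib Delta.scale_left_diff_distrib)
qed

lemma G2_oone:
  assumes "A \<in> G2"
  shows "A *v oone = oone"
proof -
  from assms obtain B where B: "A ** B = mat 1"
    by (auto simp: G2_def invertible_def)
  have "omul (A *v oone) (A *v (B *v y)) = A *v (B *v y)" for y
    using assms unfolding G2_def by (metis (mono_tags, lifting) mem_Collect_eq omul_oone(1))
  then have "omul (A *v oone) y = y" for y
    by (simp add: matrix_vector_mul_assoc B)
  from this[of oone] show ?thesis
    by (simp add: omul_oone)
qed

lemma tensor_matrix: "M ** tensor x y ** transpose N = tensor (M *v x) (N *v y)"
  by (simp add: tensor_def vec_eq_iff matrix_matrix_mult_def matrix_vector_mult_def transpose_def
      sum_distrib_left sum_distrib_right mult_ac)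

lemma act_zspin: "t \<in> G2 \<times> G2 \<Longrightarrow> act t zspin = zspin"
  by (auto simp: act_def zspin_def tensor_matrix G2_oone)

lemma G2_matrix_omul:
  assumes "A \<in> G2"
  shows "A ** matrix (omul x) = matrix (omul (A *v x)) ** A"
proof -
  have m: "matrix (omul x) *v y = omul x y" for x y
  proof -
    have "\<forall>i. (matrix (omul x) *v y)$i = omul x y$i"
      by (simp add: forall_8 matrix_vector_mult_def matrix_def sum_8 omul_def axis_def)
    then show ?thesis by (simp add: vec_eq_iff)
  qed
  show ?thesis
    using assms by (simp add: matrix_eq G2_def m flip: matrix_vector_mul_assoc)
qed

text \<open>
  \<open>G2 \<times> G2\<close> acts on spinors compatibly with its action on \<open>V\<^sub>1\<^sub>4\<close>.  It fixes \<open>zspin\<close>, whose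
  stabilizer in \<open>Spin\<^sub>1\<^sub>4\<close> times the scalars has dimension \<open>91 + 1 - 64 = 28\<close>, the dimension of
  \<open>G2 \<times> G2\<close>; so \<open>G2 \<times> G2\<close> is that stabilizer up to finite groups.
\<close>

lemma act_cliff:
  assumes "g \<in> G2" "h \<in> G2"
  shows "act (g, h) (cliff_plus (a, b) M) = cliff_plus (g *v a, h *v b) (act (g, h) M)"
    and "act (g, h) (cliff_minus (a, b) M) = cliff_minus (g *v a, h *v b) (act (g, h) M)"
proof -
  have 1: "g ** (matrix (omul a) ** N) = matrix (omul (g *v a)) ** (g ** N)" for N :: spinor
    using G2_matrix_omul[OF assms(1)] by (simp add: matrix_mul_assoc)
  have "transpose (matrix (omul b)) ** transpose h = transpose h ** transpose (matrix (omul (h *v b)))"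
    using G2_matrix_omul[OF assms(2), of b] by (metis matrix_transpose_mul)
  then have 2: "N ** transpose (matrix (omul b)) ** transpose h
      = N ** transpose h ** transpose (matrix (omul (h *v b)))" for N :: spinor
    by (metis matrix_mul_assoc)
  have 3: "g ** (matrix (omul a) ** M) ** transpose h = matrix (omul (g *v a)) ** (g ** M ** transpose h)"
    using 1 by (simp add: matrix_mul_assoc)
  have 4: "g ** (M ** transpose (matrix (omul b))) ** transpose h
      = g ** M ** transpose h ** transpose (matrix (omul (h *v b)))"
    using 2[of "g ** M"] by (simp add: matrix_mul_assoc)
  show "act (g, h) (cliff_plus (a, b) M) = cliff_plus (g *v a, h *v b) (act (g, h) M)"
    by (simp add: act_def cliff_plus_def matrix_add_ldistrib matrix_add_rdistrib cscale_matrix 3 4)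
  show "act (g, h) (cliff_minus (a, b) M) = cliff_minus (g *v a, h *v b) (act (g, h) M)"
    by (simp add: act_def cliff_minus_def matrix_diff_distrib
        cscale_matrix 3 4)
qed

lemma tensor_linear:
  "tensor (x + x') y = tensor x y + tensor x' y"
  "tensor x (y + y') = tensor x y + tensor x y'"
  "tensor (c *s x) y = cscale c (tensor x y)"
  "tensor x (c *s y) = cscale c (tensor x y)"
  by (simp_all add: tensor_def cscale_def vec_eq_iff algebra_simps)

lemma cliff_zspin:
  "cliff_minus (a, b) (cliff_plus (c, d) zspin) =
     tensor (omul a c) oone + cscale \<i> (tensor a d) - cscale \<i> (tensor c b) + tensor oone (omul b d)"
proof -
  have *: "matrix (omul x) *v y = omul x y" for x y
  proof -
    have "\<forall>i. (matrix (omul x) *v y)$i = omul x y$i"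
      by (simp add: forall_8 matrix_vector_mult_def matrix_def sum_8 omul_def axis_def)
    then show ?thesis by (simp add: vec_eq_iff)
  qed
  have l: "matrix (omul x) ** tensor y z = tensor (omul x y) z" for x y z
    using tensor_matrix[of "matrix (omul x)" y z "mat 1"] by (simp add: * transpose_mat)
  have r: "tensor y z ** transpose (matrix (omul x)) = tensor y (omul x z)" for x y z
    using tensor_matrix[of "mat 1" y z "matrix (omul x)"] by (simp add: *)
  have "cscale \<i> (cscale \<i> N) = - N" for N
    by (simp add: cscale_def vec_eq_iff flip: mult.assoc)
  then show ?thesis
    by (simp add: cliff_plus_def cliff_minus_def zspin_def matrix_add_ldistrib matrix_add_rdistrib
        cscale_matrix l r omul_oone Delta.scale_right_distrib)
qed

lemma octonion_products:
  obtains a b c d e f where "a \<in> V7" "b \<in> V7" "c \<in> V7" "d \<in> V7" "e \<in> V7" "f \<in> V7"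
    "x = omul a b + omul c d + omul e f"
proof
  let ?h = "vector [1, 0, 0, 0, 0, 0, 0, -1] :: octonion"
  let ?x = "vector [0, x$2, x$3, x$4, -x$5, -x$6, -x$7, 0] :: octonion"
  show "x = omul ?h ?x + omul (axis 2 (x$1)) (axis 5 1) + omul (axis 5 (x$8)) (axis 2 1)"
    by (simp add: vec_eq_iff forall_8 omul_def axis_def)
qed (simp_all add: V7_def axis_def)

lemma general_zspin:
  "Delta.span {cliff_minus v (cliff_plus w zspin) | v w. v \<in> V7 \<times> V7 \<and> w \<in> V7 \<times> V7} = UNIV"
  (is "?S = UNIV")
proof -
  have V0: "0 \<in> V7" by (simp add: V7_def)
  have omul_0: "omul 0 x = 0" "omul x 0 = 0" for x
    by (simp_all add: omul_def vec_eq_iff forall_8)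
  have tensor_0: "tensor 0 x = 0" "tensor x 0 = 0" for x
    by (simp_all add: tensor_def vec_eq_iff)
  have gen: "cliff_minus (a, b) (cliff_plus (c, d) zspin) \<in> ?S"
    if "a \<in> V7" "b \<in> V7" "c \<in> V7" "d \<in> V7" for a b c d
    by (rule Delta.span_base) (use that in blast)
  have left: "tensor x oone \<in> ?S" for x
  proof -
    have "tensor (omul a b) oone \<in> ?S" if "a \<in> V7" "b \<in> V7" for a b
      using gen[of a 0 b 0] that V0 by (simp add: cliff_zspin omul_0 tensor_0)
    then show ?thesis
      using octonion_products[of x "tensor x oone \<in> ?S"]
      by (auto simp: tensor_linear intro!: Delta.span_add)
  qed
  have right: "tensor oone x \<in> ?S" for x
  proof -
    have "tensor oone (omul a b) \<in> ?S" if "a \<in> V7" "b \<in> V7" for a b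
      using gen[of 0 a 0 b] that V0 by (simp add: cliff_zspin omul_0 tensor_0)
    then show ?thesis
      using octonion_products[of x "tensor oone x \<in> ?S"]
      by (auto simp: tensor_linear intro!: Delta.span_add)
  qed
  have imag: "tensor x y \<in> ?S" if "x \<in> V7" "y \<in> V7" for x y
  proof -
    have "cscale \<i> (tensor x y) \<in> ?S"
      using gen[of x 0 0 y] that V0 by (simp add: cliff_zspin omul_0 tensor_0)
    then have "cscale (- \<i>) (cscale \<i> (tensor x y)) \<in> ?S"
      by (rule Delta.span_scale)
    then show ?thesis by simp
  qed
  have tens: "tensor x y \<in> ?S" for x y
  proof -
    define re where "re x = (x$1 + x$8) / 2" for x :: octonion
    define im where "im x = x - re x *s oone" for x :: octonion
    have im: "im x \<in> V7" for x
      by (simp add: im_def re_def V7_def oone_def field_simps)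
    have split: "x = im x + re x *s oone" for x
      by (simp add: im_def)
    have "tensor x y = tensor (im x) (im y) + tensor oone (re x *s im y) + tensor (re y *s x) oone"
      by (simp add: im_def tensor_def vec_eq_iff algebra_simps)
    moreover have "tensor (im x) (im y) + tensor oone (re x *s im y) + tensor (re y *s x) oone \<in> ?S"
      by (intro Delta.span_add imag im left right)
    ultimately show ?thesis by (rule ssubst)
  qed
  have "M \<in> ?S" for M
  proof -
    have "M = (\<Sum>i\<in>UNIV. tensor (axis i 1) (row i M))"
      by (simp add: vec_eq_iff tensor_def row_def axis_def if_distrib if_distribR cong: if_cong)
    moreover have "(\<Sum>i\<in>UNIV. tensor (axis i 1) (row i M)) \<in> ?S"
      by (intro Delta.span_sum tens)
    ultimately show ?thesis by (rule ssubst)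
  qed
  then show ?thesis by blast
qed

end

theory Submission
  imports Defs
begin

text \<open>
  The proof makes the spinor variety explicit, finds the closed orbit by degeneration, and reduces an
  arbitrary maximal torus to the diagonal one.

  A spinor \<open>M\<close> is pure if it satisfies Cartan's equation \<open>\<Sum> e\<^sub>a M \<otimes> f\<^sub>a M = 0\<close> over dual bases
  of \<open>V\<^sub>1\<^sub>4\<close>.  The equation is quadratic, and by the Clifford relation it is preserved by Clifford
  multiplication (\<open>pure_spinor_cliff_plus\<close>), hence by the spin group.  Conversely the spin group is
  transitive on pure lines (\<open>pure_spinor_in_orbit\<close>): after an element of the Weyl group the leading
  coordinate is nonzero, unipotent elements remove the part of degree 2, and then Cartan's equation
  leaves only the highest weight vector.  So the pure lines form a Zariski closed orbit.  Every other
  Zariski closed orbit would contain the highest weight line as well, as a limit of a one-parameter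
  subgroup.  Hence the spinor variety is the set of pure lines (\<open>spinor_variety_eq\<close>).

  A point of \<open>DG\<close> is spanned by a pure spinor \<open>A + c z\<close>, where \<open>A\<close> lies in the tensor square of \<open>V7\<close>
  and \<open>z\<close> is fixed by \<open>G2 \<times> G2\<close>.  As \<open>z\<close> is not pure, \<open>A\<close> is not 0, and a one-parameter subgroup
  contracts a suitable translate of \<open>A + c z\<close> to a tensor of two null vectors.  Since \<open>G2\<close> is
  transitive on null vectors of \<open>V7\<close>, the tensors of null vectors form a single orbit, which is
  Zariski closed and is contained in the closure of every other one (\<open>closed_G2_orbits\<close>).

  Let a torus act on the octonions by automorphisms.  Its joint eigenvectors span, by the independence
  of characters.  Either all imaginary octonions are fixed, or there are eigenvectors \<open>x\<close> and \<open>y\<close>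
  with inverse nontrivial characters and nonzero pairing, and then \<open>x y - y x\<close> is fixed and not null
  (\<open>fixed_unit_vector\<close>).  The stabiliser of such a vector is \<open>SL\<^sub>3\<close>, where a basis of eigenvectors
  diagonalises the torus.  So a maximal torus of \<open>G2 \<times> G2\<close> is conjugate to the diagonal one
  (\<open>maximal_torus_conjugate\<close>).

  The diagonal torus acts on \<open>V7\<close> with seven distinct weights, 0 and the six short roots.  A fixed
  line is spanned by a weight vector.  Those for a pair of short roots are tensors of null vectors,
  which gives the 36 points; the other ones, which involve the weight 0, are not pure
  (\<open>pure_spinor_tensorD\<close>, \<open>not_pure_weight_zero\<close>).
\<close>

section \<open>The octonions as a quadratic space\<close>

text \<open>
  The polar form of the norm: \<open>onorm2 (x + y) = onorm2 x + onorm2 y + obil x y\<close>.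
\<close>

definition obil :: "octonion \<Rightarrow> octonion \<Rightarrow> complex" where
  "obil x y = x$1 * y$8 + x$8 * y$1
     - (x$2 * y$5 + x$5 * y$2) - (x$3 * y$6 + x$6 * y$3) - (x$4 * y$7 + x$7 * y$4)"

definition imag :: "octonion \<Rightarrow> octonion" where
  "imag x = x - ((x$1 + x$8) / 2) *s oone"

text \<open>
  The basis dual to the coordinate basis: \<open>obil (axis a 1) (odual b)\<close> is 1 if \<open>a = b\<close> and 0 otherwise.
\<close>

definition odual :: "8 \<Rightarrow> octonion" where
  "odual a = (vector [axis 8 1, - axis 5 1, - axis 6 1, - axis 7 1,
     - axis 2 1, - axis 3 1, - axis 4 1, axis 1 1] :: octonion^8) $ a"

lemma oone_nth [simp]: "oone $ 1 = 1" "oone $ 2 = 0" "oone $ 3 = 0" "oone $ 4 = 0"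
    "oone $ 5 = 0" "oone $ 6 = 0" "oone $ 7 = 0" "oone $ 8 = 1"
  by (simp_all add: oone_def)

lemma octonion_eq_iff: "(x :: octonion) = y \<longleftrightarrow>
    x$1 = y$1 \<and> x$2 = y$2 \<and> x$3 = y$3 \<and> x$4 = y$4 \<and> x$5 = y$5 \<and> x$6 = y$6 \<and> x$7 = y$7 \<and> x$8 = y$8"
  by (simp add: vec_eq_iff forall_8)

lemma omul_nth [simp]:
  "omul x y $ 1 = x$1 * y$1 + (x$2 * y$5 + x$3 * y$6 + x$4 * y$7)"
  "omul x y $ 2 = x$1 * y$2 + x$2 * y$8 - (x$6 * y$7 - x$7 * y$6)"
  "omul x y $ 3 = x$1 * y$3 + x$3 * y$8 - (x$7 * y$5 - x$5 * y$7)"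
  "omul x y $ 4 = x$1 * y$4 + x$4 * y$8 - (x$5 * y$6 - x$6 * y$5)"
  "omul x y $ 5 = x$5 * y$1 + x$8 * y$5 + (x$3 * y$4 - x$4 * y$3)"
  "omul x y $ 6 = x$6 * y$1 + x$8 * y$6 + (x$4 * y$2 - x$2 * y$4)"
  "omul x y $ 7 = x$7 * y$1 + x$8 * y$7 + (x$2 * y$3 - x$3 * y$2)"
  "omul x y $ 8 = x$8 * y$8 + (x$5 * y$2 + x$6 * y$3 + x$7 * y$4)"
  by (simp_all add: omul_def)

lemma omul_linear:
  "omul (x + x') y = omul x y + omul x' y" "omul x (y + y') = omul x y + omul x y'"
  "omul (c *s x) y = c *s omul x y" "omul x (c *s y) = c *s omul x y"
  "omul 0 y = 0" "omul x 0 = 0" "omul (- x) y = - omul x y" "omul x (- y) = - omul x y"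
  "omul (x - x') y = omul x y - omul x' y" "omul x (y - y') = omul x y - omul x y'"
  by (simp_all add: octonion_eq_iff algebra_simps)

lemma omul_sum_left: "omul (\<Sum>a\<in>A. f a) y = (\<Sum>a\<in>A. omul (f a) y)"
  by (induction A rule: infinite_finite_induct) (simp_all add: omul_linear)

lemma axis_nth: "axis a (c::complex) $ b = (if a = b then c else 0)"
  by (auto simp: axis_def)

lemma obil_sym: "obil x y = obil y x"
  by (simp add: obil_def algebra_simps)

lemma obil_linear:
  "obil (x + x') y = obil x y + obil x' y" "obil x (y + y') = obil x y + obil x y'"
  "obil (c *s x) y = c * obil x y" "obil x (c *s y) = c * obil x y"
  "obil 0 y = 0" "obil x 0 = 0" "obil (- x) y = - obil x y" "obil x (- y) = - obil x y"
  by (simp_all add: obil_def algebra_simps)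

lemma obil_self: "obil x x = 2 * onorm2 x"
  by (simp add: obil_def onorm2_def algebra_simps)

lemma onorm2_add: "onorm2 (x + y) = onorm2 x + onorm2 y + obil x y"
  by (simp add: obil_def onorm2_def algebra_simps)

lemma onorm2_scale: "onorm2 (c *s x) = c\<^sup>2 * onorm2 x"
  by (simp add: onorm2_def algebra_simps power2_eq_square)

lemma imag_V7: "imag x \<in> V7"
  by (simp add: V7_def imag_def field_simps)

text \<open>
  Orthogonal projection to \<open>V7\<close> takes dual bases of the octonions to two families of eight
  vectors that still expand every vector of \<open>V7\<close>.  Such a redundant pair serves as well as dual
  bases in all sums \<open>\<Sum> e\<^sub>a \<otimes> f\<^sub>a\<close>, which only depend on the form, and it is indexed by
  the coordinates themselves.
\<close>

lemma V7_dual_expansion: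
  assumes "v \<in> V7"
  shows "(\<Sum>a\<in>UNIV. obil v (imag (odual a)) *s imag (axis a 1)) = v"
    and "(\<Sum>a\<in>UNIV. obil v (imag (axis a 1)) *s imag (odual a)) = v"
proof -
  have v: "v$8 = - v$1"
    using assms by (simp add: V7_def add_eq_0_iff)
  show "(\<Sum>a\<in>UNIV. obil v (imag (odual a)) *s imag (axis a 1)) = v"
    by (simp add: octonion_eq_iff sum_8 imag_def odual_def axis_nth obil_def v)
  show "(\<Sum>a\<in>UNIV. obil v (imag (axis a 1)) *s imag (odual a)) = v"
    by (simp add: octonion_eq_iff sum_8 imag_def odual_def axis_nth obil_def v)
qed

section \<open>Cartan's equation for pure spinors\<close>

text \<open>
  The polar form of \<open>quad14\<close>.
\<close>

definition bil14 :: "octonion \<times> octonion \<Rightarrow> octonion \<times> octonion \<Rightarrow> complex" where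
  "bil14 v w = obil (fst v) (fst w) + obil (snd v) (snd w)"

fun basis14 :: "8 + 8 \<Rightarrow> octonion \<times> octonion" where
  "basis14 (Inl a) = (imag (axis a 1), 0)"
| "basis14 (Inr a) = (0, imag (axis a 1))"

fun dual14 :: "8 + 8 \<Rightarrow> octonion \<times> octonion" where
  "dual14 (Inl a) = (imag (odual a), 0)"
| "dual14 (Inr a) = (0, imag (odual a))"

lemma sum_8_8: "(\<Sum>a\<in>UNIV. f a) = (\<Sum>a\<in>UNIV. f (Inl a)) + (\<Sum>a\<in>UNIV. f (Inr a))"
  for f :: "8 + 8 \<Rightarrow> 'a::comm_monoid_add"
proof -
  have "(\<Sum>a\<in>UNIV. f a) = sum f (UNIV <+> UNIV)"
    by (simp only: UNIV_Plus_UNIV)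
  also have "\<dots> = (\<Sum>a\<in>UNIV. f (Inl a)) + (\<Sum>a\<in>UNIV. f (Inr a))"
    by (subst sum.Plus) (simp_all add: comp_def)
  finally show ?thesis .
qed

text \<open>
  Cartan's equation \<open>\<Sum> e\<^sub>a M \<otimes> f\<^sub>a M = 0\<close>, the sum being over dual bases of \<open>V\<^sub>1\<^sub>4\<close>.
  It says that the linear forms \<open>v \<mapsto> \<phi> (v M)\<close> on \<open>V\<^sub>1\<^sub>4\<close> make up an isotropic space, that is,
  for \<open>M \<noteq> 0\<close>, that the vectors annihilating \<open>M\<close> form a maximal isotropic subspace.  These are
  quadratic equations in the entries of \<open>M\<close>, so they define a Zariski closed set.
\<close>

definition pure_spinor :: "spinor \<Rightarrow> bool" where
  "pure_spinor M \<longleftrightarrow> (\<forall>i j k l.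
     (\<Sum>a\<in>UNIV. cliff_plus (basis14 a) M $ i $ j * cliff_plus (dual14 a) M $ k $ l) = 0)"

lemma cliff_nth:
  "cliff_plus (a, b) M $ i $ j = omul a (column j M) $ i + \<i> * omul b (row i M) $ j"
  "cliff_minus (a, b) M $ i $ j = omul a (column j M) $ i - \<i> * omul b (row i M) $ j"
  by (simp_all add: cliff_plus_def cliff_minus_def omul_column omul_row cscale_def)

lemma cscale_nth: "cscale c M $ i $ j = c * M $ i $ j"
  by (simp add: cscale_def)

lemma column_row_linear:
  "column j (M + N) = column j M + column j N" "column j (cscale c M) = c *s column j M"
  "row j (M + N) = row j M + row j N" "row j (cscale c M) = c *s row j M"
  for M :: spinor
  by (simp_all add: column_def row_def cscale_def vec_eq_iff)

lemma cliff_linear: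
  "cliff_plus v (M + N) = cliff_plus v M + cliff_plus v N"
  "cliff_plus v (cscale c M) = cscale c (cliff_plus v M)"
  "cliff_minus v (M + N) = cliff_minus v M + cliff_minus v N"
  "cliff_minus v (cscale c M) = cscale c (cliff_minus v M)"
proof -
  obtain a b where v: "v = (a, b)" by force
  show "cliff_plus v (M + N) = cliff_plus v M + cliff_plus v N"
    and "cliff_minus v (M + N) = cliff_minus v M + cliff_minus v N"
    unfolding v vec_eq_iff
    by (simp_all only: cliff_nth column_row_linear vector_add_component omul_linear) (simp_all add: distrib_left)
  have "\<i> * (c * x) = c * (\<i> * x)" for x
    by simp
  then show "cliff_plus v (cscale c M) = cscale c (cliff_plus v M)"
    and "cliff_minus v (cscale c M) = cscale c (cliff_minus v M)"
    unfolding v vec_eq_iff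
    by (simp_all only: cliff_nth column_row_linear omul_linear cscale_nth
        vector_smult_component distrib_left right_diff_distrib) simp_all
qed

lemma cliff_add:
  "cliff_plus (v + w) M = cliff_plus v M + cliff_plus w M"
  "cliff_minus (v + w) M = cliff_minus v M + cliff_minus w M"
proof -
  obtain a b a' b' where v: "v = (a, b)" "w = (a', b')" by (metis surj_pair)
  show "cliff_plus (v + w) M = cliff_plus v M + cliff_plus w M"
    "cliff_minus (v + w) M = cliff_minus v M + cliff_minus w M"
    unfolding v vec_eq_iff
    by (simp_all only: add_Pair cliff_nth vector_add_component omul_linear) (simp_all add: distrib_left)
qed

lemma bil14_linear:
  "bil14 (v + v') w = bil14 v w + bil14 v' w" "bil14 v (w + w') = bil14 v w + bil14 v w'"
  "bil14 (- v) w = - bil14 v w" "bil14 v (- w) = - bil14 v w"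
  by (simp_all add: bil14_def obil_linear algebra_simps)

lemma quad14_add: "quad14 (v + w) = quad14 v + quad14 w + bil14 v w"
  by (simp add: quad14_def bil14_def onorm2_add)

lemma bil14_sym: "bil14 v w = bil14 w v"
  by (simp add: bil14_def obil_sym)

lemma bil14_self: "bil14 v v = 2 * quad14 v"
  by (simp add: quad14_def bil14_def obil_self)

lemma V7_add: "x \<in> V7 \<Longrightarrow> y \<in> V7 \<Longrightarrow> x + y \<in> V7"
  by (simp add: V7_def add_eq_0_iff)

lemma V14_add: "v \<in> V7 \<times> V7 \<Longrightarrow> w \<in> V7 \<times> V7 \<Longrightarrow> v + w \<in> V7 \<times> V7"
  by (cases v; cases w) (simp add: mem_Times_iff V7_add)

lemma cliff_anticommute:
  assumes "v \<in> V7 \<times> V7" "w \<in> V7 \<times> V7"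
  shows "cliff_minus v (cliff_plus w M) = - cliff_minus w (cliff_plus v M) - cscale (bil14 v w) M"
    and "cliff_plus v (cliff_minus w M) = - cliff_plus w (cliff_minus v M) - cscale (bil14 v w) M"
proof -
  note vw = V14_add[OF assms]
  have eq: "x = - y - c" if "vv + x + (y + ww) = - (a + b + c)" "vv = - a" "ww = - b" for x y vv ww a b c :: spinor
  proof -
    have "x - (- y - c) = (vv + x + (y + ww)) - vv - ww + c"
      by (simp add: algebra_simps)
    also have "\<dots> = 0"
      unfolding that(1) unfolding that(2,3) by (simp add: algebra_simps)
    finally show ?thesis by (simp only: right_minus_eq)
  qed
  have "cliff_minus (v + w) (cliff_plus (v + w) M) = - (cscale (quad14 v) M + cscale (quad14 w) M + cscale (bil14 v w) M)"
    by (simp add: cliff_relation(1)[OF vw] quad14_add Delta.scale_left_distrib)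
      (simp add: cscale_def vec_eq_iff algebra_simps)
  then show "cliff_minus v (cliff_plus w M) = - cliff_minus w (cliff_plus v M) - cscale (bil14 v w) M"
    by (intro eq[where vv = "cliff_minus v (cliff_plus v M)" and ww = "cliff_minus w (cliff_plus w M)"])
      (simp_all add: cliff_add cliff_linear cliff_relation[OF assms(1)] cliff_relation[OF assms(2)] algebra_simps)
  have "cliff_plus (v + w) (cliff_minus (v + w) M) = - (cscale (quad14 v) M + cscale (quad14 w) M + cscale (bil14 v w) M)"
    by (simp add: cliff_relation(2)[OF vw] quad14_add Delta.scale_left_distrib)
      (simp add: cscale_def vec_eq_iff algebra_simps)
  then show "cliff_plus v (cliff_minus w M) = - cliff_plus w (cliff_minus v M) - cscale (bil14 v w) M"
    by (intro eq[where vv = "cliff_plus v (cliff_minus v M)" and ww = "cliff_plus w (cliff_minus w M)"])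
      (simp_all add: cliff_add cliff_linear cliff_relation[OF assms(1)] cliff_relation[OF assms(2)] algebra_simps)
qed

lemma linear_functional_expand:
  assumes add: "\<And>M N. \<phi> (M + N) = \<phi> M + \<phi> N" and scale: "\<And>c M. \<phi> (cscale c M) = c * \<phi> M"
  shows "\<phi> M = (\<Sum>i\<in>UNIV. \<Sum>j\<in>UNIV. M$i$j * \<phi> (tensor (axis i 1) (axis j 1)))"
proof -
  have "\<phi> 0 = 0"
    using scale[of 0 0] by (simp add: cscale_def zero_vec_def)
  then have sum: "\<phi> (sum f A) = (\<Sum>a\<in>A. \<phi> (f a))" for f and A :: "8 set"
    by (induction A rule: infinite_finite_induct) (simp_all add: add)
  have "M = (\<Sum>i\<in>UNIV. \<Sum>j\<in>UNIV. cscale (M$i$j) (tensor (axis i 1) (axis j 1)))"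
  proof -
    have inner: "(\<Sum>j\<in>UNIV. cscale (M$i$j) (tensor (axis i 1) (axis j 1)) $ p $ q)
        = (if i = p then M$p$q else 0)" for i p q
    proof (cases "i = p")
      case True
      have "(\<Sum>j\<in>UNIV. cscale (M$i$j) (tensor (axis i 1) (axis j 1)) $ p $ q)
          = (\<Sum>j\<in>UNIV. if j = q then M$p$j else 0)"
        by (rule sum.cong) (simp_all add: cscale_nth tensor_def axis_nth True)
      then show ?thesis using True by simp
    qed (simp add: cscale_nth tensor_def axis_nth)
    show ?thesis
      by (simp add: vec_eq_iff sum_component inner)
  qed
  then have "\<phi> M = \<phi> (\<Sum>i\<in>UNIV. \<Sum>j\<in>UNIV. cscale (M$i$j) (tensor (axis i 1) (axis j 1)))"
    by simp
  then show ?thesis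
    by (simp add: sum scale)
qed

text \<open>
  Cartan's equation is about the coordinates of a tensor.  Its consequences for other pairs of
  linear functionals, such as a coordinate after Clifford multiplication, come from here.
\<close>

lemma tensor_vanishing_functional:
  fixes N N' :: "'a::finite \<Rightarrow> spinor"
  assumes "\<And>i j k l. (\<Sum>a\<in>UNIV. N a $ i $ j * N' a $ k $ l) = 0"
    and "\<And>M N. \<phi> (M + N) = \<phi> M + \<phi> N" "\<And>c M. \<phi> (cscale c M) = c * \<phi> M"
    and "\<And>M N. \<psi> (M + N) = \<psi> M + \<psi> N" "\<And>c M. \<psi> (cscale c M) = c * \<psi> M"
  shows "(\<Sum>a\<in>UNIV. \<phi> (N a) * \<psi> (N' a)) = 0"
proof -
  let ?E = "\<lambda>i j. tensor (axis i 1) (axis j 1)"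
  let ?S = "UNIV :: (8 \<times> 8) set"
  have \<phi>: "\<phi> M = (\<Sum>p\<in>?S. M $ fst p $ snd p * \<phi> (?E (fst p) (snd p)))" for M
    using linear_functional_expand[of \<phi> M] assms(2,3)
    by (simp add: sum.cartesian_product split_beta)
  have \<psi>: "\<psi> M = (\<Sum>p\<in>?S. M $ fst p $ snd p * \<psi> (?E (fst p) (snd p)))" for M
    using linear_functional_expand[of \<psi> M] assms(4,5)
    by (simp add: sum.cartesian_product split_beta)
  have "(\<Sum>a\<in>UNIV. \<phi> (N a) * \<psi> (N' a))
      = (\<Sum>a\<in>UNIV. \<Sum>p\<in>?S. \<Sum>q\<in>?S. (N a $ fst p $ snd p * N' a $ fst q $ snd q)
          * (\<phi> (?E (fst p) (snd p)) * \<psi> (?E (fst q) (snd q))))"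
    by (subst \<phi>, subst \<psi>) (simp add: sum_product mult_ac)
  also have "\<dots> = (\<Sum>p\<in>?S. \<Sum>a\<in>UNIV. \<Sum>q\<in>?S. (N a $ fst p $ snd p * N' a $ fst q $ snd q)
          * (\<phi> (?E (fst p) (snd p)) * \<psi> (?E (fst q) (snd q))))"
    by (rule sum.swap)
  also have "\<dots> = (\<Sum>p\<in>?S. \<Sum>q\<in>?S. \<Sum>a\<in>UNIV. (N a $ fst p $ snd p * N' a $ fst q $ snd q)
          * (\<phi> (?E (fst p) (snd p)) * \<psi> (?E (fst q) (snd q))))"
    by (rule sum.cong[OF refl], rule sum.swap)
  also have "\<dots> = 0"
    by (simp add: assms(1) flip: sum_distrib_right)
  finally show ?thesis .
qed

lemma cliff_zero: "cliff_plus 0 M = 0" "cliff_minus 0 M = 0" "cliff_plus v 0 = 0" "cliff_minus v 0 = 0"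
  by (cases v; simp add: vec_eq_iff cliff_nth omul_linear zero_prod_def column_def row_def flip: zero_vec_def)+

lemma cliff_dual_expansion_entry:
  assumes "v \<in> V7 \<times> V7"
  shows "(\<Sum>a\<in>UNIV. bil14 v (dual14 a) * cliff_plus (basis14 a) M $ i $ j) = cliff_plus v M $ i $ j"
    and "(\<Sum>a\<in>UNIV. bil14 v (basis14 a) * cliff_plus (dual14 a) M $ i $ j) = cliff_plus v M $ i $ j"
proof -
  obtain x y where v: "v = (x, y)" "x \<in> V7" "y \<in> V7"
    using assms by auto
  have omul_expand: "(\<Sum>a\<in>UNIV. obil z (g a) * omul (f a) w $ k) = omul z w $ k"
    if "(\<Sum>a\<in>UNIV. obil z (g a) *s f a) = z" for z f g w k
  proof -
    have "omul (\<Sum>a\<in>UNIV. obil z (g a) *s f a) w $ k = (\<Sum>a\<in>UNIV. obil z (g a) * omul (f a) w $ k)"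
      by (simp only: omul_sum_left sum_component omul_linear vector_smult_component)
    then show ?thesis
      using that by simp
  qed
  have ii: "(\<Sum>a\<in>A. c a * (\<i> * d a)) = \<i> * (\<Sum>a\<in>A. c a * d a)" for c d and A :: "8 set"
    by (simp add: sum_distrib_left mult_ac)
  show "(\<Sum>a\<in>UNIV. bil14 v (dual14 a) * cliff_plus (basis14 a) M $ i $ j) = cliff_plus v M $ i $ j"
    by (simp add: v sum_8_8 cliff_nth bil14_def obil_linear omul_linear ii
        omul_expand[OF V7_dual_expansion(1)[OF v(2)]] omul_expand[OF V7_dual_expansion(1)[OF v(3)]])
  show "(\<Sum>a\<in>UNIV. bil14 v (basis14 a) * cliff_plus (dual14 a) M $ i $ j) = cliff_plus v M $ i $ j"
    by (simp add: v sum_8_8 cliff_nth bil14_def obil_linear omul_linear ii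
        omul_expand[OF V7_dual_expansion(2)[OF v(2)]] omul_expand[OF V7_dual_expansion(2)[OF v(3)]])
qed

lemma basis14_V14: "basis14 a \<in> V7 \<times> V7" "dual14 a \<in> V7 \<times> V7"
proof -
  have "0 \<in> V7" by (simp add: V7_def)
  then show "basis14 a \<in> V7 \<times> V7" "dual14 a \<in> V7 \<times> V7"
    by (cases a; simp add: imag_V7)+
qed

lemma sum_obil_dual:
  assumes "v \<in> V7" "w \<in> V7"
  shows "(\<Sum>a\<in>UNIV. obil v (imag (axis a 1)) * obil w (imag (odual a))) = obil v w"
  using assms unfolding V7_def add_eq_0_iff mem_Collect_eq
  by (simp add: sum_8 imag_def odual_def axis_nth obil_def)

lemma sum_bil14_dual:
  assumes "v \<in> V7 \<times> V7" "w \<in> V7 \<times> V7"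
  shows "(\<Sum>a\<in>UNIV. bil14 v (basis14 a) * bil14 w (dual14 a)) = bil14 v w"
  using assms by (cases v; cases w) (simp add: sum_8_8 bil14_def sum_obil_dual obil_linear)

text \<open>
  \<open>cliff_plus\<close> and \<open>cliff_minus\<close> differ in the sign of the imaginary unit, which occurs twice
  in every summand or not at all.
\<close>

lemma pure_spinor_minus:
  "pure_spinor M \<longleftrightarrow> (\<forall>i j k l.
     (\<Sum>a\<in>UNIV. cliff_minus (basis14 a) M $ i $ j * cliff_minus (dual14 a) M $ k $ l) = 0)"
  by (simp add: pure_spinor_def sum_8_8 cliff_nth omul_linear)

text \<open>
  Moving \<open>e\<^sub>a\<close> and \<open>f\<^sub>a\<close> past \<open>v\<close> with the Clifford relation turns the sum for \<open>v M\<close> into the image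
  of the sum for \<open>M\<close> under \<open>v \<otimes> v\<close>, which vanishes, and three multiples of \<open>M \<otimes> M\<close>, with the
  coefficients \<open>-q\<close>, \<open>-q\<close> and \<open>2 q\<close>, where \<open>q = quad14 v\<close>.
\<close>

lemma pure_spinor_cliff_plus:
  assumes v: "v \<in> V7 \<times> V7" and M: "pure_spinor M"
  shows "pure_spinor (cliff_plus v M)"
  unfolding pure_spinor_minus
proof (intro allI)
  fix i j k l :: 8
  let ?X = "\<lambda>i j e. cliff_minus v (cliff_plus e M) $ i $ j"
  let ?e = "basis14" and ?f = "dual14"
  have swap: "cliff_minus e (cliff_plus v M) $ i $ j = - (?X i j e + bil14 v e * M $ i $ j)"
    if "e \<in> V7 \<times> V7" for e i j
    using cliff_anticommute(1)[OF that v, of M] by (simp add: cscale_nth bil14_sym)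
  have XX: "(\<Sum>a\<in>UNIV. ?X i j (?e a) * ?X k l (?f a)) = 0"
    using M by (intro tensor_vanishing_functional[where \<phi> = "\<lambda>N. cliff_minus v N $ i $ j"
          and \<psi> = "\<lambda>N. cliff_minus v N $ k $ l"])
      (simp_all add: pure_spinor_def cliff_linear cscale_nth)
  have expand: "(\<Sum>a\<in>UNIV. b a * ?X i j (c a)) = - quad14 v * M $ i $ j"
    if *: "\<And>i j. (\<Sum>a\<in>UNIV. b a * cliff_plus (c a) M $ i $ j) = cliff_plus v M $ i $ j"
    for b c i j
  proof -
    have sum: "cliff_minus v (\<Sum>a\<in>A. cscale (b a) (cliff_plus (c a) M)) $ i $ j
        = (\<Sum>a\<in>A. b a * ?X i j (c a))" for A
      by (induction A rule: infinite_finite_induct) (simp_all add: cliff_linear cliff_zero cscale_nth)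
    have "(\<Sum>a\<in>UNIV. cscale (b a) (cliff_plus (c a) M)) = cliff_plus v M"
      using * by (simp add: vec_eq_iff cscale_nth)
    then show ?thesis
      using sum[of UNIV] by (simp add: cliff_relation[OF v] cscale_nth)
  qed
  note eX = expand[of "\<lambda>a. bil14 v (?f a)" ?e, OF cliff_dual_expansion_entry(1)[OF v]]
  note fX = expand[of "\<lambda>a. bil14 v (?e a)" ?f, OF cliff_dual_expansion_entry(2)[OF v]]
  have "(\<Sum>a\<in>UNIV. cliff_minus (?e a) (cliff_plus v M) $ i $ j * cliff_minus (?f a) (cliff_plus v M) $ k $ l)
    = (\<Sum>a\<in>UNIV. ?X i j (?e a) * ?X k l (?f a) + bil14 v (?f a) * ?X i j (?e a) * M $ k $ l
        + bil14 v (?e a) * ?X k l (?f a) * M $ i $ j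
        + bil14 v (?e a) * bil14 v (?f a) * (M $ i $ j * M $ k $ l))"
    by (simp add: swap basis14_V14 algebra_simps)
  also have "\<dots> = 0"
    by (simp add: sum.distrib XX eX fX sum_bil14_dual[OF v v] bil14_self flip: sum_distrib_right)
  finally show "(\<Sum>a\<in>UNIV. cliff_minus (?e a) (cliff_plus v M) $ i $ j
      * cliff_minus (?f a) (cliff_plus v M) $ k $ l) = 0" .
qed

lemma pure_spinor_cliff_minus:
  assumes "v \<in> V7 \<times> V7" "pure_spinor M"
  shows "pure_spinor (cliff_minus v M)"
proof -
  obtain a b where v: "v = (a, b)" by force
  have "cliff_minus (a, b) M = cliff_plus (a, - b) M"
    by (simp add: vec_eq_iff cliff_nth omul_linear)
  moreover have "(a, - b) \<in> V7 \<times> V7"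
    using assms(1) by (simp add: v V7_def add_eq_0_iff)
  ultimately show ?thesis
    using pure_spinor_cliff_plus[OF _ assms(2)] v by metis
qed

lemma pure_spinor_spin14:
  assumes "g \<in> spin14" "pure_spinor M"
  shows "pure_spinor (g M)"
  using assms by induction (simp_all add: pure_spinor_cliff_plus pure_spinor_cliff_minus)

text \<open>
  The coordinates of \<open>\<Sum> e\<^sub>a x \<otimes> f\<^sub>a y\<close> over dual bases of all octonions.  The unit contributes
  half of \<open>x \<otimes> y\<close>, and this part is the same for the two factors of the spin module, so Cartan's
  equation may be written with octonions in place of imaginary octonions.
\<close>

definition casimir :: "octonion \<Rightarrow> octonion \<Rightarrow> 8 \<Rightarrow> 8 \<Rightarrow> complex" where
  "casimir x y i k = (\<Sum>a\<in>UNIV. omul (axis a 1) x $ i * omul (odual a) y $ k)"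

lemma casimir_V7:
  "(\<Sum>a\<in>UNIV. omul (imag (axis a 1)) x $ i * omul (imag (odual a)) y $ k)
     = casimir x y i k - x$i * y$k / 2"
proof -
  have imag: "omul (imag z) x $ i = omul z x $ i - (z$1 + z$8) / 2 * x$i" for x z :: octonion and i
    by (simp add: imag_def omul_linear omul_oone)
  have unit: "omul (axis 8 1) z $ i = z$i - omul (axis 1 1) z $ i" for z i
  proof -
    have "omul (axis 1 1) z + omul (axis 8 1) z = z"
      by (simp add: octonion_eq_iff axis_nth)
    then show ?thesis
      by (metis add_diff_cancel_left' vector_add_component)
  qed
  show ?thesis
    unfolding casimir_def sum_8 odual_def vector_8 imag
    by (simp add: axis_nth omul_linear unit field_simps)
qed

lemma casimir_linear:
  "casimir (x + x') y i k = casimir x y i k + casimir x' y i k"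
  "casimir x (y + y') i k = casimir x y i k + casimir x y' i k"
  "casimir (c *s x) y i k = c * casimir x y i k"
  "casimir x (c *s y) i k = c * casimir x y i k"
  by (simp_all only: casimir_def omul_linear vector_add_component vector_smult_component
      sum_distrib_left sum.distrib distrib_left distrib_right mult_ac)

text \<open>
  A tensor \<open>x \<otimes> x\<close> is the sum of a multiple of the invariant form and a vector of the Cartan
  square of a half-spin representation of \<open>Spin\<^sub>8\<close>; only the former contributes.
\<close>

lemma casimir_self: "casimir x x i k = onorm2 x * odual i $ k"
proof -
  have "\<forall>i k. casimir x x i k = onorm2 x * odual i $ k"
    unfolding forall_8 casimir_def sum_8 odual_def vector_8 omul_nth onorm2_def
    by (simp add: axis_nth algebra_simps)
  then show ?thesis by blast
qed

lemma pure_spinor_casimir: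
  "pure_spinor M \<longleftrightarrow>
     (\<forall>i j k l. casimir (column j M) (column l M) i k = casimir (row i M) (row k M) j l)"
proof -
  have "(\<Sum>a\<in>UNIV. cliff_plus (basis14 a) M $ i $ j * cliff_plus (dual14 a) M $ k $ l)
      = casimir (column j M) (column l M) i k - casimir (row i M) (row k M) j l" for i j k l
  proof -
    have ii: "\<i> * x * (\<i> * y) = - (x * y)" for x y
    proof -
      have "\<i> * x * (\<i> * y) = \<i> * \<i> * (x * y)"
        by (simp only: mult_ac)
      then show ?thesis by simp
    qed
    have col: "column j M $ i = M$i$j" "row i M $ j = M$i$j" for i j
      by (simp_all add: column_def row_def)
    show ?thesis
      by (simp add: sum_8_8 cliff_nth omul_linear casimir_V7 ii sum_negf col)
  qed
  then show ?thesis
    by (simp add: pure_spinor_def)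
qed

lemma tensor_nth: "tensor x y $ i $ j = x$i * y$j"
  by (simp add: tensor_def)

lemma column_row_tensor: "column j (tensor x y) = y$j *s x" "row i (tensor x y) = x$i *s y"
  by (simp_all add: column_def row_def tensor_def vec_eq_iff)

lemma pure_spinor_tensor:
  assumes "onorm2 x = 0" "onorm2 y = 0"
  shows "pure_spinor (tensor x y)"
  by (simp add: pure_spinor_casimir column_row_tensor casimir_linear casimir_self assms)

text \<open>
  The dual basis has zero diagonal coordinates but no zero vector, so for suitable indices one
  side of Cartan's equation for \<open>x \<otimes> y\<close> vanishes and the other is a nonzero multiple of a norm.
\<close>

lemma pure_spinor_tensorD:
  assumes "pure_spinor (tensor x y)" "tensor x y \<noteq> 0"
  shows "onorm2 x = 0 \<and> onorm2 y = 0"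
proof -
  obtain p q where pq: "x$p \<noteq> 0" "y$q \<noteq> 0"
    using assms(2) by (auto simp: vec_eq_iff tensor_nth)
  have eq: "y$j * y$l * (onorm2 x * odual i $ k) = x$i * x$k * (onorm2 y * odual j $ l)" for i j k l
  proof -
    have "casimir (y$j *s x) (y$l *s x) i k = casimir (x$i *s y) (x$k *s y) j l"
      using assms(1) by (simp add: pure_spinor_casimir column_row_tensor)
    then show ?thesis
      by (simp only: casimir_linear casimir_self mult_ac)
  qed
  have diag: "odual a $ a = 0" and nz: "\<exists>b. odual a $ b \<noteq> 0" for a
  proof -
    have "\<forall>a. odual a $ a = 0"
      by (simp add: forall_8 odual_def axis_nth)
    then show "odual a $ a = 0" by blast
    have "\<forall>a. odual a \<noteq> 0"
      by (simp add: forall_8 odual_def)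
    then show "\<exists>b. odual a $ b \<noteq> 0"
      by (metis vec_eq_iff zero_index)
  qed
  from nz obtain b where "odual p $ b \<noteq> 0" by blast
  then have "onorm2 x = 0"
    using eq[of q q p b] pq diag[of q] by simp
  moreover from nz obtain b where "odual q $ b \<noteq> 0" by blast
  then have "onorm2 y = 0"
    using eq[of q b p p] pq diag[of p] by simp
  ultimately show ?thesis by blast
qed

lemma spin14_linear:
  assumes "g \<in> spin14"
  shows "g (M + N) = g M + g N" "g (cscale c M) = cscale c (g M)"
  using assms by (induction arbitrary: M N c) (simp_all add: cliff_linear)

lemma spin14_comp: "g \<in> spin14 \<Longrightarrow> h \<in> spin14 \<Longrightarrow> g \<circ> h \<in> spin14"
proof (induction rule: spin14.induct)
  case (spin14_mult v w g)
  then show ?case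
    using spin14.spin14_mult[OF spin14_mult.hyps(1-4), of "g \<circ> h"] by (simp only: comp_assoc)
qed simp

lemma spin14_pair:
  "v \<in> V7 \<times> V7 \<Longrightarrow> w \<in> V7 \<times> V7 \<Longrightarrow> quad14 v = 1 \<Longrightarrow> quad14 w = 1 \<Longrightarrow>
     (\<lambda>M. cliff_minus v (cliff_plus w M)) \<in> spin14"
  using spin14_mult[OF _ _ _ _ spin14_id] by (simp add: comp_def)

lemma spin14_inverse:
  assumes "g \<in> spin14"
  obtains h where "h \<in> spin14" "\<And>M. h (g M) = M" "\<And>M. g (h M) = M"
proof -
  have "\<exists>h\<in>spin14. (\<forall>M. h (g M) = M) \<and> (\<forall>M. g (h M) = M)"
    using assms
  proof induction
    case spin14_id
    then show ?case by (intro bexI[of _ id]) (simp_all add: spin14.spin14_id)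
  next
    case (spin14_mult v w g)
    then obtain h where h: "h \<in> spin14" "\<And>M. h (g M) = M" "\<And>M. g (h M) = M" by blast
    have neg: "cliff_plus v (- M) = - cliff_plus v M" "cliff_minus v (- M) = - cliff_minus v M" for v M
      using cliff_linear(2)[of v "-1" M] cliff_linear(4)[of v "-1" M] by simp_all
    let ?h = "h \<circ> (\<lambda>M. cliff_minus w (cliff_plus v M))"
    have "?h \<in> spin14"
      using spin14_mult h by (intro spin14_comp spin14_pair)
    moreover have "?h ((cliff_minus v \<circ> cliff_plus w \<circ> g) M) = M"
      "(cliff_minus v \<circ> cliff_plus w \<circ> g) (?h M) = M" for M
      using spin14_mult(1-4) h by (simp_all add: cliff_relation neg)
    ultimately show ?case by blast
  qed
  then show ?thesis using that by blast
qed

lemma V7_minus: "- x \<in> V7 \<longleftrightarrow> x \<in> V7"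
proof -
  have "(- x)$1 + (- x)$8 = - (x$1 + x$8)" by simp
  then show ?thesis
    by (simp only: V7_def mem_Collect_eq neg_equal_0_iff_equal)
qed

lemma onorm2_minus: "onorm2 (- x) = onorm2 x"
  by (simp add: onorm2_def)

section \<open>Transitivity of the spin group on pure spinors\<close>

lemma column_row_nth [simp]: "column j M $ i = M$i$j" "row i M $ j = M$i$j" for M :: spinor
  by (simp_all add: column_def row_def)

lemma transpose_nth: "transpose M $ i $ j = M$j$i"
  by (simp add: transpose_def)

text \<open>
  Transposition exchanges the two factors of the spin module.  It takes Clifford multiplication
  by \<open>(a, b)\<close> to that by \<open>(b, -a)\<close>, up to the scalars \<open>\<i>\<close> and \<open>-\<i>\<close>, which cancel in pairs.
  Statements about rows thus yield statements about columns.
\<close>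

lemma spin14_transpose:
  assumes "g \<in> spin14"
  shows "(\<lambda>M. transpose (g (transpose M))) \<in> spin14"
  using assms
proof induction
  case spin14_id
  then show ?case by (simp add: spin14.spin14_id flip: id_def)
next
  case (spin14_mult v w g)
  obtain a b a' b' where vw: "v = (a, b)" "w = (a', b')" by (metis surj_pair)
  have tr: "transpose (cliff_plus (x, y) M) = cscale \<i> (cliff_plus (y, - x) (transpose M))"
    "transpose (cliff_minus (x, y) M) = cscale (- \<i>) (cliff_minus (y, - x) (transpose M))" for x y M
    by (simp_all add: vec_eq_iff transpose_nth cliff_nth cscale_nth omul_linear column_transpose
        row_transpose distrib_left right_diff_distrib flip: mult.assoc)
  have "(\<lambda>M. cliff_minus (b, - a) (cliff_plus (b', - a') M)) \<in> spin14"
    using spin14_mult(1-4) by (intro spin14_pair)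
      (simp_all add: vw V7_minus quad14_def onorm2_minus add.commute)
  then have "(\<lambda>M. cliff_minus (b, - a) (cliff_plus (b', - a') M)) \<circ> (\<lambda>M. transpose (g (transpose M))) \<in> spin14"
    using spin14_mult(6) by (rule spin14_comp)
  moreover have "transpose (cliff_minus v (cliff_plus w M)) = cliff_minus (b, - a) (cliff_plus (b', - a') (transpose M))" for M
    by (simp add: vw tr cliff_linear)
  ultimately show ?case
    by (simp add: comp_def)
qed

text \<open>
  The imaginary octonion of weight 0 for the diagonal torus of \<open>G2\<close>; it has norm -1.
\<close>

definition h7 :: octonion where
  "h7 = vector [1, 0, 0, 0, 0, 0, 0, -1]"

lemma h7_nth [simp]: "h7 $ 1 = 1" "h7 $ 2 = 0" "h7 $ 3 = 0" "h7 $ 4 = 0"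
    "h7 $ 5 = 0" "h7 $ 6 = 0" "h7 $ 7 = 0" "h7 $ 8 = -1"
  by (simp_all add: h7_def)

text \<open>
  For \<open>k = 2, 3, 4\<close> left multiplication by \<open>axis k 1 - axis (k + 3) 1\<close> permutes the eight
  coordinates up to sign
  and \<open>\<i> h7\<close> acts diagonally; both are unit vectors.  The products of the two represent elements of
  the Weyl group, and chains of them lead from every coordinate to the first one.
\<close>

lemma spin14_move_row: "\<exists>g\<in>spin14. \<exists>c. c \<noteq> 0 \<and> (\<forall>M j. g M $ 1 $ j = c * M $ i $ j)"
proof -
  define P where "P i k \<longleftrightarrow> (\<exists>g\<in>spin14. \<exists>c. c \<noteq> 0 \<and> (\<forall>M j. g M $ k $ j = c * M $ i $ j))" for i k :: 8
  have trans: "P i l" if ik: "P i k" and kl: "P k l" for i k l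
  proof -
    obtain g c where g: "g \<in> spin14" "c \<noteq> 0" "\<And>M j. g M $ k $ j = c * M $ i $ j"
      using ik unfolding P_def by blast
    obtain g' c' where g': "g' \<in> spin14" "c' \<noteq> 0" "\<And>M j. g' M $ l $ j = c' * M $ k $ j"
      using kl unfolding P_def by blast
    show ?thesis
      unfolding P_def using g g'
      by (intro bexI[OF _ spin14_comp[OF g'(1) g(1)]] exI[of _ "c' * c"]) simp
  qed
  have ih: "(\<i> *s h7, 0) \<in> V7 \<times> V7" "quad14 (\<i> *s h7, 0) = 1"
    by (simp_all add: V7_def quad14_def onorm2_def)
  have step: "P i k" if "(w, 0) \<in> V7 \<times> V7" "quad14 (w, 0) = 1" "c \<noteq> 0"
    "\<forall>M j. cliff_minus (\<i> *s h7, 0) (cliff_plus (w, 0) M) $ k $ j = c * M $ i $ j" for w c i k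
    unfolding P_def using that spin14_pair[OF ih(1) that(1) ih(2) that(2)]
    by (intro bexI[of _ "\<lambda>M. cliff_minus (\<i> *s h7, 0) (cliff_plus (w, 0) M)"] exI[of _ c]) auto
  have 51: "P 5 1" and 37: "P 3 7" and 46: "P 4 6" and 82: "P 8 2"
    using step[where w = "axis 2 1 - axis 5 1" and c = \<i> and i = 5 and k = 1] step[where w = "axis 2 1 - axis 5 1" and c = "- \<i>" and i = 3 and k = 7]
      step[where w = "axis 2 1 - axis 5 1" and c = \<i> and i = 4 and k = 6] step[where w = "axis 2 1 - axis 5 1" and c = \<i> and i = 8 and k = 2]
    by (simp_all add: V7_def quad14_def onorm2_def axis_nth cliff_nth omul_linear)
  have 61: "P 6 1" and 27: "P 2 7"
    using step[where w = "axis 3 1 - axis 6 1" and c = \<i> and i = 6 and k = 1] step[where w = "axis 3 1 - axis 6 1" and c = \<i> and i = 2 and k = 7]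
    by (simp_all add: V7_def quad14_def onorm2_def axis_nth cliff_nth omul_linear)
  have 71: "P 7 1"
    using step[where w = "axis 4 1 - axis 7 1" and c = \<i> and i = 7 and k = 1]
    by (simp_all add: V7_def quad14_def onorm2_def axis_nth cliff_nth omul_linear)
  have 11: "P 1 1"
    unfolding P_def by (intro bexI[OF _ spin14_id] exI[of _ 1]) simp
  have "P i 1"
    using exhaust_8[of i] 11 51 61 71 trans[OF 37 71] trans[OF 46 61] trans[OF 27 71]
      trans[OF 82 trans[OF 27 71]]
    by auto
  then show ?thesis by (simp add: P_def)
qed

lemma spin14_move_entry: "\<exists>g\<in>spin14. \<exists>c. c \<noteq> 0 \<and> (\<forall>M. g M $ 1 $ 1 = c * M $ i $ j)"
proof -
  obtain g c where g: "g \<in> spin14" "c \<noteq> 0" "\<And>M j. g M $ 1 $ j = c * M $ i $ j"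
    using spin14_move_row[of i] by blast
  obtain g' c' where g': "g' \<in> spin14" "c' \<noteq> 0" "\<And>M k. g' M $ 1 $ k = c' * M $ j $ k"
    using spin14_move_row[of j] by blast
  show ?thesis
    using g g' spin14_comp[OF spin14_transpose[OF g'(1)] g(1)]
    by (intro bexI[OF _ spin14_comp[OF spin14_transpose[OF g'(1)] g(1)]] exI[of _ "c' * c"])
      (simp add: transpose_nth)
qed

lemma V14_minus: "v \<in> V7 \<times> V7 \<Longrightarrow> - v \<in> V7 \<times> V7"
  by (cases v) (simp add: V7_def add_eq_0_iff)

lemma cliff_neg:
  "cliff_plus (- v) M = - cliff_plus v M" "cliff_minus (- v) M = - cliff_minus v M"
  "cliff_plus v (- M) = - cliff_plus v M" "cliff_minus v (- M) = - cliff_minus v M"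
proof -
  obtain a b where v: "v = (a, b)" by force
  show "cliff_plus (- v) M = - cliff_plus v M" "cliff_minus (- v) M = - cliff_minus v M"
    by (simp_all add: v vec_eq_iff cliff_nth omul_linear)
  show "cliff_plus v (- M) = - cliff_plus v M" "cliff_minus v (- M) = - cliff_minus v M"
    using cliff_linear(2)[of v "-1" M] cliff_linear(4)[of v "-1" M] by simp_all
qed

lemma quad14_minus: "quad14 (- v) = quad14 v"
  by (simp add: quad14_def onorm2_def)

text \<open>
  If \<open>e\<close> and \<open>n\<close> span an isotropic plane, the element \<open>e n\<close> of the Clifford algebra has square 0, and
  its exponential \<open>1 + e n\<close> is in the spin group.  Any unit vector \<open>z\<close> orthogonal to the plane
  gives a factorisation into unit vectors, \<open>1 + e n = z (- z - m) (z + e) (- z + n)\<close> where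
  \<open>m = n + e\<close>.
\<close>

lemma spin14_unipotent:
  assumes V: "e \<in> V7 \<times> V7" "n \<in> V7 \<times> V7" "z \<in> V7 \<times> V7"
    and q: "quad14 e = 0" "quad14 n = 0" "quad14 z = 1"
    and B: "bil14 e n = 0" "bil14 z e = 0" "bil14 z n = 0"
  shows "(\<lambda>M. M + cliff_minus e (cliff_plus n M)) \<in> spin14"
proof -
  \<comment> \<open>\<open>z (- z - m) = 1 - z m\<close> and \<open>(z + e) (- z + n) = 1 + z m + e n\<close>\<close>
  define m where "m = n + e"
  have m: "m \<in> V7 \<times> V7" "quad14 m = 0" "bil14 z m = 0" "bil14 m e = 0" "bil14 m n = 0"
    using V q B by (simp_all add: m_def V14_add quad14_add bil14_linear bil14_sym[of n e] bil14_self)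
  note rel = cliff_relation[OF V(1)] cliff_relation[OF V(2)] cliff_relation[OF V(3)] cliff_relation[OF m(1)]
  have z0: "cscale 0 N = 0" "cscale (-1) N = - N" for N
    by (simp_all add: vec_eq_iff cscale_nth)
  have g1: "(\<lambda>M. cliff_minus (z + e) (cliff_plus (- z + n) M)) \<in> spin14"
    by (intro spin14_pair V14_add V14_minus V; simp only: quad14_add quad14_minus bil14_linear q B) simp_all
  have g2: "(\<lambda>M. cliff_minus z (cliff_plus (- z + - m) M)) \<in> spin14"
    by (intro spin14_pair V14_add V14_minus V m(1); simp only: quad14_add quad14_minus bil14_linear q m) simp_all
  have "cliff_minus z (cliff_plus (- z + - m) (cliff_minus (z + e) (cliff_plus (- z + n) M)))
      = M + cliff_minus e (cliff_plus n M)" for M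
  proof -
    have ez: "cliff_minus e (cliff_plus z N) = - cliff_minus z (cliff_plus e N)" for N
      using cliff_anticommute(1)[OF V(1,3), of N] B by (simp add: bil14_sym[of e z] z0)
    have a: "cliff_minus (z + e) (cliff_plus (- z + n) M)
        = M + cliff_minus z (cliff_plus m M) + cliff_minus e (cliff_plus n M)"
      by (simp only: cliff_add cliff_neg cliff_linear m_def) (simp add: rel q z0 ez)
    have b: "cliff_minus z (cliff_plus (- z + - m) N) = N - cliff_minus z (cliff_plus m N)" for N
      by (simp only: cliff_add cliff_neg cliff_linear) (simp add: rel q z0)
    have mz: "cliff_plus m (cliff_minus z N) = - cliff_plus z (cliff_minus m N)" for N
      using cliff_anticommute(2)[OF m(1) V(3), of N] m by (simp add: bil14_sym[of m z] z0)
    have me: "cliff_plus m (cliff_minus e N) = - cliff_plus e (cliff_minus m N)" for N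
      using cliff_anticommute(2)[OF m(1) V(1), of N] m by (simp add: z0)
    have mn: "cliff_minus m (cliff_plus n N) = cliff_minus e (cliff_plus n N)" for N
      by (simp add: m_def cliff_add rel q z0)
    have c: "cliff_minus z (cliff_plus m (cliff_minus z (cliff_plus m M))) = 0"
      by (simp add: mz rel m z0 cliff_zero)
    have d: "cliff_minus z (cliff_plus m (cliff_minus e (cliff_plus n M))) = 0"
      by (simp add: me mn rel q z0 cliff_zero cliff_neg)
    show ?thesis
      unfolding a b by (simp only: cliff_linear c d) (simp add: c)
  qed
  then show ?thesis
    using spin14_comp[OF g2 g1] by (simp add: comp_def)
qed

text \<open>
  The spin module is the exterior algebra of a maximal isotropic subspace of \<open>V\<^sub>1\<^sub>4\<close>, applied
  to the vector annihilated by a complementary one.  Here this vector has its only nonzero entry at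
  \<open>(1, 1)\<close>, and the isotropic subspace is spanned by \<open>(axis i 1, 0)\<close> and \<open>(0, axis i 1)\<close> for
  \<open>i = 5, 6, 7\<close> and \<open>(h7, - \<i> *s h7)\<close>.  The part of degree 2 of the exterior algebra has
  dimension 21 and occupies the following entries.
\<close>

definition deg2 :: "(8 \<times> 8) set" where
  "deg2 = {(2,1), (3,1), (4,1), (5,1), (6,1), (7,1), (1,2), (1,3), (1,4), (1,5), (1,6), (1,7),
     (5,5), (5,6), (5,7), (6,5), (6,6), (6,7), (7,5), (7,6), (7,7)}"

text \<open>
  The group element is allowed to depend on \<open>M\<close>.  As it changes no other entry of degree 2, entries
  can be cleared one after the other.
\<close>

definition clears :: "(8 \<times> 8) set \<Rightarrow> bool" where
  "clears S \<longleftrightarrow> (\<forall>M. M$1$1 = 1 \<longrightarrow> (\<exists>g\<in>spin14. g M $1$1 = 1 \<and>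
     (\<forall>i j. (i,j) \<in> S \<longrightarrow> g M $i$j = 0) \<and> (\<forall>i j. (i,j) \<in> deg2 - S \<longrightarrow> g M $i$j = M$i$j)))"

lemma clears_Un:
  assumes S: "clears S" and T: "clears T"
  shows "clears (S \<union> T \<inter> deg2)"
  unfolding clears_def
proof (intro allI impI)
  fix M :: spinor assume "M$1$1 = 1"
  then obtain g where g: "g \<in> spin14" "g M $1$1 = 1"
     "\<And>i j. (i,j) \<in> T \<Longrightarrow> g M $i$j = 0" "\<And>i j. (i,j) \<in> deg2 - T \<Longrightarrow> g M $i$j = M$i$j"
    using T unfolding clears_def by metis
  then obtain h where h: "h \<in> spin14" "h (g M) $1$1 = 1"
     "\<And>i j. (i,j) \<in> S \<Longrightarrow> h (g M) $i$j = 0" "\<And>i j. (i,j) \<in> deg2 - S \<Longrightarrow> h (g M) $i$j = g M$i$j"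
    using S unfolding clears_def by metis
  show "\<exists>g\<in>spin14. g M $1$1 = 1 \<and> (\<forall>i j. (i,j) \<in> S \<union> T \<inter> deg2 \<longrightarrow> g M $i$j = 0) \<and>
      (\<forall>i j. (i,j) \<in> deg2 - (S \<union> T \<inter> deg2) \<longrightarrow> g M $i$j = M$i$j)"
  proof (intro bexI[OF _ spin14_comp[OF h(1) g(1)]] conjI allI impI)
    show "(h \<circ> g) M $1$1 = 1" using h by simp
    show "(h \<circ> g) M $i$j = 0" if "(i, j) \<in> S \<union> T \<inter> deg2" for i j
      using that g(3)[of i j] h(3)[of i j] h(4)[of i j] by (cases "(i, j) \<in> S") auto
    show "(h \<circ> g) M $i$j = M$i$j" if "(i, j) \<in> deg2 - (S \<union> T \<inter> deg2)" for i j
      using that g(4)[of i j] h(4)[of i j] by auto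
  qed
qed

lemma clears_transpose:
  assumes "clears S"
  shows "clears (prod.swap ` S)"
  unfolding clears_def
proof (intro allI impI)
  fix M :: spinor assume "M$1$1 = 1"
  then have "transpose M$1$1 = 1" by (simp add: transpose_nth)
  then obtain g where g: "g \<in> spin14" "g (transpose M) $1$1 = 1"
     "\<And>i j. (i,j) \<in> S \<Longrightarrow> g (transpose M) $i$j = 0"
     "\<And>i j. (i,j) \<in> deg2 - S \<Longrightarrow> g (transpose M) $i$j = transpose M$i$j"
    using assms unfolding clears_def by metis
  have swap: "(j, i) \<in> deg2 - S" if "(i, j) \<in> deg2 - prod.swap ` S" for i j
  proof -
    have "prod.swap ` deg2 \<subseteq> deg2"
      by (simp add: deg2_def)
    then show ?thesis using that by (auto simp: image_iff)
  qed
  show "\<exists>g\<in>spin14. g M $1$1 = 1 \<and> (\<forall>i j. (i,j) \<in> prod.swap ` S \<longrightarrow> g M $i$j = 0) \<and>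
      (\<forall>i j. (i,j) \<in> deg2 - prod.swap ` S \<longrightarrow> g M $i$j = M$i$j)"
  proof (intro bexI[OF _ spin14_transpose[OF g(1)]] conjI allI impI)
    show "transpose (g (transpose M)) $1$1 = 1" using g by (simp add: transpose_nth)
    show "transpose (g (transpose M)) $i$j = 0" if "(i, j) \<in> prod.swap ` S" for i j
      using that g(3)[of j i] by (auto simp: transpose_nth)
    show "transpose (g (transpose M)) $i$j = M$i$j" if "(i, j) \<in> deg2 - prod.swap ` S" for i j
      using g(4)[OF swap[OF that]] by (simp add: transpose_nth)
  qed
qed

text \<open>
  If \<open>e\<close> and \<open>n\<close> are in the isotropic subspace that generates the exterior algebra, then \<open>1 + e n\<close>
  adds to the part of degree 2 the bivector \<open>e \<and> n\<close> multiplied by the entry at \<open>(1, 1)\<close>.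
\<close>

lemma clearsI:
  fixes e n :: "spinor \<Rightarrow> octonion \<times> octonion"
  assumes V: "\<And>M. e M \<in> V7 \<times> V7" "\<And>M. n M \<in> V7 \<times> V7" "z \<in> V7 \<times> V7"
    and q: "\<And>M. quad14 (e M) = 0" "\<And>M. quad14 (n M) = 0" "quad14 z = 1"
    and B: "\<And>M. bil14 (e M) (n M) = 0" "\<And>M. bil14 z (e M) = 0" "\<And>M. bil14 z (n M) = 0"
    and S: "S \<subseteq> deg2" and 11: "\<And>M. cliff_minus (e M) (cliff_plus (n M) M) $ 1 $ 1 = 0"
    and eff: "\<And>M. M$1$1 = 1 \<Longrightarrow> \<forall>(i,j)\<in>deg2.
       cliff_minus (e M) (cliff_plus (n M) M) $ i $ j = (if (i,j) \<in> S then - M$i$j else 0)"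
  shows "clears S"
  unfolding clears_def
proof (intro allI impI)
  fix M :: spinor assume M: "M$1$1 = 1"
  let ?N = "cliff_minus (e M) (cliff_plus (n M) M)"
  have entry: "?N $ i $ j = (if (i,j) \<in> S then - M$i$j else 0)" if "(i, j) \<in> deg2" for i j
    using bspec[OF eff[OF M] that] by simp
  show "\<exists>g\<in>spin14. g M $1$1 = 1 \<and> (\<forall>i j. (i,j) \<in> S \<longrightarrow> g M $i$j = 0) \<and>
      (\<forall>i j. (i,j) \<in> deg2 - S \<longrightarrow> g M $i$j = M$i$j)"
  proof (intro bexI[of _ "\<lambda>L. L + cliff_minus (e M) (cliff_plus (n M) L)"] conjI allI impI)
    show "(\<lambda>L. L + cliff_minus (e M) (cliff_plus (n M) L)) \<in> spin14"
      by (intro spin14_unipotent[OF V(1,2,3) q(1,2,3) B(1,2,3)])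
    show "(M + ?N) $1$1 = 1" by (simp add: M 11)
    show "(M + ?N) $i$j = 0" if "(i, j) \<in> S" for i j
      using that S entry[of i j] by auto
    show "(M + ?N) $i$j = M$i$j" if "(i, j) \<in> deg2 - S" for i j
      using that entry[of i j] by auto
  qed
qed

lemma clears_column_567: "clears {(5,1), (6,1), (7,1)}"
  by (rule clearsI[where e = "\<lambda>M. (vector [0, 0, 0, 0, - M$5$1 / 2, - M$6$1 / 2, - M$7$1 / 2, 0], 0)"
        and n = "\<lambda>M. (h7, - \<i> *s h7)" and z = "(0, axis 2 1 - axis 5 1)"])
    (simp_all add: deg2_def V7_def quad14_def onorm2_def bil14_def obil_def axis_nth cliff_nth)

lemma clears_column_234: "clears {(3,1), (4,1)}" "clears {(2,1)}"
  by (rule clearsI[where e = "\<lambda>M. (vector [0, 0, 0, 0, 0, - M$4$1, M$3$1, 0], 0)"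
        and n = "\<lambda>M. (axis 5 1, 0)" and z = "(\<i> *s h7, 0)"];
      simp add: deg2_def V7_def quad14_def onorm2_def bil14_def obil_def axis_nth cliff_nth)
    (rule clearsI[where e = "\<lambda>M. (vector [0, 0, 0, 0, 0, M$2$1, 0, 0], 0)"
        and n = "\<lambda>M. (axis 7 1, 0)" and z = "(\<i> *s h7, 0)"];
      simp add: deg2_def V7_def quad14_def onorm2_def bil14_def obil_def axis_nth cliff_nth)

lemma clears_column_of_block:
  assumes "b = 5 \<or> b = 6 \<or> b = 7"
  shows "clears {(5,b), (6,b), (7,b)}"
proof -
  have ii: "\<i> * x * \<i> = - x" for x
  proof -
    have "\<i> * x * \<i> = \<i> * \<i> * x"
      by (simp only: mult_ac)
    then show ?thesis by simp
  qed
  show ?thesis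
    using assms
  by (elim disjE; hypsubst; intro
      clearsI[where e = "\<lambda>M. (vector [0, 0, 0, 0, \<i> * M$5$b, \<i> * M$6$b, \<i> * M$7$b, 0], 0)"
        and n = "\<lambda>M. (0, axis b 1)" and z = "(\<i> *s h7, 0)"];
      simp add: deg2_def V7_def quad14_def onorm2_def bil14_def obil_def axis_nth cliff_nth ii
        flip: mult.assoc)
qed

lemma clears_deg2: "clears deg2"
proof -
  define C where "C = {(5,1), (6,1), (7,1)} \<union> ({(3,1), (4,1)} \<union> {(2::8,1::8)} \<inter> deg2) \<inter> deg2"
  define B where "B = {(5,5), (6,5), (7,5)} \<union> ({(5,6), (6,6), (7,6)} \<union> {(5,7), (6,7), (7::8,7::8)} \<inter> deg2) \<inter> deg2"
  have "clears C"
    unfolding C_def by (intro clears_Un clears_column_567 clears_column_234)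
  moreover have "clears B"
    unfolding B_def by (intro clears_Un clears_column_of_block) simp_all
  ultimately have "clears (C \<union> (prod.swap ` C \<union> B \<inter> deg2) \<inter> deg2)"
    by (intro clears_Un clears_transpose)
  moreover have "C \<union> (prod.swap ` C \<union> B \<inter> deg2) \<inter> deg2 = deg2"
    unfolding C_def B_def deg2_def by auto
  ultimately show ?thesis by simp
qed

text \<open>
  A highest weight vector of the spin module.
\<close>

definition hwv :: spinor where
  "hwv = tensor (axis 1 1) (axis 1 1)"

text \<open>
  If \<open>M\<close> has leading entry 1 and no part of degree 2, then the entry of \<open>e M\<close> at \<open>(i, 1)\<close> for
  \<open>i = 5, 6, 7\<close> is a coordinate of \<open>e\<close>.  With this entry as the first functional, Cartan's equation
  says that \<open>M\<close> is annihilated by the vector dual to that coordinate.  Together with the same fact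
  for \<open>(1, j)\<close> this leaves a single nonzero entry.
\<close>

lemma pure_spinor_deg2_zero:
  assumes pure: "pure_spinor M" and M: "M$1$1 = 1" and zero: "\<And>i j. (i,j) \<in> deg2 \<Longrightarrow> M$i$j = 0"
  shows "M = hwv"
proof -
  have "\<forall>(i,j)\<in>deg2. M$i$j = 0"
    using zero by blast
  then have z: "M$2$1 = 0 \<and> M$3$1 = 0 \<and> M$4$1 = 0 \<and> M$5$1 = 0 \<and> M$6$1 = 0 \<and> M$7$1 = 0 \<and>
      M$1$2 = 0 \<and> M$1$3 = 0 \<and> M$1$4 = 0 \<and> M$1$5 = 0 \<and> M$1$6 = 0 \<and> M$1$7 = 0 \<and>
      M$5$5 = 0 \<and> M$5$6 = 0 \<and> M$5$7 = 0 \<and> M$6$5 = 0 \<and> M$6$6 = 0 \<and> M$6$7 = 0 \<and>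
      M$7$5 = 0 \<and> M$7$6 = 0 \<and> M$7$7 = 0"
    by (simp add: deg2_def)
  have cas: "casimir (column j M) (column l M) i k = casimir (row i M) (row k M) j l" for i j k l
    using pure unfolding pure_spinor_casimir by blast
  have c: "omul (odual i) (column l M) = 0" if "i \<in> {5, 6, 7}" for i l
  proof -
    have "omul (odual i) (column l M) $ k = casimir (column 1 M) (column l M) i k" for k
      using that by (auto simp: casimir_def sum_8 axis_nth z M)
    moreover have "casimir (row i M) (row k M) 1 l = 0" for k
      using that by (auto simp: casimir_def sum_8 axis_nth z M)
    ultimately show ?thesis
      by (simp add: vec_eq_iff cas)
  qed
  have r: "omul (odual j) (row k M) = 0" if "j \<in> {5, 6, 7}" for j k
  proof -
    have "omul (odual j) (row k M) $ l = casimir (row 1 M) (row k M) j l" for l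
      using that by (auto simp: casimir_def sum_8 axis_nth z M)
    moreover have "casimir (column j M) (column l M) 1 k = 0" for l
      using that by (auto simp: casimir_def sum_8 axis_nth z M)
    ultimately show ?thesis
      by (simp add: vec_eq_iff flip: cas)
  qed
  have kernel: "y$i = 0" if "\<And>j. j \<in> {5, 6, 7} \<Longrightarrow> omul (odual j) y = 0" "i \<noteq> 1" for y i
    using that(1)[of 5] that(1)[of 6] that(1)[of 7] that(2) exhaust_8[of i]
    by (auto simp: octonion_eq_iff odual_def axis_nth)
  have "M$i$j = 0" if "i \<noteq> 1 \<or> j \<noteq> 1" for i j
    using that kernel[of "column j M" i] kernel[of "row i M" j] c r by auto
  then show ?thesis
    using M by (auto simp: vec_eq_iff hwv_def tensor_nth axis_nth)
qed

text \<open>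
  A pure spinor with a nonzero entry is moved so that its leading entry does not vanish; then it
  lies in the open cell, and unipotent elements remove its part of degree 2.
\<close>

lemma pure_spinor_in_orbit:
  assumes "pure_spinor M" "M \<noteq> 0"
  obtains g c where "g \<in> spin14" "c \<noteq> 0" "M = cscale c (g hwv)"
proof -
  \<comment> \<open>move a nonzero entry to \<open>(1, 1)\<close> and normalise it to 1\<close>
  obtain i j where ij: "M$i$j \<noteq> 0"
    using assms(2) by (auto simp: vec_eq_iff)
  obtain g c where g: "g \<in> spin14" "c \<noteq> 0" "\<And>M. g M $1$1 = c * M$i$j"
    using spin14_move_entry[of i j] by blast
  define N where "N = cscale (inverse (c * M$i$j)) (g M)"
  have N1: "N$1$1 = 1"
    using ij g by (simp add: N_def cscale_nth field_simps)
  have scale: "pure_spinor (cscale a L)" if "pure_spinor L" for a L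
    using that by (simp add: pure_spinor_casimir column_row_linear casimir_linear)
  have "pure_spinor N"
    unfolding N_def by (intro scale pure_spinor_spin14[OF g(1)] assms)
  obtain h where h: "h \<in> spin14" "h N $1$1 = 1" "\<And>i j. (i,j) \<in> deg2 \<Longrightarrow> h N $i$j = 0"
    using clears_deg2 N1 unfolding clears_def by metis
  have hN: "h N = hwv"
    using pure_spinor_deg2_zero[OF pure_spinor_spin14[OF h(1) \<open>pure_spinor N\<close>] h(2,3)] .
  obtain k where k: "k \<in> spin14" "\<And>M. k ((h \<circ> g) M) = M"
    using spin14_inverse[OF spin14_comp[OF h(1) g(1)]] by metis
  have "hwv = cscale (inverse (c * M$i$j)) ((h \<circ> g) M)"
    by (simp add: N_def spin14_linear[OF h(1)] flip: hN)
  from arg_cong[OF this, of k] have "k hwv = cscale (inverse (c * M$i$j)) M"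
    by (simp only: spin14_linear(2)[OF k(1)] k(2))
  then have "M = cscale (c * M$i$j) (k hwv)"
    using ij g(2) by (simp add: field_simps)
  then show ?thesis
    using that[OF k(1)] ij g(2) by (metis mult_eq_0_iff)
qed

section \<open>The spinor variety\<close>

lemma span_line: "Delta.span {M} = {cscale c M | c. True}"
  by (auto simp: Delta.span_singleton)

lemma span_line_scale: "c \<noteq> 0 \<Longrightarrow> Delta.span {cscale c M} = Delta.span {M}"
proof -
  assume c: "c \<noteq> 0"
  have "cscale d M = cscale (d / c) (cscale c M)" for d
    using c by simp
  then have "cscale d M \<in> {cscale a (cscale c M) | a. True}" for d
    by blast
  then show ?thesis
    unfolding span_line by auto
qed

lemma span_lineD:
  assumes "Delta.span {M} = Delta.span {N}" "N \<noteq> 0"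
  obtains c where "c \<noteq> 0" "N = cscale c M"
proof -
  have "N \<in> Delta.span {M}"
    by (simp add: assms(1) Delta.span_base)
  then obtain c where "N = cscale c M"
    by (auto simp: span_line)
  moreover have "c \<noteq> 0"
    using calculation assms(2) by auto
  ultimately show ?thesis using that by blast
qed

lemma image_line:
  assumes "\<And>c M. g (cscale c M) = cscale c (g M)"
  shows "g ` Delta.span {M} = Delta.span {g M}"
  by (force simp: span_line assms)

lemma spin14_image_line: "g \<in> spin14 \<Longrightarrow> g ` Delta.span {M} = Delta.span {g M}"
  by (rule image_line) (rule spin14_linear(2))

lemma orbit_of_point:
  assumes comp: "\<And>g h. g \<in> H \<Longrightarrow> h \<in> H \<Longrightarrow> g \<circ> h \<in> H"
    and inv: "\<And>g. g \<in> H \<Longrightarrow> \<exists>h\<in>H. \<forall>x. h (g x) = x"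
    and Y: "Y \<in> orbits H X" "q \<in> Y"
  shows "Y = {g ` q | g. g \<in> H}"
proof -
  obtain p g0 where p: "Y = {g ` p | g. g \<in> H}" "g0 \<in> H" "q = g0 ` p"
    using Y by (auto simp: orbits_def)
  obtain h where h: "h \<in> H" "\<And>x. h (g0 x) = x"
    using inv[OF p(2)] by blast
  have hq: "p = h ` q"
    by (simp add: p(3) image_image h(2))
  have gp: "g ` p = (g \<circ> h) ` q" for g
    by (simp add: image_comp hq)
  have gq: "g ` q = (g \<circ> g0) ` p" for g
    by (simp add: image_comp p(3))
  show ?thesis
    unfolding p(1)
  proof (intro equalityI subsetI; clarify)
    fix g assume g: "g \<in> H"
    show "\<exists>k. g ` p = k ` q \<and> k \<in> H"
      by (intro exI[of _ "g \<circ> h"] conjI gp comp g h)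
  next
    fix g assume g: "g \<in> H"
    show "\<exists>k. g ` q = k ` p \<and> k \<in> H"
      by (intro exI[of _ "g \<circ> g0"] conjI gq comp g p)
  qed
qed

lemma isCont_fun_algebra:
  assumes f: "f \<in> fun_algebra {(\<lambda>M :: spinor. M$i$j) | i j. True}"
    and \<gamma>: "\<And>i j. isCont (\<lambda>r. \<gamma> r $ i $ j) (a :: complex)"
  shows "isCont (\<lambda>r. f (\<gamma> r)) a"
  using f
proof induction
  case (fun_algebra_gen f)
  then show ?case using \<gamma> by auto
qed (auto intro: isCont_add isCont_mult)

text \<open>
  Polynomials are continuous, so Zariski closed sets contain the limits of curves.  This is how
  closed orbits are found below: one-parameter subgroups degenerate a point to a highest weight line.
\<close>

lemma zariski_closed_limit:
  assumes Y: "zariski_closed Y" and \<gamma>: "\<And>i j. isCont (\<lambda>r. \<gamma> r $ i $ j) (0 :: complex)"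
    and in_Y: "\<And>r. r \<noteq> 0 \<Longrightarrow> Delta.span {\<gamma> r} \<in> Y" and nz: "\<gamma> 0 \<noteq> 0"
  shows "Delta.span {\<gamma> 0} \<in> Y"
proof -
  obtain F where F: "F \<subseteq> fun_algebra {(\<lambda>M. M$i$j) | i j. True}"
    and iff: "\<And>M. M \<noteq> 0 \<Longrightarrow> Delta.span {M} \<in> Y \<longleftrightarrow> (\<forall>f\<in>F. f M = 0)" and sub: "Y \<subseteq> proj UNIV"
    using Y unfolding zariski_closed_def by blast
  have nonzero: "\<gamma> r \<noteq> 0" if "r \<noteq> 0" for r
  proof
    assume "\<gamma> r = 0"
    then have "{0} \<in> proj UNIV"
      using in_Y[OF that] sub by (auto simp: subset_iff)
    then obtain M where "{0} = Delta.span {M}" "M \<noteq> 0"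
      by (auto simp: proj_def)
    then show False
      using Delta.span_base[of M "{M}"] by auto
  qed
  have "f (\<gamma> 0) = 0" if "f \<in> F" for f
  proof -
    have "((\<lambda>r. f (\<gamma> r)) \<longlongrightarrow> f (\<gamma> 0)) (at 0)"
      using isCont_fun_algebra[where f = f and \<gamma> = \<gamma> and a = 0] F that \<gamma> by (auto simp: isCont_def)
    moreover have "((\<lambda>r. f (\<gamma> r)) \<longlongrightarrow> 0) (at 0)"
      by (rule Lim_transform_eventually[OF tendsto_const[of 0]])
        (use iff in_Y nonzero that in \<open>auto simp: eventually_at intro!: exI[of _ 1]\<close>)
    ultimately show ?thesis
      using tendsto_unique[OF trivial_limit_at] by blast
  qed
  then show ?thesis
    using iff[OF nz] by blast
qed

definition pure_lines :: "spinor set set" where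
  "pure_lines = {Delta.span {M} | M. M \<noteq> 0 \<and> pure_spinor M}"

lemma pure_spinor_scale: "c \<noteq> 0 \<Longrightarrow> pure_spinor (cscale c M) \<longleftrightarrow> pure_spinor M"
  by (simp add: pure_spinor_casimir column_row_linear casimir_linear)

lemma pure_lines_iff: "M \<noteq> 0 \<Longrightarrow> Delta.span {M} \<in> pure_lines \<longleftrightarrow> pure_spinor M"
  unfolding pure_lines_def by (auto elim!: span_lineD simp: pure_spinor_scale)

lemma fun_algebra_sum:
  "finite A \<Longrightarrow> (\<And>a. a \<in> A \<Longrightarrow> f a \<in> fun_algebra S) \<Longrightarrow> (\<lambda>x. \<Sum>a\<in>A. f a x) \<in> fun_algebra S"
  by (induction A rule: finite_induct) (auto intro: fun_algebra_const fun_algebra_add)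

lemma omul_coordinates: "omul a y $ i = (\<Sum>p\<in>UNIV. omul a (axis p 1) $ i * y $ p)"
proof -
  have "\<forall>i. omul a y $ i = (\<Sum>p\<in>UNIV. omul a (axis p 1) $ i * y $ p)"
    by (simp add: forall_8 sum_8 axis_nth)
  then show ?thesis by blast
qed

lemma cliff_plus_fun_algebra:
  "(\<lambda>M. cliff_plus v M $ i $ j) \<in> fun_algebra {(\<lambda>M :: spinor. M$i$j) | i j. True}" (is "_ \<in> ?A")
proof -
  obtain a b where v: "v = (a, b)" by force
  have entry: "(\<lambda>M. M$i$j) \<in> ?A" for i j
    by (rule fun_algebra_gen) blast
  have "(\<lambda>M. (\<Sum>p\<in>UNIV. omul a (axis p 1) $ i * M$p$j)
      + \<i> * (\<Sum>p\<in>UNIV. omul b (axis p 1) $ j * M$i$p)) \<in> ?A"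
    by (intro fun_algebra_add fun_algebra_mult fun_algebra_sum fun_algebra_const entry) simp_all
  moreover have "cliff_plus v M $ i $ j = (\<Sum>p\<in>UNIV. omul a (axis p 1) $ i * M$p$j)
      + \<i> * (\<Sum>p\<in>UNIV. omul b (axis p 1) $ j * M$i$p)" for M
    by (simp only: v cliff_nth omul_coordinates[of a "column j M"] omul_coordinates[of b "row i M"] column_row_nth)
  ultimately show ?thesis by simp
qed

lemma zariski_closedI:
  assumes "Y \<subseteq> proj UNIV"
    and "\<And>a. F a \<in> fun_algebra {(\<lambda>M. M$i$j) | i j. True}"
    and "\<And>M. M \<noteq> 0 \<Longrightarrow> Delta.span {M} \<in> Y \<longleftrightarrow> (\<forall>a. F a M = 0)"
  shows "zariski_closed Y"
proof -
  have "range F \<subseteq> fun_algebra {(\<lambda>M. M$i$j) | i j. True}"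
    using assms(2) by (rule image_subsetI)
  moreover have "\<forall>M. M \<noteq> 0 \<longrightarrow> (Delta.span {M} \<in> Y \<longleftrightarrow> (\<forall>f\<in>range F. f M = 0))"
    by (simp add: assms(3))
  ultimately show ?thesis
    unfolding zariski_closed_def using assms(1) by (intro conjI exI[of _ "range F"])
qed

lemma zariski_closed_pure_lines: "zariski_closed pure_lines"
proof (rule zariski_closedI[where F = "\<lambda>(i,j,k,l) M. \<Sum>a\<in>UNIV. cliff_plus (basis14 a) M $ i $ j * cliff_plus (dual14 a) M $ k $ l"])
  show "pure_lines \<subseteq> proj UNIV"
    by (auto simp: pure_lines_def proj_def)
next
  fix a :: "8 \<times> 8 \<times> 8 \<times> 8"
  obtain i j k l where a: "a = (i, j, k, l)" by (metis surj_pair)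
  show "(case a of (i,j,k,l) \<Rightarrow> \<lambda>M. \<Sum>a\<in>UNIV. cliff_plus (basis14 a) M $ i $ j * cliff_plus (dual14 a) M $ k $ l)
      \<in> fun_algebra {(\<lambda>M. M$i$j) | i j. True}"
    unfolding a prod.case by (intro fun_algebra_sum fun_algebra_mult cliff_plus_fun_algebra finite)
next
  fix M :: spinor assume "M \<noteq> 0"
  then show "Delta.span {M} \<in> pure_lines \<longleftrightarrow> (\<forall>a. (case a of (i,j,k,l) \<Rightarrow> \<lambda>M.
      \<Sum>a\<in>UNIV. cliff_plus (basis14 a) M $ i $ j * cliff_plus (dual14 a) M $ k $ l) M = 0)"
    by (simp add: pure_lines_iff pure_spinor_def)
qed

definition rescales_rows :: "octonion \<Rightarrow> bool" where
  "rescales_rows d \<longleftrightarrow> (\<exists>g\<in>spin14. \<exists>c. c \<noteq> 0 \<and> (\<forall>M i j. g M $i$j = c * d$i * M$i$j))"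

lemma rescales_rows_mult:
  assumes "rescales_rows d" "rescales_rows e"
  shows "rescales_rows (\<chi> i. d$i * e$i)"
proof -
  obtain g c where g: "g \<in> spin14" "c \<noteq> 0" "\<And>M i j. g M $i$j = c * d$i * M$i$j"
    using assms(1) unfolding rescales_rows_def by blast
  obtain h b where h: "h \<in> spin14" "b \<noteq> 0" "\<And>M i j. h M $i$j = b * e$i * M$i$j"
    using assms(2) unfolding rescales_rows_def by blast
  show ?thesis
    unfolding rescales_rows_def using g h
    by (intro bexI[OF _ spin14_comp[OF g(1) h(1)]] exI[of _ "c * b"]) simp
qed

text \<open>
  For \<open>e = axis k 1\<close> and \<open>f = - axis (k + 3) 1\<close> the vectors \<open>e + f\<close> and \<open>r e + f / r\<close> have norm 1, and
  their product acts diagonally with eigenvalues \<open>- r\<close> and \<open>- 1 / r\<close>.  Here \<open>k = 2, 3, 4\<close>, and the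
  common factor \<open>- 1 / r\<close> has been taken out.
\<close>

lemma rescales_rows_plane:
  assumes "r \<noteq> 0"
  shows "rescales_rows (vector [1, 1, r\<^sup>2, r\<^sup>2, r\<^sup>2, 1, 1, r\<^sup>2])"
    and "rescales_rows (vector [1, r\<^sup>2, 1, r\<^sup>2, 1, r\<^sup>2, 1, r\<^sup>2])"
    and "rescales_rows (vector [1, r\<^sup>2, r\<^sup>2, 1, 1, 1, r\<^sup>2, r\<^sup>2])"
proof -
  have I: "rescales_rows d" if "v \<in> V7" "w \<in> V7" "onorm2 v = 1" "onorm2 w = 1"
    "\<And>y. \<forall>i. omul v (omul w y) $ i = - inverse r * d $ i * y $ i" for v w d
  proof -
    have diag: "omul v (omul w y) $ i = - inverse r * d $ i * y $ i" for y i
      using that(5) by blast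
    have "(\<lambda>M. cliff_minus (v, 0) (cliff_plus (w, 0) M)) \<in> spin14"
      using that by (intro spin14_pair) (simp_all add: V7_def quad14_def onorm2_def)
    moreover have "column j (cliff_plus (w, 0) M) = omul w (column j M)" for j M
      by (simp add: vec_eq_iff cliff_nth omul_linear)
    ultimately show ?thesis
      unfolding rescales_rows_def using assms
      by (intro bexI[of _ "\<lambda>M. cliff_minus (v, 0) (cliff_plus (w, 0) M)"] exI[of _ "- inverse r"])
        (simp_all add: cliff_nth omul_linear diag)
  qed
  show "rescales_rows (vector [1, 1, r\<^sup>2, r\<^sup>2, r\<^sup>2, 1, 1, r\<^sup>2])"
    using assms
    by (intro I[of "axis 2 1 - axis 5 1" "axis 2 r - axis 5 (inverse r)"])
      (simp_all add: V7_def onorm2_def axis_nth forall_8 power2_eq_square)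
  show "rescales_rows (vector [1, r\<^sup>2, 1, r\<^sup>2, 1, r\<^sup>2, 1, r\<^sup>2])"
    using assms
    by (intro I[of "axis 3 1 - axis 6 1" "axis 3 r - axis 6 (inverse r)"])
      (simp_all add: V7_def onorm2_def axis_nth forall_8 power2_eq_square)
  show "rescales_rows (vector [1, r\<^sup>2, r\<^sup>2, 1, 1, 1, r\<^sup>2, r\<^sup>2])"
    using assms
    by (intro I[of "axis 4 1 - axis 7 1" "axis 4 r - axis 7 (inverse r)"])
      (simp_all add: V7_def onorm2_def axis_nth forall_8 power2_eq_square)
qed

text \<open>
  The product of the three one-parameter subgroups above: its exponents are twice the number of
  factors \<open>axis 5 1\<close>, \<open>axis 6 1\<close>, \<open>axis 7 1\<close> by which a coordinate arises from the first one.
\<close>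

definition spin_scaling :: "complex \<Rightarrow> octonion" where
  "spin_scaling r = vector [1, r^4, r^4, r^4, r^2, r^2, r^2, r^6]"

lemma spin_scaling_realised:
  assumes "r \<noteq> 0"
  obtains g c where "g \<in> spin14" "c \<noteq> 0"
    "\<And>M i j. g M $i$j = c * (spin_scaling r $ i * M$i$j * spin_scaling r $ j)"
proof -
  have "rescales_rows (spin_scaling r)"
  proof -
    have "(\<chi> i. vector [1, 1, r\<^sup>2, r\<^sup>2, r\<^sup>2, 1, 1, r\<^sup>2] $ i *
        (\<chi> i. vector [1, r\<^sup>2, 1, r\<^sup>2, 1, r\<^sup>2, 1, r\<^sup>2] $ i * vector [1, r\<^sup>2, r\<^sup>2, 1, 1, 1, r\<^sup>2, r\<^sup>2] $ i) $ i)
      = spin_scaling r"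
      by (simp add: octonion_eq_iff spin_scaling_def flip: power_add)
    then show ?thesis
      using rescales_rows_mult[OF rescales_rows_plane(1)[OF assms]
          rescales_rows_mult[OF rescales_rows_plane(2,3)[OF assms]]] by simp
  qed
  then obtain g c where g: "g \<in> spin14" "c \<noteq> 0" "\<And>M i j. g M $i$j = c * spin_scaling r $i * M$i$j"
    unfolding rescales_rows_def by blast
  show ?thesis
  proof (rule that[of "g \<circ> (\<lambda>M. transpose (g (transpose M)))" "c * c"])
    show "g \<circ> (\<lambda>M. transpose (g (transpose M))) \<in> spin14"
      by (intro spin14_comp spin14_transpose g)
  qed (use g in \<open>simp_all add: transpose_nth\<close>)
qed

text \<open>
  As \<open>r\<close> tends to 0, the subgroup \<open>spin_scaling\<close>, applied on both sides to a spinor with nonzero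
  leading entry, contracts it to a multiple of \<open>hwv\<close>.
\<close>

lemma closed_spin14_orbit_contains_hwv:
  assumes Y: "Y \<in> orbits spin14 (proj UNIV)" "zariski_closed Y"
  shows "Delta.span {hwv} \<in> Y"
proof -
  obtain M where M: "M \<noteq> 0" "Y = {g ` Delta.span {M} | g. g \<in> spin14}"
    using Y(1) by (auto simp: orbits_def proj_def)
  obtain i j where ij: "M$i$j \<noteq> 0"
    using M(1) by (auto simp: vec_eq_iff)
  obtain g c where g: "g \<in> spin14" "c \<noteq> 0" "g M $1$1 = c * M$i$j"
    using spin14_move_entry[of i j] by blast
  define \<gamma> where "\<gamma> r = (\<chi> i j. spin_scaling r $ i * g M $i$j * spin_scaling r $ j)" for r
  have \<gamma>0: "\<gamma> 0 = cscale (c * M$i$j) hwv"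
  proof -
    have "\<forall>p q. \<gamma> 0 $ p $ q = cscale (c * M$i$j) hwv $ p $ q"
      by (simp add: forall_8 \<gamma>_def spin_scaling_def cscale_nth hwv_def tensor_nth axis_nth g(3))
    then show ?thesis by (simp add: vec_eq_iff)
  qed
  have "Delta.span {\<gamma> 0} \<in> Y"
  proof (rule zariski_closed_limit[OF Y(2)])
    show "isCont (\<lambda>r. \<gamma> r $ i $ j) 0" for i j
    proof -
      have "\<forall>i. isCont (\<lambda>r. spin_scaling r $ i) 0"
        by (simp add: forall_8 spin_scaling_def)
      then show ?thesis
        by (simp add: \<gamma>_def)
    qed
    show "Delta.span {\<gamma> r} \<in> Y" if r: "r \<noteq> 0" for r
    proof -
      obtain h b where h: "h \<in> spin14" "b \<noteq> 0"
        "\<And>M i j. h M $i$j = b * (spin_scaling r $ i * M$i$j * spin_scaling r $ j)"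
        using spin_scaling_realised[OF r] by blast
      have "h (g M) = cscale b (\<gamma> r)"
        by (simp add: vec_eq_iff h(3) \<gamma>_def cscale_nth)
      then have "(h \<circ> g) ` Delta.span {M} = Delta.span {\<gamma> r}"
        using span_line_scale[OF h(2)] spin14_linear[OF spin14_comp[OF h(1) g(1)]]
        by (simp add: image_line)
      then show ?thesis
        using spin14_comp[OF h(1) g(1)] M(2) by blast
    qed
    show "\<gamma> 0 \<noteq> 0"
    proof
      assume "\<gamma> 0 = 0"
      then have "cscale (c * M$i$j) hwv $ 1 $ 1 = 0"
        unfolding \<gamma>0 by (simp only: zero_index)
      then show False using g(2) ij by (simp add: cscale_nth hwv_def tensor_nth)
    qed
  qed
  then show ?thesis
    unfolding \<gamma>0 using span_line_scale[of "c * M$i$j" hwv] g(2) ij by simp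
qed

lemma hwv_pure: "pure_spinor hwv" "hwv \<noteq> 0"
proof -
  show "pure_spinor hwv"
    unfolding hwv_def by (intro pure_spinor_tensor) (simp_all add: onorm2_def axis_nth)
  have "hwv $ 1 $ 1 = 1" by (simp add: hwv_def tensor_nth axis_nth)
  then show "hwv \<noteq> 0" by auto
qed

lemma spin14_orbit_hwv: "{g ` Delta.span {hwv} | g. g \<in> spin14} = pure_lines"
proof (intro equalityI subsetI)
  fix p assume "p \<in> {g ` Delta.span {hwv} | g. g \<in> spin14}"
  then obtain g where g: "g \<in> spin14" "p = Delta.span {g hwv}"
    using spin14_image_line by blast
  obtain h where h: "h \<in> spin14" "\<And>M. h (g M) = M"
    using spin14_inverse[OF g(1)] by metis
  have "h 0 = 0"
    using spin14_linear(2)[OF h(1), of 0 0] by simp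
  then have "g hwv \<noteq> 0"
    using h(2)[of hwv] hwv_pure(2) by auto
  then show "p \<in> pure_lines"
    using pure_spinor_spin14[OF g(1) hwv_pure(1)] g(2) by (auto simp: pure_lines_def)
next
  fix p assume "p \<in> pure_lines"
  then obtain M where M: "p = Delta.span {M}" "M \<noteq> 0" "pure_spinor M"
    by (auto simp: pure_lines_def)
  obtain g c where g: "g \<in> spin14" "c \<noteq> 0" "M = cscale c (g hwv)"
    using pure_spinor_in_orbit[OF M(3,2)] by blast
  have "p = g ` Delta.span {hwv}"
    by (simp add: M(1) g(3) span_line_scale[OF g(2)] image_line[of g, OF spin14_linear(2)[OF g(1)]])
  then show "p \<in> {g ` Delta.span {hwv} | g. g \<in> spin14}"
    using g(1) by blast
qed

lemma spinor_variety_eq: "spinor_variety = pure_lines"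
  unfolding spinor_variety_def
proof (rule the_equality)
  have "Delta.span {hwv} \<in> proj UNIV"
    using hwv_pure by (auto simp: proj_def)
  then have "pure_lines \<in> orbits spin14 (proj UNIV)"
    unfolding orbits_def using spin14_orbit_hwv by blast
  then show "pure_lines \<in> orbits spin14 (proj UNIV) \<and> zariski_closed pure_lines"
    using zariski_closed_pure_lines by blast
next
  fix Y assume "Y \<in> orbits spin14 (proj UNIV) \<and> zariski_closed Y"
  then show "Y = pure_lines"
  proof (elim conjE)
    assume Y: "Y \<in> orbits spin14 (proj UNIV)" "zariski_closed Y"
    have "Y = {g ` Delta.span {hwv} | g. g \<in> spin14}"
    proof (rule orbit_of_point[OF spin14_comp _ Y(1) closed_spin14_orbit_contains_hwv[OF Y]])
      show "\<exists>h\<in>spin14. \<forall>x. h (g x) = x" if "g \<in> spin14" for g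
        using spin14_inverse[OF that] by metis
    qed
    then show ?thesis
      by (simp only: spin14_orbit_hwv)
  qed
qed

section \<open>Automorphisms of the octonions\<close>

lemma G2_hom: "A \<in> G2 \<Longrightarrow> A *v omul x y = omul (A *v x) (A *v y)"
  by (simp add: G2_def)

lemma G2_inverse:
  assumes "A \<in> G2"
  obtains B where "B \<in> G2" "A ** B = mat 1" "B ** A = mat 1"
proof -
  obtain B where B: "A ** B = mat 1" "B ** A = mat 1"
    using assms by (auto simp: G2_def invertible_def)
  have "B *v omul x y = omul (B *v x) (B *v y)" for x y
  proof -
    have "omul x y = A *v omul (B *v x) (B *v y)"
      by (simp add: G2_hom[OF assms] matrix_vector_mul_assoc B)
    then show ?thesis
      by (simp add: matrix_vector_mul_assoc B)
  qed
  then have "B \<in> G2"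
    using B by (auto simp: G2_def invertible_def)
  then show ?thesis using that B by blast
qed

lemma G2_mult: "A \<in> G2 \<Longrightarrow> B \<in> G2 \<Longrightarrow> A ** B \<in> G2"
  by (simp add: G2_def invertible_mult flip: matrix_vector_mul_assoc)

lemma G2_one: "mat 1 \<in> G2"
  by (simp add: G2_def invertible_def)

lemma omul_square: "omul x x = (x$1 + x$8) *s x - onorm2 x *s oone"
  by (simp add: octonion_eq_iff onorm2_def algebra_simps)

lemma smult_oone_V7: "c *s oone \<in> V7 \<longleftrightarrow> c = 0"
  by (simp add: V7_def)

text \<open>
  Every octonion satisfies \<open>x\<^sup>2 = t x - n\<close> with its trace \<open>t\<close> and its norm \<open>n\<close>.  For an automorphism
  \<open>A\<close> and an imaginary \<open>x\<close> the image \<open>A x\<close> has the square \<open>- n\<close> of \<open>x\<close>; so either its own trace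
  vanishes or it is a scalar, and the latter would make \<open>x\<close> an imaginary scalar.
\<close>

lemma G2_V7_norm:
  assumes A: "A \<in> G2" and x: "x \<in> V7"
  shows "A *v x \<in> V7" "onorm2 (A *v x) = onorm2 x"
proof -
  define t where "t = (A *v x)$1 + (A *v x)$8"
  have "omul x x = (- onorm2 x) *s oone"
    using x by (simp add: omul_square V7_def)
  then have "A *v omul x x = (- onorm2 x) *s oone"
    by (simp only: matrix_vector_mult_scaleR vector_scalar_commute G2_oone[OF A])
  then have "t *s (A *v x) - onorm2 (A *v x) *s oone = (- onorm2 x) *s oone"
    unfolding G2_hom[OF A] omul_square[of "A *v x"] t_def[symmetric] .
  then have eq: "t *s (A *v x) = (onorm2 (A *v x) - onorm2 x) *s oone"
    by (simp add: octonion_eq_iff algebra_simps)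
  have t: "t = 0"
  proof (rule ccontr)
    assume t: "t \<noteq> 0"
    obtain B where B: "B \<in> G2" "B ** A = mat 1"
      using G2_inverse[OF A] by blast
    define c where "c = (onorm2 (A *v x) - onorm2 x) / t"
    have "A *v x = c *s oone"
      using eq t by (simp add: c_def octonion_eq_iff field_simps)
    then have "B *v (A *v x) = c *s oone"
      by (simp only: vector_scalar_commute G2_oone[OF B(1)])
    then have "x = c *s oone"
      by (simp add: matrix_vector_mul_assoc B)
    then have "c = 0"
      using x smult_oone_V7 by simp
    then show False
      using \<open>A *v x = c *s oone\<close> t by (simp add: t_def)
  qed
  then show "A *v x \<in> V7"
    by (simp add: V7_def t_def)
  have "((onorm2 (A *v x) - onorm2 x) *s oone) $ 1 = 0"
    by (simp only: eq[symmetric] t) simp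
  then show "onorm2 (A *v x) = onorm2 x"
    by simp
qed

lemma G2_preserves:
  assumes "A \<in> G2"
  shows "(A *v x)$1 + (A *v x)$8 = x$1 + x$8" and "A *v imag x = imag (A *v x)"
    and "onorm2 (A *v x) = onorm2 x"
proof -
  define r where "r = (x$1 + x$8) / 2"
  have x: "x = imag x + r *s oone"
    by (simp add: imag_def r_def)
  have Ax: "A *v x = A *v imag x + r *s oone"
    by (subst x) (simp only: matrix_vector_right_distrib vector_scalar_commute G2_oone[OF assms])
  have V: "A *v imag x \<in> V7"
    by (rule G2_V7_norm[OF assms imag_V7])
  show tr: "(A *v x)$1 + (A *v x)$8 = x$1 + x$8"
    using V unfolding Ax by (simp add: V7_def r_def)
  show "A *v imag x = imag (A *v x)"
    unfolding imag_def[of "A *v x"] tr by (simp add: Ax r_def)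
  have "obil y oone = y$1 + y$8" for y
    by (simp add: obil_def)
  then have "onorm2 (y + r *s oone) = onorm2 y + r\<^sup>2 * onorm2 oone" if "y \<in> V7" for y
    using that by (simp add: onorm2_add onorm2_scale obil_linear V7_def)
  then show "onorm2 (A *v x) = onorm2 x"
    using V imag_V7[of x] G2_V7_norm(2)[OF assms imag_V7[of x]] by (subst x, subst Ax) simp
qed

lemma G2_obil: "A \<in> G2 \<Longrightarrow> obil (A *v x) (A *v y) = obil x y"
  using onorm2_add[of x y] onorm2_add[of "A *v x" "A *v y"] G2_preserves(3)
  by (metis add_left_cancel matrix_vector_right_distrib)

lemma G2I:
  assumes "\<And>x y. f (x + y) = f x + f y" "\<And>c x. f (c *s x) = c *s f x" "\<And>x. g (f x) = x"
    and hom: "\<And>x y. f (omul x y) = omul (f x) (f y)"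
  shows "\<exists>A\<in>G2. \<forall>x. A *v x = f x"
proof -
  have "Vector_Spaces.linear (*s) (*s) f"
    by (simp add: Vector_Spaces.linear_iff vec.vector_space_axioms assms)
  then have works: "matrix f *v x = f x" for x
    by (rule matrix_works)
  have "inj f"
    by (metis assms(3) injI)
  moreover have "(*v) (matrix f) = f"
    by (simp add: fun_eq_iff works)
  ultimately have "invertible (matrix f)"
    by (simp add: invertible_left_inverse matrix_left_invertible_injective)
  then show ?thesis
    using hom works by (intro bexI[of _ "matrix f"]) (simp_all add: G2_def)
qed

text \<open>
  The exponential of a nilpotent derivation, a combination of three short root vectors with the
  coefficients \<open>c$2\<close>, \<open>c$3\<close>, \<open>c$4\<close>.
\<close>

definition shear :: "octonion \<Rightarrow> octonion \<Rightarrow> octonion" where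
  "shear c x = (let s = c$2 * x$5 + c$3 * x$6 + c$4 * x$7; d = x$1 - x$8 - s in vector [
     x$1 - s, x$2 + d * c$2, x$3 + d * c$3, x$4 + d * c$4,
     x$5 + (c$3 * x$4 - c$4 * x$3), x$6 + (c$4 * x$2 - c$2 * x$4), x$7 + (c$2 * x$3 - c$3 * x$2), x$8 + s])"

lemma G2_shear: "\<exists>A\<in>G2. \<forall>x. A *v x = shear c x"
  by (rule G2I[where g = "shear (- c)"])
    (simp_all add: octonion_eq_iff shear_def Let_def algebra_simps)

text \<open>
  The automorphism that exchanges the two idempotents \<open>axis 1 1\<close> and \<open>axis 8 1\<close> and thereby the
  two 3-spaces of their Peirce decomposition.
\<close>

definition oswap :: "octonion \<Rightarrow> octonion" where
  "oswap x = vector [x$8, - x$5, - x$6, - x$7, - x$2, - x$3, - x$4, x$1]"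

lemma shear_nth:
  assumes "c$2 * x$5 + c$3 * x$6 + c$4 * x$7 = s"
  shows "shear c x $ 1 = x$1 - s" "shear c x $ 2 = x$2 + (x$1 - x$8 - s) * c$2"
    "shear c x $ 3 = x$3 + (x$1 - x$8 - s) * c$3" "shear c x $ 4 = x$4 + (x$1 - x$8 - s) * c$4"
    "shear c x $ 8 = x$8 + s"
  unfolding shear_def Let_def assms by simp_all

lemma G2_oswap: "\<exists>A\<in>G2. \<forall>x. A *v x = oswap x"
  by (rule G2I[where g = oswap])
    (simp_all add: octonion_eq_iff oswap_def algebra_simps)

text \<open>
  The coordinates 2, 3, 4 of an octonion form a vector in 3-space, the upper right entry of its
  vector matrix; this is the determinant of three such vectors.
\<close>

definition det3 :: "octonion \<Rightarrow> octonion \<Rightarrow> octonion \<Rightarrow> complex" where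
  "det3 p q r = p$2 * (q$3 * r$4 - q$4 * r$3) + p$3 * (q$4 * r$2 - q$2 * r$4) + p$4 * (q$2 * r$3 - q$3 * r$2)"

text \<open>
  For columns \<open>p\<close>, \<open>q\<close>, \<open>r\<close> of determinant 1, the automorphism fixing \<open>h7\<close> that acts on the
  coordinates 2, 3, 4 by the matrix with these columns, and on the coordinates 5, 6, 7 by the cofactor matrix, that is, by the dual
  representation.
\<close>

definition sl3 :: "octonion \<Rightarrow> octonion \<Rightarrow> octonion \<Rightarrow> octonion \<Rightarrow> octonion" where
  "sl3 p q r x = vector [x$1,
     p$2 * x$2 + q$2 * x$3 + r$2 * x$4, p$3 * x$2 + q$3 * x$3 + r$3 * x$4, p$4 * x$2 + q$4 * x$3 + r$4 * x$4,
     (q$3 * r$4 - q$4 * r$3) * x$5 + (r$3 * p$4 - r$4 * p$3) * x$6 + (p$3 * q$4 - p$4 * q$3) * x$7,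
     (q$4 * r$2 - q$2 * r$4) * x$5 + (r$4 * p$2 - r$2 * p$4) * x$6 + (p$4 * q$2 - p$2 * q$4) * x$7,
     (q$2 * r$3 - q$3 * r$2) * x$5 + (r$2 * p$3 - r$3 * p$2) * x$6 + (p$2 * q$3 - p$3 * q$2) * x$7,
     x$8]"

definition sl3_inv :: "octonion \<Rightarrow> octonion \<Rightarrow> octonion \<Rightarrow> octonion \<Rightarrow> octonion" where
  "sl3_inv p q r x = vector [x$1,
     (q$3 * r$4 - q$4 * r$3) * x$2 + (q$4 * r$2 - q$2 * r$4) * x$3 + (q$2 * r$3 - q$3 * r$2) * x$4,
     (r$3 * p$4 - r$4 * p$3) * x$2 + (r$4 * p$2 - r$2 * p$4) * x$3 + (r$2 * p$3 - r$3 * p$2) * x$4,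
     (p$3 * q$4 - p$4 * q$3) * x$2 + (p$4 * q$2 - p$2 * q$4) * x$3 + (p$2 * q$3 - p$3 * q$2) * x$4,
     p$2 * x$5 + p$3 * x$6 + p$4 * x$7, q$2 * x$5 + q$3 * x$6 + q$4 * x$7, r$2 * x$5 + r$3 * x$6 + r$4 * x$7,
     x$8]"

lemma sl3_inv_sl3:
  assumes "det3 p q r = 1"
  shows "sl3_inv p q r (sl3 p q r x) = x"
proof -
  have "\<forall>i. sl3_inv p q r (sl3 p q r x) $ i = (if i = 1 \<or> i = 8 then x$i else det3 p q r * x$i)"
    by (simp add: forall_8 sl3_inv_def sl3_def det3_def algebra_simps)
  then show ?thesis
    by (simp add: vec_eq_iff assms)
qed

text \<open>
  For arbitrary columns the two sides differ by multiples of \<open>det3 p q r - 1\<close>: dot products of a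
  vector and a covector are multiplied by the determinant, and so are cross products of covectors.
\<close>

lemma sl3_omul:
  assumes "det3 p q r = 1"
  shows "sl3 p q r (omul x y) = omul (sl3 p q r x) (sl3 p q r y)"
proof -
  let ?D = "det3 p q r - 1"
  \<comment> \<open>the image of the cross product of the lower left entries of \<open>x\<close> and \<open>y\<close>\<close>
  let ?E = "sl3 p q r (vector [0, x$6 * y$7 - x$7 * y$6, x$7 * y$5 - x$5 * y$7, x$5 * y$6 - x$6 * y$5, 0, 0, 0, 0])"
  have "\<forall>i. omul (sl3 p q r x) (sl3 p q r y) $ i = sl3 p q r (omul x y) $ i +
      ?D * (vector [x$2 * y$5 + x$3 * y$6 + x$4 * y$7, - ?E$2, - ?E$3, - ?E$4, 0, 0, 0,
        x$5 * y$2 + x$6 * y$3 + x$7 * y$4] :: octonion) $ i"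
    by (simp add: forall_8 sl3_def det3_def algebra_simps)
  then show ?thesis
    by (simp add: vec_eq_iff assms)
qed

lemma G2_sl3:
  assumes "det3 p q r = 1"
  shows "\<exists>A\<in>G2. \<forall>x. A *v x = sl3 p q r x"
  by (rule G2I[where g = "sl3_inv p q r"])
    (simp_all add: sl3_inv_sl3 sl3_omul assms, simp_all add: octonion_eq_iff sl3_def algebra_simps)

definition G2_related :: "octonion \<Rightarrow> octonion \<Rightarrow> bool" where
  "G2_related x y \<longleftrightarrow> (\<exists>A\<in>G2. A *v x = y)"

lemma G2_related_trans: "G2_related x y \<Longrightarrow> G2_related y z \<Longrightarrow> G2_related x z"
  unfolding G2_related_def using G2_mult by (metis matrix_vector_mul_assoc)

lemma G2_related_sym: "G2_related x y \<Longrightarrow> G2_related y x"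
  unfolding G2_related_def by (metis G2_inverse matrix_vector_mul_assoc matrix_vector_mul_lid)

lemma G2_relatedI: "\<exists>A\<in>G2. \<forall>x. A *v x = f x \<Longrightarrow> G2_related x (f x)"
  unfolding G2_related_def by blast

lemma G2_related_inv: "G2_related x y \<Longrightarrow> x \<in> V7 \<Longrightarrow> y \<in> V7 \<and> onorm2 y = onorm2 x \<and> (x \<noteq> 0 \<longrightarrow> y \<noteq> 0)"
proof -
  assume "G2_related x y" and x: "x \<in> V7"
  then obtain A where A: "A \<in> G2" "A *v x = y" by (auto simp: G2_related_def)
  then obtain B where "B *v y = x"
    by (metis G2_inverse matrix_vector_mul_assoc matrix_vector_mul_lid)
  then have "x \<noteq> 0 \<longrightarrow> y \<noteq> 0" by auto
  then show ?thesis using G2_V7_norm[OF A(1) x] A(2) by blast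
qed

lemma complete_det3:
  assumes "p$2 \<noteq> 0 \<or> p$3 \<noteq> 0 \<or> p$4 \<noteq> 0"
  obtains q r where "det3 p q r = 1"
proof -
  consider "p$2 \<noteq> 0" | "p$3 \<noteq> 0" | "p$4 \<noteq> 0" using assms by blast
  then show ?thesis
  proof cases
    case 1
    then show ?thesis
      using that[of "axis 3 1" "axis 4 (inverse (p$2))"] by (simp add: det3_def axis_nth)
  next
    case 2
    then show ?thesis
      using that[of "axis 4 1" "axis 2 (inverse (p$3))"] by (simp add: det3_def axis_nth)
  next
    case 3
    then show ?thesis
      using that[of "axis 2 1" "axis 3 (inverse (p$4))"] by (simp add: det3_def axis_nth)
  qed
qed

lemma G2_related_axis2:
  assumes "x$1 = 0" "x$8 = 0" "x$5 = 0" "x$6 = 0" "x$7 = 0" "x \<noteq> 0"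
  shows "G2_related x (axis 2 1)"
proof -
  have "x$2 \<noteq> 0 \<or> x$3 \<noteq> 0 \<or> x$4 \<noteq> 0"
    using assms by (auto simp: octonion_eq_iff)
  then obtain q r where d: "det3 x q r = 1"
    using complete_det3 by blast
  have "sl3 x q r (axis 2 1) = x"
    using assms by (simp add: octonion_eq_iff sl3_def axis_nth)
  then show ?thesis
    using G2_relatedI[OF G2_sl3[OF d], of "axis 2 1"] G2_related_sym by simp
qed

lemma shear_solve:
  fixes s :: complex
  assumes "v$5 \<noteq> 0 \<or> v$6 \<noteq> 0 \<or> v$7 \<noteq> 0"
  obtains c :: octonion where "c$2 * v$5 + c$3 * v$6 + c$4 * v$7 = s"
proof -
  consider "v$5 \<noteq> 0" | "v$6 \<noteq> 0" | "v$7 \<noteq> 0" using assms by blast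
  then show ?thesis
  proof cases
    case 1 then show ?thesis using that[of "axis 2 (s / v$5)"] by (simp add: axis_nth)
  next
    case 2 then show ?thesis using that[of "axis 3 (s / v$6)"] by (simp add: axis_nth)
  next
    case 3 then show ?thesis using that[of "axis 4 (s / v$7)"] by (simp add: axis_nth)
  qed
qed

text \<open>
  In the notation \<open>(a, u, v, -a)\<close> for imaginary octonions: a shear makes \<open>a = 0\<close> if \<open>v \<noteq> 0\<close>, while
  for \<open>v = 0\<close> the norm forces \<open>a = 0\<close>; the swap provides \<open>u \<noteq> 0\<close>; as \<open>u\<close> and \<open>v\<close> are then
  orthogonal, \<open>v\<close> is a cross product of \<open>u\<close> with a vector orthogonal to \<open>v\<close>, and a shear along that
  vector removes it.  What remains is a vector of 3-space, on which \<open>sl3\<close> is transitive.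
\<close>

lemma G2_transitive_null:
  assumes "x \<in> V7" "onorm2 x = 0" "x \<noteq> 0"
  shows "G2_related x (axis 2 1)"
proof -
  define Q where "Q y \<longleftrightarrow> y \<in> V7 \<and> onorm2 y = 0 \<and> y \<noteq> 0" for y
  have Q: "Q y \<Longrightarrow> G2_related y z \<Longrightarrow> Q z" for y z
    unfolding Q_def using G2_related_inv by metis
  have 1: "G2_related y (axis 2 1)" if "Q y" "y$1 = 0" and u: "y$2 \<noteq> 0 \<or> y$3 \<noteq> 0 \<or> y$4 \<noteq> 0" for y
  proof -
    have y8: "y$8 = 0"
      using that by (simp add: Q_def V7_def)
    have "y$2 * y$5 + y$3 * y$6 + y$4 * y$7 = y$1 * y$8"
      using that(1) unfolding Q_def onorm2_def by (metis eq_iff_diff_eq_0)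
    then have n: "y$2 * y$5 + y$3 * y$6 + y$4 * y$7 = 0"
      by (simp only: that(2) mult_zero_left)
    have "\<exists>w::octonion. w$5 * y$2 + w$6 * y$3 + w$7 * y$4 = 1"
    proof -
      obtain w :: octonion where "w$2 * oswap y$5 + w$3 * oswap y$6 + w$4 * oswap y$7 = 1"
        using shear_solve[of "oswap y" 1] u by (auto simp: oswap_def)
      then show ?thesis
        by (intro exI[of _ "oswap w"]) (simp add: oswap_def)
    qed
    then obtain w :: octonion where w: "w$5 * y$2 + w$6 * y$3 + w$7 * y$4 = 1" by blast
    \<comment> \<open>the cross product of \<open>v\<close> and \<open>w\<close>, where \<open>w\<close> is a covector with \<open>w \<cdot> u = 1\<close>\<close>
    let ?c = "vector [0, w$7 * y$6 - w$6 * y$7, w$5 * y$7 - w$7 * y$5, w$6 * y$5 - w$5 * y$6, 0, 0, 0, 0] :: octonion"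
    have c0: "?c$2 * y$5 + ?c$3 * y$6 + ?c$4 * y$7 = 0"
      by (simp add: algebra_simps)
    have "shear ?c y $ 5 = y$5 * (1 - (w$5 * y$2 + w$6 * y$3 + w$7 * y$4)) + w$5 * (y$2 * y$5 + y$3 * y$6 + y$4 * y$7)"
      "shear ?c y $ 6 = y$6 * (1 - (w$5 * y$2 + w$6 * y$3 + w$7 * y$4)) + w$6 * (y$2 * y$5 + y$3 * y$6 + y$4 * y$7)"
      "shear ?c y $ 7 = y$7 * (1 - (w$5 * y$2 + w$6 * y$3 + w$7 * y$4)) + w$7 * (y$2 * y$5 + y$3 * y$6 + y$4 * y$7)"
      by (simp_all add: shear_def Let_def algebra_simps)
    then have v: "shear ?c y $ 5 = 0" "shear ?c y $ 6 = 0" "shear ?c y $ 7 = 0"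
      by (simp_all add: w n)
    have a: "shear ?c y $ 1 = 0" "shear ?c y $ 8 = 0"
      by (simp_all only: shear_nth[OF c0] that y8) simp_all
    have r: "G2_related y (shear ?c y)"
      by (rule G2_relatedI[OF G2_shear])
    have "shear ?c y \<noteq> 0"
      using Q[OF that(1) r] by (simp add: Q_def)
    then show ?thesis
      using G2_related_trans[OF r G2_related_axis2[OF a v]] by simp
  qed
  have 2: "G2_related y (axis 2 1)" if "Q y" "y$1 = 0" for y
  proof (cases "y$2 \<noteq> 0 \<or> y$3 \<noteq> 0 \<or> y$4 \<noteq> 0")
    case False
    have r: "G2_related y (oswap y)"
      by (rule G2_relatedI[OF G2_oswap])
    have y8: "y$8 = 0"
      using that by (simp add: Q_def V7_def)
    then have "y$5 \<noteq> 0 \<or> y$6 \<noteq> 0 \<or> y$7 \<noteq> 0"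
      using False that by (auto simp: Q_def octonion_eq_iff)
    then have "G2_related (oswap y) (axis 2 1)"
      using y8 by (intro 1 Q[OF that(1) r]) (simp_all add: oswap_def)
    then show ?thesis
      using r G2_related_trans by blast
  qed (use 1 that in blast)
  have Qx: "Q x" using assms by (simp add: Q_def)
  show ?thesis
  proof (cases "x$5 \<noteq> 0 \<or> x$6 \<noteq> 0 \<or> x$7 \<noteq> 0")
    case True
    then obtain c :: octonion where c: "c$2 * x$5 + c$3 * x$6 + c$4 * x$7 = x$1"
      using shear_solve by blast
    have r: "G2_related x (shear c x)"
      by (rule G2_relatedI[OF G2_shear])
    have "shear c x $ 1 = 0"
      unfolding shear_def Let_def c by simp
    then show ?thesis
      using 2[OF Q[OF Qx r]] r G2_related_trans by blast
  next
    case False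
    then have "x$1 = 0"
      using assms by (auto simp: V7_def onorm2_def add_eq_0_iff)
    then show ?thesis using 2[OF Qx] by blast
  qed
qed

text \<open>
  As for null vectors, but the shear is used to obtain \<open>a = 1\<close>.  Then \<open>u\<close> and \<open>v\<close> are orthogonal, and
  the shear along \<open>- u / 2\<close> removes \<open>u\<close>; the swap brings \<open>v\<close> into the place of \<open>u\<close>, where another
  shear removes it.
\<close>

lemma G2_transitive_unit:
  assumes "x \<in> V7" "onorm2 x = -1"
  shows "G2_related x h7"
proof -
  define Q where "Q y \<longleftrightarrow> y \<in> V7 \<and> onorm2 y = -1" for y
  have Q: "Q y \<Longrightarrow> G2_related y z \<Longrightarrow> Q z" for y z
    unfolding Q_def using G2_related_inv by metis
  have 0: "G2_related y h7" if "Q y" "y$1 = 1" "y$5 = 0" "y$6 = 0" "y$7 = 0" for y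
  proof -
    have y8: "y$8 = -1"
      using that by (simp add: Q_def V7_def add_eq_0_iff)
    have "shear (vector [0, - y$2 / 2, - y$3 / 2, - y$4 / 2, 0, 0, 0, 0]) y = h7"
      using that y8 by (simp add: octonion_eq_iff shear_def Let_def)
    then show ?thesis
      by (metis G2_relatedI[OF G2_shear])
  qed
  have 1: "G2_related y h7" if "Q y" "y$1 = 1" for y
  proof -
    have y8: "y$8 = -1"
      using that by (simp add: Q_def V7_def add_eq_0_iff)
    have "y$1 * y$8 - (y$2 * y$5 + y$3 * y$6 + y$4 * y$7) = -1"
      using that(1) unfolding Q_def onorm2_def by blast
    then have "y$2 * y$5 + y$3 * y$6 + y$4 * y$7 = y$1 * y$8 + 1"
      by algebra
    then have n: "y$2 * y$5 + y$3 * y$6 + y$4 * y$7 = 0"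
      unfolding that(2) y8 by simp
    define c :: octonion where "c = vector [0, - y$2 / 2, - y$3 / 2, - y$4 / 2, 0, 0, 0, 0]"
    have s: "c$2 * y$5 + c$3 * y$6 + c$4 * y$7 = 0"
    proof -
      have "c$2 * y$5 + c$3 * y$6 + c$4 * y$7 = - (y$2 * y$5 + y$3 * y$6 + y$4 * y$7) / 2"
        by (simp add: c_def field_simps)
      then show ?thesis by (simp add: n)
    qed
    have u: "shear c y $ 2 = 0" "shear c y $ 3 = 0" "shear c y $ 4 = 0" "shear c y $ 1 = 1" "shear c y $ 8 = -1"
      unfolding shear_nth[OF s] by (simp_all add: that y8 c_def)
    define z where "z = oswap (shear c y)"
    have r: "G2_related y z"
      unfolding z_def by (rule G2_related_trans[OF G2_relatedI[OF G2_shear] G2_relatedI[OF G2_oswap]])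
    have z: "z$1 = -1" "z$8 = 1" "z$5 = 0" "z$6 = 0" "z$7 = 0"
      by (simp_all add: z_def oswap_def u)
    have "shear (vector [0, z$2 / 2, z$3 / 2, z$4 / 2, 0, 0, 0, 0]) z = - h7"
      using z by (simp add: octonion_eq_iff shear_def Let_def)
    then have "G2_related z (- h7)"
      by (metis G2_relatedI[OF G2_shear])
    moreover have "oswap (- h7) = h7"
      by (simp add: octonion_eq_iff oswap_def)
    then have "G2_related (- h7) h7"
      by (metis G2_relatedI[OF G2_oswap])
    ultimately show ?thesis
      using r G2_related_trans by blast
  qed
  have Qx: "Q x" using assms by (simp add: Q_def)
  show ?thesis
  proof (cases "x$5 \<noteq> 0 \<or> x$6 \<noteq> 0 \<or> x$7 \<noteq> 0")
    case True
    then obtain c :: octonion where c: "c$2 * x$5 + c$3 * x$6 + c$4 * x$7 = x$1 - 1"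
      using shear_solve by blast
    have r: "G2_related x (shear c x)"
      by (rule G2_relatedI[OF G2_shear])
    have "shear c x $ 1 = 1"
      unfolding shear_def Let_def c by simp
    then show ?thesis
      using 1[OF Q[OF Qx r]] r G2_related_trans by blast
  next
    case False
    then have "x$1 * x$1 = 1"
      using assms by (auto simp: V7_def onorm2_def add_eq_0_iff)
    then consider "x$1 = 1" | "x$1 = -1"
      by (metis square_eq_1_iff)
    then show ?thesis
    proof cases
      case 1
      then show ?thesis using \<open>\<And>y. Q y \<Longrightarrow> y$1 = 1 \<Longrightarrow> G2_related y h7\<close> Qx by blast
    next
      case 2
      have r: "G2_related x (oswap x)"
        by (rule G2_relatedI[OF G2_oswap])
      have "oswap x $ 1 = 1"
        using assms(1) 2 by (simp add: oswap_def V7_def add_eq_0_iff)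
      then show ?thesis
        using 1[OF Q[OF Qx r]] r G2_related_trans by blast
    qed
  qed
qed

section \<open>The group action on the double Cayley Grassmannian\<close>

abbreviation DG_space :: "spinor set" where
  "DG_space \<equiv> Delta.span ({tensor x y | x y. x \<in> V7 \<and> y \<in> V7} \<union> {zspin})"

definition V7_tensor_V7 :: "spinor set" where
  "V7_tensor_V7 = {A. (\<forall>j. column j A \<in> V7) \<and> (\<forall>i. row i A \<in> V7)}"

lemma zspin_nth: "zspin $ i $ j = oone $ i * oone $ j"
  by (simp add: zspin_def tensor_nth)

lemma V7_scale: "x \<in> V7 \<Longrightarrow> c *s x \<in> V7"
  by (simp add: V7_def flip: distrib_left)

lemma DG_space_decompose:
  assumes "M \<in> DG_space"
  obtains A c where "A \<in> V7_tensor_V7" "M = A + cscale c zspin"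
proof -
  let ?S = "{A + cscale c zspin | A c. A \<in> V7_tensor_V7}"
  have zero: "0 \<in> V7_tensor_V7"
    by (simp add: V7_tensor_V7_def V7_def)
  have add: "A + B \<in> V7_tensor_V7" if "A \<in> V7_tensor_V7" "B \<in> V7_tensor_V7" for A B
    using that by (simp add: V7_tensor_V7_def column_row_linear V7_add)
  have scale: "cscale c A \<in> V7_tensor_V7" if "A \<in> V7_tensor_V7" for A c
    using that by (simp add: V7_tensor_V7_def column_row_linear V7_scale)
  have "Delta.subspace ?S"
  proof (rule Delta.subspaceI)
    show "0 \<in> ?S"
      using zero by (intro CollectI exI[of _ 0] exI[of _ "0::complex"]) simp
    show "M + N \<in> ?S" if "M \<in> ?S" "N \<in> ?S" for M N
    proof -
      obtain A c where "M = A + cscale c zspin" "A \<in> V7_tensor_V7"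
        using \<open>M \<in> ?S\<close> by blast
      moreover obtain B d where "N = B + cscale d zspin" "B \<in> V7_tensor_V7"
        using \<open>N \<in> ?S\<close> by blast
      ultimately show ?thesis
        using add by (intro CollectI exI[of _ "A + B"] exI[of _ "c + d"]) (simp add: Delta.scale_left_distrib)
    qed
    show "cscale k M \<in> ?S" if M: "M \<in> ?S" for k M
    proof -
      obtain A c where "M = A + cscale c zspin" "A \<in> V7_tensor_V7"
        using M by blast
      then show ?thesis
        using scale by (intro CollectI exI[of _ "cscale k A"] exI[of _ "k * c"]) (simp add: Delta.scale_right_distrib)
    qed
  qed
  moreover have "{tensor x y | x y. x \<in> V7 \<and> y \<in> V7} \<union> {zspin} \<subseteq> ?S"
  proof (intro Un_least subsetI)
    fix M assume "M \<in> {tensor x y | x y. x \<in> V7 \<and> y \<in> V7}"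
    then have "M \<in> V7_tensor_V7"
      by (auto simp: V7_tensor_V7_def column_row_tensor V7_scale)
    then show "M \<in> ?S"
      by (intro CollectI exI[of _ M] exI[of _ "0::complex"]) simp
  next
    fix M assume "M \<in> {zspin}"
    then show "M \<in> ?S"
      using zero by (intro CollectI exI[of _ 0] exI[of _ "1::complex"]) simp
  qed
  ultimately have "DG_space \<subseteq> ?S"
    by (rule Delta.span_minimal[rotated])
  then show ?thesis using assms that by blast
qed

lemma DG_iff: "M \<noteq> 0 \<Longrightarrow> Delta.span {M} \<in> DG \<longleftrightarrow> pure_spinor M \<and> M \<in> DG_space"
proof -
  assume M: "M \<noteq> 0"
  have "Delta.span {M} \<in> proj DG_space \<longleftrightarrow> M \<in> DG_space"
  proof
    assume "Delta.span {M} \<in> proj DG_space"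
    then obtain N where N: "N \<in> DG_space" "Delta.span {M} = Delta.span {N}"
      by (auto simp: proj_def)
    then obtain c where "M = cscale c N"
      using span_lineD[of N M] M by metis
    then show "M \<in> DG_space"
      using N(1) by (simp add: Delta.span_scale)
  qed (use M in \<open>auto simp: proj_def\<close>)
  then show ?thesis
    using M by (simp add: DG_def spinor_variety_eq pure_lines_iff)
qed

lemma DG_cases:
  assumes "p \<in> DG"
  obtains M where "M \<noteq> 0" "p = Delta.span {M}" "pure_spinor M" "M \<in> DG_space"
proof -
  obtain M where M: "M \<noteq> 0" "p = Delta.span {M}"
    using assms by (auto simp: DG_def proj_def)
  then show ?thesis
    using that[OF M] assms DG_iff[OF M(1)] by simp
qed

lemma act_linear:
  "act t (M + N) = act t M + act t N" "act t (cscale c M) = cscale c (act t M)"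
  by (simp_all add: act_def matrix_add_ldistrib matrix_add_rdistrib cscale_matrix)

lemma act_image_line: "act t ` Delta.span {M} = Delta.span {act t M}"
  by (rule image_line) (rule act_linear(2))

lemma act_comp: "act t (act s M) = act (fst t ** fst s, snd t ** snd s) M"
  by (simp add: act_def matrix_mul_assoc matrix_transpose_mul)

lemma act_one: "act (mat 1, mat 1) M = M"
  by (simp add: act_def transpose_mat)

lemma act_tensor: "act t (tensor x y) = tensor (fst t *v x) (snd t *v y)"
  by (simp add: act_def tensor_matrix)

text \<open>
  Conjugation by \<open>act (g, h)\<close> moves the unit vectors of a Clifford product by the isometry \<open>(g, h)\<close>.
\<close>

lemma act_normalises_spin14:
  assumes "g \<in> G2" "h \<in> G2" "k \<in> spin14"
  obtains k' where "k' \<in> spin14" "\<And>M. act (g, h) (k M) = k' (act (g, h) M)"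
proof -
  have "\<exists>k'\<in>spin14. \<forall>M. act (g, h) (k M) = k' (act (g, h) M)"
    using assms(3)
  proof induction
    case spin14_id
    then show ?case by (intro bexI[of _ id]) (simp_all add: spin14.spin14_id)
  next
    case (spin14_mult v w k)
    then obtain k' where k': "k' \<in> spin14" "\<And>M. act (g, h) (k M) = k' (act (g, h) M)" by blast
    obtain a b a' b' where vw: "v = (a, b)" "w = (a', b')" by (metis surj_pair)
    have V: "(g *v a, h *v b) \<in> V7 \<times> V7" "(g *v a', h *v b') \<in> V7 \<times> V7"
      using spin14_mult(1,2) G2_V7_norm(1)[OF assms(1)] G2_V7_norm(1)[OF assms(2)] by (simp_all add: vw)
    have q: "quad14 (g *v a, h *v b) = 1" "quad14 (g *v a', h *v b') = 1"
      using spin14_mult(3,4) by (simp_all add: vw quad14_def G2_preserves(3) assms)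
    have "(\<lambda>M. cliff_minus (g *v a, h *v b) (cliff_plus (g *v a', h *v b') M)) \<circ> k' \<in> spin14"
      by (intro spin14_comp spin14_pair V q k')
    then show ?case
      by (rule rev_bexI) (simp add: vw act_cliff[OF assms(1,2)] k'(2))
  qed
  then show ?thesis using that by blast
qed

text \<open>
  Write \<open>M\<close> as a multiple of \<open>k hwv\<close> with \<open>k\<close> in the spin group.  The action normalises the spin
  group and sends \<open>hwv\<close> to a tensor of two null octonions, which is again pure.
\<close>

lemma pure_spinor_act:
  assumes t: "t \<in> G2 \<times> G2" and M: "pure_spinor M"
  shows "pure_spinor (act t M)"
proof (cases "M = 0")
  case True
  then have "act t M = M"
    using act_linear(2)[of t 0 M] by simp
  then show ?thesis using M by simp
next
  case False
  obtain g h where gh: "t = (g, h)" "g \<in> G2" "h \<in> G2"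
    using t by auto
  obtain k c where k: "k \<in> spin14" "c \<noteq> 0" "M = cscale c (k hwv)"
    using pure_spinor_in_orbit[OF M False] by blast
  obtain k' where k': "k' \<in> spin14" "\<And>M. act (g, h) (k M) = k' (act (g, h) M)"
    using act_normalises_spin14[OF gh(2,3) k(1)] by blast
  have "pure_spinor (act (g, h) hwv)"
    unfolding hwv_def act_tensor
    by (intro pure_spinor_tensor) (simp_all add: G2_preserves(3) gh, simp_all add: onorm2_def axis_nth)
  then show ?thesis
    using pure_spinor_spin14[OF k'(1)] by (simp add: k(3) gh(1) act_linear k'(2) pure_spinor_scale[OF k(2)])
qed

lemma DG_space_act:
  assumes t: "t \<in> G2 \<times> G2" and M: "M \<in> DG_space"
  shows "act t M \<in> DG_space"
  using M
proof (induction rule: Delta.span_induct)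
  show "Delta.subspace {M. act t M \<in> DG_space}"
    using act_linear(2)[of t 0 0]
    by (intro Delta.subspaceI) (simp_all add: act_linear Delta.span_add Delta.span_scale Delta.span_zero)
next
  fix M assume "M \<in> {tensor x y | x y. x \<in> V7 \<and> y \<in> V7} \<union> {zspin}"
  then consider x y where "M = tensor x y" "x \<in> V7" "y \<in> V7" | "M = zspin" by blast
  then show "act t M \<in> DG_space"
  proof cases
    case 1
    have "fst t *v x \<in> V7" "snd t *v y \<in> V7"
      using t 1 G2_V7_norm(1) by auto
    then have "act t M \<in> {tensor x y | x y. x \<in> V7 \<and> y \<in> V7}"
      unfolding 1(1) act_tensor by blast
    then show ?thesis
      by (intro Delta.span_base) blast
  next
    case 2
    then show ?thesis
      by (simp add: act_zspin[OF t] Delta.span_base)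
  qed
qed

lemma act_invertible:
  assumes "t \<in> G2 \<times> G2"
  obtains s where "s \<in> G2 \<times> G2" "\<And>M. act s (act t M) = M" "\<And>M. act t (act s M) = M"
proof -
  obtain g h where gh: "t = (g, h)" "g \<in> G2" "h \<in> G2"
    using assms by auto
  obtain g' where g': "g' \<in> G2" "g ** g' = mat 1" "g' ** g = mat 1"
    using G2_inverse[OF gh(2)] by blast
  obtain h' where h': "h' \<in> G2" "h ** h' = mat 1" "h' ** h = mat 1"
    using G2_inverse[OF gh(3)] by blast
  show ?thesis
    by (rule that[of "(g', h')"]) (simp_all add: gh g' h' act_comp act_one)
qed

lemma act_nonzero:
  assumes "t \<in> G2 \<times> G2" "M \<noteq> 0"
  shows "act t M \<noteq> 0"
proof
  assume eq: "act t M = 0"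
  obtain s where s: "\<And>M. act s (act t M) = M"
    using act_invertible[OF assms(1)] by metis
  have "act s 0 = 0"
    using act_linear(2)[of s 0 0] by simp
  then show False
    using s[of M] eq assms(2) by simp
qed

lemma DG_act:
  assumes "t \<in> G2 \<times> G2" "p \<in> DG"
  shows "act t ` p \<in> DG"
proof -
  obtain M where M: "M \<noteq> 0" "p = Delta.span {M}" "pure_spinor M" "M \<in> DG_space"
    using DG_cases[OF assms(2)] by blast
  show ?thesis
    unfolding M(2) act_image_line DG_iff[OF act_nonzero[OF assms(1) M(1)]]
    using pure_spinor_act[OF assms(1) M(3)] DG_space_act[OF assms(1) M(4)] by blast
qed

text \<open>
  Cartan's equation with the row indices 2 and 5, the latter the nonzero coordinate of \<open>odual 2\<close>: its
  right hand side vanishes, and its left hand side is the norm form on the space of columns.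
\<close>

lemma columns_null_of_rows_zero:
  assumes pure: "pure_spinor M" and rows: "row 2 M = 0" "row 5 M = 0"
  shows "onorm2 (a *s column j M + b *s column l M) = 0"
proof -
  have cas0: "casimir 0 0 i k = 0" for i k
    by (simp add: casimir_def omul_linear)
  have cas: "casimir (column j M) (column l M) 2 5 = 0" for j l
    using pure unfolding pure_spinor_casimir by (metis cas0 rows)
  have "casimir (a *s column j M + b *s column l M) (a *s column j M + b *s column l M) 2 5 = 0"
    by (simp only: casimir_linear cas) simp
  then show ?thesis
    by (simp add: casimir_self odual_def axis_nth)
qed

text \<open>
  The spinors considered here are those of weight 0 for the standard torus of \<open>G2 \<times> G2\<close>.  The
  columns 1 and 8, combined as in the proof, have norm \<open>4 c\<^sup>2\<close> and \<open>c\<^sup>2 - a\<^sup>2\<close>.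
\<close>

lemma not_pure_weight_zero:
  assumes "pure_spinor (cscale a (tensor h7 h7) + cscale c zspin)"
  shows "a = 0 \<and> c = 0"
proof -
  let ?M = "cscale a (tensor h7 h7) + cscale c zspin"
  have rows: "row 2 ?M = 0" "row 5 ?M = 0"
    by (simp_all add: vec_eq_iff cscale_nth tensor_nth zspin_nth)
  have "onorm2 (1 *s column 1 ?M + 1 *s column 8 ?M) = 0" "onorm2 (1 *s column 1 ?M + 0 *s column 8 ?M) = 0"
    by (rule columns_null_of_rows_zero[OF assms rows])+
  then show ?thesis
    by (simp add: onorm2_def cscale_nth tensor_nth zspin_nth)
qed

section \<open>The closed orbit\<close>

lemma tensor_nonzero: "x \<noteq> 0 \<Longrightarrow> y \<noteq> 0 \<Longrightarrow> tensor x y \<noteq> 0"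
  by (auto simp: vec_eq_iff tensor_nth)

lemma tensor_in_DG_space: "x \<in> V7 \<Longrightarrow> y \<in> V7 \<Longrightarrow> tensor x y \<in> DG_space"
  by (rule Delta.span_base) blast

lemma Q5xQ5_subset_DG: "Q5xQ5 \<subseteq> DG"
proof
  fix p assume "p \<in> Q5xQ5"
  then obtain x y where xy: "p = Delta.span {tensor x y}" "x \<in> V7" "x \<noteq> 0" "onorm2 x = 0"
    "y \<in> V7" "y \<noteq> 0" "onorm2 y = 0"
    unfolding Q5xQ5_def by blast
  show "p \<in> DG"
    unfolding xy(1) DG_iff[OF tensor_nonzero[OF xy(3,6)]]
    by (intro conjI pure_spinor_tensor tensor_in_DG_space xy)
qed

lemma axis2_null: "axis 2 1 \<in> V7" "onorm2 (axis 2 1) = 0" "axis 2 1 \<noteq> (0 :: octonion)"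
  by (simp_all add: V7_def onorm2_def axis_nth octonion_eq_iff)

abbreviation null_line :: "spinor set" where
  "null_line \<equiv> Delta.span {tensor (axis 2 1) (axis 2 1)}"

lemma Q5xQ5_orbit: "{g ` null_line | g. g \<in> act ` (G2 \<times> G2)} = Q5xQ5"
proof (intro equalityI subsetI)
  fix p assume "p \<in> {g ` null_line | g. g \<in> act ` (G2 \<times> G2)}"
  then obtain A B where AB: "A \<in> G2" "B \<in> G2" "p = Delta.span {tensor (A *v axis 2 1) (B *v axis 2 1)}"
    by (auto simp: act_image_line act_tensor)
  have "A *v axis 2 1 \<in> V7 \<and> onorm2 (A *v axis 2 1) = 0 \<and> A *v axis 2 1 \<noteq> 0" if "A \<in> G2" for A
    using G2_related_inv[of "axis 2 1" "A *v axis 2 1"] axis2_null that by (auto simp: G2_related_def)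
  then show "p \<in> Q5xQ5"
    unfolding Q5xQ5_def AB(3) using AB(1,2) by blast
next
  fix p assume "p \<in> Q5xQ5"
  then obtain x y where xy: "p = Delta.span {tensor x y}" "x \<in> V7" "x \<noteq> 0" "onorm2 x = 0"
    "y \<in> V7" "y \<noteq> 0" "onorm2 y = 0"
    unfolding Q5xQ5_def by blast
  obtain A where A: "A \<in> G2" "A *v axis 2 1 = x"
    using G2_related_sym[OF G2_transitive_null[OF xy(2,4,3)]] unfolding G2_related_def by blast
  obtain B where B: "B \<in> G2" "B *v axis 2 1 = y"
    using G2_related_sym[OF G2_transitive_null[OF xy(5,7,6)]] unfolding G2_related_def by blast
  have "p = act (A, B) ` null_line"
    by (simp add: act_image_line act_tensor A B xy(1))
  then show "p \<in> {g ` null_line | g. g \<in> act ` (G2 \<times> G2)}"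
    using A B by blast
qed

lemma fun_algebra_diff:
  assumes "f \<in> fun_algebra S" "g \<in> fun_algebra S"
  shows "(\<lambda>x. f x - g x) \<in> fun_algebra S"
  using fun_algebra_add[OF assms(1) fun_algebra_mult[OF fun_algebra_const[of "-1"] assms(2)]] by simp

text \<open>
  The number \<open>n\<close> selects a family of equations: rank at most one, columns and rows imaginary,
  columns and rows null.
\<close>

definition Q5xQ5_equation :: "nat \<times> 8 \<times> 8 \<times> 8 \<times> 8 \<Rightarrow> spinor \<Rightarrow> complex" where
  "Q5xQ5_equation = (\<lambda>(n, i, j, k, l) M.
     if n = 0 then M$i$j * M$k$l - M$i$l * M$k$j
     else if n = 1 then M$1$j + M$8$j
     else if n = 2 then M$i$1 + M$i$8
     else if n = 3 then onorm2 (column j M)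
     else onorm2 (row i M))"

lemma zariski_closed_Q5xQ5: "zariski_closed Q5xQ5"
proof (rule zariski_closedI[where F = Q5xQ5_equation])
  show "Q5xQ5 \<subseteq> proj UNIV"
    unfolding Q5xQ5_def proj_def using tensor_nonzero by blast
next
  fix a :: "nat \<times> 8 \<times> 8 \<times> 8 \<times> 8"
  obtain n i j k l where a: "a = (n, i, j, k, l)" by (metis surj_pair)
  define S where "S = {(\<lambda>M :: spinor. M$i$j) | i j. True}"
  have entry: "(\<lambda>M. M$i$j) \<in> fun_algebra S" for i j
    unfolding S_def by (rule fun_algebra_gen) blast
  consider "n = 0" | "n = 1" | "n = 2" | "n = 3" | "n > 3" by linarith
  then show "Q5xQ5_equation a \<in> fun_algebra {(\<lambda>M. M$i$j) | i j. True}"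
    unfolding Q5xQ5_equation_def a prod.case onorm2_def column_row_nth S_def[symmetric]
    by cases (simp_all, (intro fun_algebra_add fun_algebra_mult fun_algebra_diff entry)+)
next
  fix M :: spinor assume M: "M \<noteq> 0"
  show "Delta.span {M} \<in> Q5xQ5 \<longleftrightarrow> (\<forall>a. Q5xQ5_equation a M = 0)"
  proof
    assume "Delta.span {M} \<in> Q5xQ5"
    then obtain x y where xy: "Delta.span {M} = Delta.span {tensor x y}" "x \<in> V7" "onorm2 x = 0"
      "y \<in> V7" "onorm2 y = 0"
      unfolding Q5xQ5_def by blast
    obtain c where c: "M = cscale c (tensor x y)"
      using span_lineD[OF xy(1)[symmetric] M] by blast
    have "x$1 + x$8 = 0" "y$1 + y$8 = 0"
      using xy by (simp_all add: V7_def)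
    then have "x$8 = - x$1" "y$8 = - y$1"
      by (simp_all add: add_eq_0_iff)
    then show "\<forall>a. Q5xQ5_equation a M = 0"
      using xy(3,5) by (simp add: Q5xQ5_equation_def c cscale_nth tensor_nth column_row_linear column_row_tensor onorm2_scale)
  next
    assume eqs: "\<forall>a. Q5xQ5_equation a M = 0"
    have rank: "M$i$j * M$k$l = M$i$l * M$k$j" for i j k l
      using eqs[rule_format, of "(0, i, j, k, l)"] by (simp add: Q5xQ5_equation_def)
    have col: "column j M \<in> V7" "onorm2 (column j M) = 0" for j
      using eqs[rule_format, of "(1, 1, j, 1, 1)"] eqs[rule_format, of "(3, 1, j, 1, 1)"]
      by (simp_all add: Q5xQ5_equation_def V7_def)
    have row: "row i M \<in> V7" "onorm2 (row i M) = 0" for i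
      using eqs[rule_format, of "(2, i, 1, 1, 1)"] eqs[rule_format, of "(4, i, 1, 1, 1)"]
      by (simp_all add: Q5xQ5_equation_def V7_def)
    obtain a b where ab: "M$a$b \<noteq> 0"
      using M by (auto simp: vec_eq_iff)
    have "tensor (column b M) (row a M) = cscale (M$a$b) M"
      using rank[of _ _ a b] by (simp add: vec_eq_iff tensor_nth cscale_nth mult.commute)
    then have "Delta.span {M} = Delta.span {tensor (column b M) (row a M)}"
      using span_line_scale[OF ab] by simp
    moreover have "column b M \<noteq> 0" "row a M \<noteq> 0"
      using ab by (metis column_row_nth(1) zero_index, metis column_row_nth(2) zero_index)
    ultimately show "Delta.span {M} \<in> Q5xQ5"
      unfolding Q5xQ5_def using col row by blast
  qed
qed

text \<open>
  The weights of the standard maximal torus of \<open>G2\<close> on the octonions; on \<open>V7\<close> these are 0 and the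
  six short roots.
\<close>

definition weights :: "complex \<Rightarrow> complex \<Rightarrow> octonion" where
  "weights a b = vector [1, a, b, inverse (a * b), inverse a, inverse b, a * b, 1]"

definition torus2 :: "complex \<Rightarrow> complex \<Rightarrow> complex^8^8" where
  "torus2 a b = (\<chi> i j. if i = j then weights a b $ i else 0)"

lemma torus2_mult_vec: "torus2 a b *v x = (\<chi> i. weights a b $ i * x $ i)"
  by (simp add: torus2_def matrix_vector_mult_def vec_eq_iff if_distrib if_distribR cong: if_cong)

lemma torus2_G2:
  assumes "a \<noteq> 0" "b \<noteq> 0"
  shows "torus2 a b \<in> G2"
proof -
  obtain A where A: "A \<in> G2" "\<And>x. A *v x = (\<chi> i. weights a b $ i * x $ i)"
    using G2I[where f = "\<lambda>x. \<chi> i. weights a b $ i * x $ i" and g = "\<lambda>x. \<chi> i. inverse (weights a b $ i) * x $ i"] assms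
    by (auto simp: octonion_eq_iff weights_def field_simps)
  then have "A = torus2 a b"
    by (simp add: matrix_eq torus2_mult_vec)
  then show ?thesis using A(1) by simp
qed

lemma act_torus2: "act (torus2 a b, torus2 c d) M $ i $ j = weights a b $ i * M$i$j * weights c d $ j"
proof -
  have "(torus2 a b ** M) $ i $ j = weights a b $ i * M$i$j" for i j
    by (simp add: torus2_def matrix_matrix_mult_def if_distrib if_distribR cong: if_cong)
  moreover have "(N ** transpose (torus2 c d)) $ i $ j = N$i$j * weights c d $ j" for N :: spinor and i j
    by (simp add: torus2_def matrix_matrix_mult_def transpose_def if_distrib if_distribR cong: if_cong)
  ultimately show ?thesis
    by (simp add: act_def)
qed

text \<open>
  The second coordinate of \<open>A x\<close> is the pairing of \<open>x\<close> with a null vector, which can be any one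
  because \<open>G2\<close> is transitive on null vectors; and null vectors span \<open>V7\<close>.
\<close>

lemma V7_separated:
  assumes x: "x \<in> V7" and zero: "\<And>A. A \<in> G2 \<Longrightarrow> (A *v x) $ 2 = 0"
  shows "x = 0"
proof -
  have obil0: "obil x y = 0" if y: "y \<in> V7" "onorm2 y = 0" "y \<noteq> 0" for y
  proof -
    have "axis 5 1 \<in> V7" "onorm2 (axis 5 1) = 0" "axis 5 1 \<noteq> (0 :: octonion)"
      by (simp_all add: V7_def onorm2_def axis_nth octonion_eq_iff)
    then have "G2_related y (axis 5 1)"
      using G2_transitive_null[OF y] G2_transitive_null G2_related_trans G2_related_sym by blast
    then obtain A where A: "A \<in> G2" "A *v y = axis 5 1"
      by (auto simp: G2_related_def)
    have "obil x y = obil (A *v x) (axis 5 1)"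
      using G2_obil[OF A(1)] A(2) by metis
    also have "\<dots> = - (A *v x) $ 2"
      by (simp add: obil_def axis_nth)
    finally show ?thesis using zero[OF A(1)] by simp
  qed
  have "obil x (axis 2 1) = 0" "obil x (axis 3 1) = 0" "obil x (axis 4 1) = 0" "obil x (axis 5 1) = 0"
    "obil x (axis 6 1) = 0" "obil x (axis 7 1) = 0" "obil x (h7 + axis 2 1 - axis 5 1) = 0"
    by (rule obil0; simp add: V7_def onorm2_def axis_nth octonion_eq_iff)+
  then show ?thesis
    using x by (simp add: octonion_eq_iff obil_def axis_nth V7_def add_eq_0_iff)
qed

text \<open>
  Apply separation to the rows of \<open>A\<close> and to the columns of \<open>A h\<^sup>T\<close>.
\<close>

lemma G2_move_to_22:
  assumes A: "A \<in> V7_tensor_V7" "A \<noteq> 0"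
  obtains t where "t \<in> G2 \<times> G2" "act t A $ 2 $ 2 \<noteq> 0"
proof (rule ccontr)
  assume *: "\<not> thesis"
  have "A = 0"
  proof -
    have "row i A = 0" for i
    proof (rule V7_separated)
      show "row i A \<in> V7" using A(1) by (simp add: V7_tensor_V7_def)
      fix h assume h: "h \<in> G2"
      define x where "x = column 2 (A ** transpose h)"
      have "x = 0"
      proof (rule V7_separated)
        have "x$i = (\<Sum>j\<in>UNIV. A$i$j * h$2$j)" for i
          by (simp add: x_def matrix_matrix_mult_def transpose_def)
        then have "x$1 + x$8 = (\<Sum>j\<in>UNIV. (column j A $ 1 + column j A $ 8) * h$2$j)"
          by (simp add: sum.distrib distrib_right)
        also have "\<dots> = 0"
          using A(1) by (simp add: V7_tensor_V7_def V7_def)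
        finally show "x \<in> V7" by (simp add: V7_def)
        fix g assume g: "g \<in> G2"
        have "act (g, h) A $ 2 $ 2 = 0"
          using * that[of "(g, h)"] g h by auto
        then show "(g *v x) $ 2 = 0"
        proof -
          have "(g ** N) $ 2 $ 2 = (g *v column 2 N) $ 2" for N :: spinor
            by (simp add: matrix_matrix_mult_def matrix_vector_mult_def)
          moreover have "act (g, h) A = g ** (A ** transpose h)"
            by (simp add: act_def matrix_mul_assoc)
          ultimately show ?thesis
            using \<open>act (g, h) A $ 2 $ 2 = 0\<close> by (simp add: x_def)
        qed
      qed
      then have "x $ i = 0" by simp
      then show "(h *v row i A) $ 2 = 0"
        by (simp add: x_def matrix_matrix_mult_def matrix_vector_mult_def transpose_def mult.commute)
    qed
    then show ?thesis
      by (metis column_row_nth(2) vec_eq_iff zero_index)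
  qed
  then show False using A(2) by simp
qed

text \<open>
  A one-parameter subgroup of the standard torus of \<open>G2\<close>, multiplied by \<open>s ^ 3\<close>: its seven weights
  on \<open>V7\<close> are distinct, and coordinate 2 has the least exponent.
\<close>

definition G2_scaling :: "complex \<Rightarrow> octonion" where
  "G2_scaling s = vector [s^3, 1, s^4, s^5, s^6, s^2, s, s^3]"

text \<open>
  A point of \<open>DG\<close> is \<open>A + c z\<close>, where \<open>A\<close> is in the tensor square of \<open>V7\<close> and \<open>z\<close> is fixed by
  \<open>G2 \<times> G2\<close>.  As \<open>z\<close> is not pure, \<open>A\<close> is nonzero, and it can be moved to have a nonzero
  entry of highest weight at \<open>(2, 2)\<close>; a torus then contracts it to this entry.
\<close>

lemma closed_G2_orbit_contains_axis2:
  assumes Y: "Y \<in> orbits (act ` (G2 \<times> G2)) DG" "zariski_closed Y"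
  shows "null_line \<in> Y"
proof -
  obtain p where p: "p \<in> DG" "Y = {g ` p | g. g \<in> act ` (G2 \<times> G2)}"
    using Y(1) by (auto simp: orbits_def)
  obtain M where M: "M \<noteq> 0" "p = Delta.span {M}" "pure_spinor M" "M \<in> DG_space"
    using DG_cases[OF p(1)] by blast
  obtain A c where A: "A \<in> V7_tensor_V7" "M = A + cscale c zspin"
    using DG_space_decompose[OF M(4)] by blast
  have "A \<noteq> 0"
  proof
    assume "A = 0"
    then have "pure_spinor (cscale 0 (tensor h7 h7) + cscale c zspin)"
      using M(3) A(2) by simp
    then have "c = 0" using not_pure_weight_zero by blast
    then show False using M(1) A(2) \<open>A = 0\<close> by simp
  qed
  then obtain t where t: "t \<in> G2 \<times> G2" "act t A $ 2 $ 2 \<noteq> 0"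
    using G2_move_to_22[OF A(1)] by blast
  define m where "m = act t M $ 2 $ 2"
  have m: "m \<noteq> 0"
    using t by (simp add: m_def A(2) act_linear act_zspin cscale_nth zspin_nth)
  define \<gamma> where "\<gamma> s = (\<chi> i j. G2_scaling s $ i * act t M $i$j * G2_scaling s $ j)" for s
  have \<gamma>0: "\<gamma> 0 = cscale m (tensor (axis 2 1) (axis 2 1))"
  proof -
    have "\<forall>p q. \<gamma> 0 $ p $ q = cscale m (tensor (axis 2 1) (axis 2 1)) $ p $ q"
      by (simp add: forall_8 \<gamma>_def G2_scaling_def cscale_nth tensor_nth axis_nth m_def)
    then show ?thesis by (simp add: vec_eq_iff)
  qed
  have "Delta.span {\<gamma> 0} \<in> Y"
  proof (rule zariski_closed_limit[OF Y(2)])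
    show "isCont (\<lambda>r. \<gamma> r $ i $ j) 0" for i j
    proof -
      have "\<forall>i. isCont (\<lambda>r. G2_scaling r $ i) 0"
        by (simp add: forall_8 G2_scaling_def)
      then show ?thesis
        by (simp add: \<gamma>_def)
    qed
    show "Delta.span {\<gamma> r} \<in> Y" if r: "r \<noteq> 0" for r
    proof -
      let ?t = "(torus2 (inverse r ^ 3) r, torus2 (inverse r ^ 3) r)"
      have t': "?t \<in> G2 \<times> G2"
        using r by (simp add: torus2_G2)
      have w: "\<forall>i. G2_scaling r $ i = r^3 * weights (inverse r ^ 3) r $ i"
        using r by (simp add: forall_8 G2_scaling_def weights_def field_simps eval_nat_numeral)
      have "\<gamma> r = cscale (r^6) (act ?t (act t M))"
        using w by (simp add: vec_eq_iff \<gamma>_def cscale_nth act_torus2 power_mult_distrib flip: power_add)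
      then have "Delta.span {\<gamma> r} = act ?t ` act t ` p"
        using r by (simp add: span_line_scale act_image_line M(2))
      also have "\<dots> = act (fst ?t ** fst t, snd ?t ** snd t) ` p"
        by (simp add: image_image act_comp)
      finally have "Delta.span {\<gamma> r} = act (fst ?t ** fst t, snd ?t ** snd t) ` p" .
      moreover have "(fst ?t ** fst t, snd ?t ** snd t) \<in> G2 \<times> G2"
        using t t' by (auto intro: G2_mult)
      ultimately show ?thesis
        unfolding p(2) by blast
    qed
    show "\<gamma> 0 \<noteq> 0"
      unfolding \<gamma>0 using m tensor_nonzero[OF axis2_null(3) axis2_null(3)] by simp
  qed
  then show ?thesis
    unfolding \<gamma>0 using span_line_scale[OF m] by simp
qed

lemma closed_G2_orbits:
  "{Y \<in> orbits (act ` (G2 \<times> G2)) DG. zariski_closed Y} = {Q5xQ5}"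
proof (intro equalityI subsetI)
  fix Y assume "Y \<in> {Q5xQ5}"
  moreover have "null_line \<in> DG"
    using Q5xQ5_subset_DG axis2_null unfolding Q5xQ5_def by blast
  then have "Q5xQ5 \<in> orbits (act ` (G2 \<times> G2)) DG"
    unfolding orbits_def using Q5xQ5_orbit by blast
  ultimately show "Y \<in> {Y \<in> orbits (act ` (G2 \<times> G2)) DG. zariski_closed Y}"
    using zariski_closed_Q5xQ5 by blast
next
  fix Y assume "Y \<in> {Y \<in> orbits (act ` (G2 \<times> G2)) DG. zariski_closed Y}"
  then have Y: "Y \<in> orbits (act ` (G2 \<times> G2)) DG" "zariski_closed Y" by blast+
  have "Y = {g ` null_line | g. g \<in> act ` (G2 \<times> G2)}"
  proof (rule orbit_of_point[OF _ _ Y(1) closed_G2_orbit_contains_axis2[OF Y]])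
    fix g h assume "g \<in> act ` (G2 \<times> G2)" "h \<in> act ` (G2 \<times> G2)"
    then obtain s t where st: "s \<in> G2 \<times> G2" "t \<in> G2 \<times> G2" "g = act s" "h = act t" by blast
    have "g \<circ> h = act (fst s ** fst t, snd s ** snd t)"
      by (simp add: fun_eq_iff st act_comp)
    then show "g \<circ> h \<in> act ` (G2 \<times> G2)"
      using st G2_mult by auto
  next
    fix g assume "g \<in> act ` (G2 \<times> G2)"
    then obtain t where t: "g = act t" "t \<in> G2 \<times> G2" by (rule imageE)
    obtain s where "s \<in> G2 \<times> G2" "\<And>M. act s (act t M) = M"
      using act_invertible[OF t(2)] by metis
    then show "\<exists>h\<in>act ` (G2 \<times> G2). \<forall>x. h (g x) = x"
      unfolding t(1) by (intro bexI[of _ "act s"] allI imageI)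
  qed
  then show "Y \<in> {Q5xQ5}"
    by (simp only: Q5xQ5_orbit singleton_iff)
qed

section \<open>Diagonalisation of tori\<close>

lemma Gm_mult: "s \<in> Gm n \<Longrightarrow> t \<in> Gm n \<Longrightarrow> (\<lambda>i. s i * t i) \<in> Gm n"
  by (simp add: Gm_def)

lemma Gm_one: "(\<lambda>_. 1) \<in> Gm n"
  by (simp add: Gm_def)

text \<open>
  Square roots exist in a torus, so no nontrivial character of it has a trivial square.
\<close>

lemma Gm_sqrt:
  assumes "t \<in> Gm n"
  obtains s where "s \<in> Gm n" "t = (\<lambda>i. s i * s i)"
proof (rule that[of "\<lambda>i. csqrt (t i)"])
  have "csqrt 1 = 1" by simp
  then show "(\<lambda>i. csqrt (t i)) \<in> Gm n"
    using assms by (simp add: Gm_def)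
  show "t = (\<lambda>i. csqrt (t i) * csqrt (t i))"
    by (simp add: fun_eq_iff flip: power2_eq_square)
qed

text \<open>
  Outside the torus characters take the value 0, so that characters which agree on the torus are
  equal functions.
\<close>

definition characters :: "nat \<Rightarrow> ((nat \<Rightarrow> complex) \<Rightarrow> complex) set" where
  "characters n = {\<theta>. \<theta> (\<lambda>_. 1) = 1 \<and> (\<forall>t. t \<notin> Gm n \<longrightarrow> \<theta> t = 0) \<and>
     (\<forall>s\<in>Gm n. \<forall>t\<in>Gm n. \<theta> (\<lambda>i. s i * t i) = \<theta> s * \<theta> t)}"

text \<open>
  Dedekind's argument: comparing a relation at \<open>s t\<close> with \<open>\<theta>0 s\<close> times the relation at \<open>t\<close>
  eliminates the character \<open>\<theta>0\<close>.
\<close>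

lemma characters_independent:
  assumes "finite K" "K \<subseteq> characters n" "\<forall>t\<in>Gm n. (\<Sum>\<theta>\<in>K. c \<theta> * \<theta> t) = 0"
  shows "\<forall>\<theta>\<in>K. c \<theta> = 0"
  using assms
proof (induction K arbitrary: c rule: finite_induct)
  case empty
  show ?case by simp
next
  case (insert \<theta>0 K)
  have ch: "\<psi> (\<lambda>i. s i * t i) = \<psi> s * \<psi> t" if "\<psi> \<in> insert \<theta>0 K" "s \<in> Gm n" "t \<in> Gm n" for \<psi> s t
    using that insert.prems(1) unfolding characters_def by blast
  have sum0: "(\<Sum>\<theta>\<in>insert \<theta>0 K. c \<theta> * \<theta> t) = 0" if "t \<in> Gm n" for t
    using insert.prems(2) that by simp
  have zero: "\<forall>\<psi>\<in>K. c \<psi> = 0"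
  proof
    fix \<psi> assume \<psi>: "\<psi> \<in> K"
    have step: "\<forall>\<psi>\<in>K. c \<psi> * (\<psi> s - \<theta>0 s) = 0" if s: "s \<in> Gm n" for s
    proof (rule insert.IH)
      show "K \<subseteq> characters n" using insert.prems(1) by blast
      show "\<forall>t\<in>Gm n. (\<Sum>\<theta>\<in>K. c \<theta> * (\<theta> s - \<theta>0 s) * \<theta> t) = 0"
      proof
        fix t assume t: "t \<in> Gm n"
        have "(\<Sum>\<theta>\<in>insert \<theta>0 K. c \<theta> * (\<theta> s - \<theta>0 s) * \<theta> t)
            = (\<Sum>\<theta>\<in>insert \<theta>0 K. c \<theta> * (\<theta> s * \<theta> t)) - \<theta>0 s * (\<Sum>\<theta>\<in>insert \<theta>0 K. c \<theta> * \<theta> t)"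
          by (simp only: sum_distrib_left flip: sum_subtractf) (simp add: algebra_simps)
        also have "(\<Sum>\<theta>\<in>insert \<theta>0 K. c \<theta> * (\<theta> s * \<theta> t)) = (\<Sum>\<theta>\<in>insert \<theta>0 K. c \<theta> * \<theta> (\<lambda>i. s i * t i))"
          by (intro sum.cong refl) (simp only: ch[OF _ s t])
        finally have "(\<Sum>\<theta>\<in>insert \<theta>0 K. c \<theta> * (\<theta> s - \<theta>0 s) * \<theta> t) = 0"
          by (simp only: sum0[OF t] sum0[OF Gm_mult[OF s t]]) simp
        then show "(\<Sum>\<theta>\<in>K. c \<theta> * (\<theta> s - \<theta>0 s) * \<theta> t) = 0"
          using insert.hyps by simp
      qed
    qed
    have "\<psi> \<noteq> \<theta>0" using \<psi> insert.hyps by blast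
    then obtain s where s: "\<psi> s \<noteq> \<theta>0 s" by (auto simp: fun_eq_iff)
    have "s \<in> Gm n"
    proof (rule ccontr)
      assume "s \<notin> Gm n"
      moreover have "\<psi> \<in> characters n" "\<theta>0 \<in> characters n"
        using insert.prems(1) \<psi> by auto
      ultimately have "\<psi> s = 0" "\<theta>0 s = 0"
        by (simp_all add: characters_def)
      then show False
        using s by simp
    qed
    then show "c \<psi> = 0" using bspec[OF step[of s] \<psi>] s by simp
  qed
  have "(\<Sum>\<theta>\<in>insert \<theta>0 K. c \<theta> * \<theta> (\<lambda>_. 1)) = c \<theta>0"
  proof -
    have "\<theta>0 (\<lambda>_. 1) = 1"
      using insert.prems(1) by (simp add: characters_def)
    then show ?thesis
      using insert.hyps zero by simp
  qed
  then have "c \<theta>0 = 0"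
    using sum0[OF Gm_one] by simp
  then show ?case
    using zero by simp
qed

definition character_sum :: "nat \<Rightarrow> ((nat \<Rightarrow> complex) \<Rightarrow> complex) \<Rightarrow> bool" where
  "character_sum n f \<longleftrightarrow> (\<exists>K c. finite K \<and> K \<subseteq> characters n \<and> (\<forall>t\<in>Gm n. f t = (\<Sum>\<theta>\<in>K. c \<theta> * \<theta> t)))"

lemma character_sum_scaled:
  assumes "\<And>t. t \<in> Gm n \<Longrightarrow> f t = c * \<theta> t" "\<theta> (\<lambda>_. 1) = 1"
    "\<And>s t. s \<in> Gm n \<Longrightarrow> t \<in> Gm n \<Longrightarrow> \<theta> (\<lambda>i. s i * t i) = \<theta> s * \<theta> t"
  shows "character_sum n f"
proof -
  define \<psi> where "\<psi> t = (if t \<in> Gm n then \<theta> t else 0)" for t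
  have "\<psi> \<in> characters n"
    unfolding characters_def using assms(2,3) by (simp add: \<psi>_def Gm_mult Gm_one)
  moreover have "f t = (\<Sum>\<theta>\<in>{\<psi>}. c * \<theta> t)" if "t \<in> Gm n" for t
    using assms(1) that by (simp add: \<psi>_def)
  ultimately show ?thesis
    unfolding character_sum_def by (intro exI[of _ "{\<psi>}"] exI[of _ "\<lambda>_. c"]) simp
qed

lemma character_sum_common:
  assumes "finite I" "\<And>i. i \<in> I \<Longrightarrow> character_sum n (f i)"
  obtains K c where "finite K" "K \<subseteq> characters n"
    "\<And>i t. i \<in> I \<Longrightarrow> t \<in> Gm n \<Longrightarrow> f i t = (\<Sum>\<theta>\<in>K. c i \<theta> * \<theta> t)"
proof -
  define Q where "Q i K c \<longleftrightarrow> finite K \<and> K \<subseteq> characters n \<and>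
      (\<forall>t\<in>Gm n. f i t = (\<Sum>\<theta>\<in>K. c \<theta> * \<theta> t))" for i K c
  have "\<forall>i\<in>I. \<exists>Kc. Q i (fst Kc) (snd Kc)"
    using assms(2) unfolding character_sum_def Q_def[symmetric] by (metis fst_conv snd_conv)
  from bchoice[OF this] obtain Kc where *: "\<forall>i\<in>I. Q i (fst (Kc i)) (snd (Kc i))" ..
  define K c where "K i = fst (Kc i)" and "c i = snd (Kc i)" for i
  have Q: "Q i (K i) (c i)" if "i \<in> I" for i
    using * that by (simp add: K_def c_def)
  have Kc: "finite (K i)" "K i \<subseteq> characters n" "t \<in> Gm n \<Longrightarrow> f i t = (\<Sum>\<theta>\<in>K i. c i \<theta> * \<theta> t)"
    if "i \<in> I" for i t
    using Q[OF that] by (simp_all add: Q_def)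
  show ?thesis
  proof (rule that[of "\<Union>i\<in>I. K i" "\<lambda>i \<theta>. if \<theta> \<in> K i then c i \<theta> else 0"])
    show "finite (\<Union>i\<in>I. K i)" "(\<Union>i\<in>I. K i) \<subseteq> characters n"
      using Kc(1,2) assms(1) by auto
    fix i t assume i: "i \<in> I" and t: "t \<in> Gm n"
    have "f i t = (\<Sum>\<theta>\<in>K i. c i \<theta> * \<theta> t)" by (rule Kc(3)[OF i t])
    also have "\<dots> = (\<Sum>\<theta>\<in>(\<Union>i\<in>I. K i). (if \<theta> \<in> K i then c i \<theta> else 0) * \<theta> t)"
      by (rule sum.mono_neutral_cong_left) (use Kc(1) assms(1) i in auto)
    finally show "f i t = (\<Sum>\<theta>\<in>(\<Union>i\<in>I. K i). (if \<theta> \<in> K i then c i \<theta> else 0) * \<theta> t)" .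
  qed
qed

lemma character_sum_add:
  assumes "character_sum n f" "character_sum n g"
  shows "character_sum n (\<lambda>t. f t + g t)"
proof -
  obtain K c where K: "finite K" "K \<subseteq> characters n"
    "\<And>i t. i \<in> {True, False} \<Longrightarrow> t \<in> Gm n \<Longrightarrow> (if i then f else g) t = (\<Sum>\<theta>\<in>K. c i \<theta> * \<theta> t)"
    by (rule character_sum_common[of "{True, False}" n "\<lambda>b. if b then f else g"]) (use assms in auto)
  have "f t + g t = (\<Sum>\<theta>\<in>K. (c True \<theta> + c False \<theta>) * \<theta> t)" if "t \<in> Gm n" for t
    using K(3)[OF _ that, of True] K(3)[OF _ that, of False] by (simp add: distrib_right sum.distrib)
  then show ?thesis
    unfolding character_sum_def using K(1,2) by (intro exI[of _ K] exI[of _ "\<lambda>\<theta>. c True \<theta> + c False \<theta>"]) simp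
qed

lemma character_sum_mult:
  assumes "character_sum n f" "character_sum n g"
  shows "character_sum n (\<lambda>t. f t * g t)"
proof -
  obtain K c where K: "finite K" "K \<subseteq> characters n" "\<And>t. t \<in> Gm n \<Longrightarrow> f t = (\<Sum>\<theta>\<in>K. c \<theta> * \<theta> t)"
    using assms(1) unfolding character_sum_def by blast
  obtain L d where L: "finite L" "L \<subseteq> characters n" "\<And>t. t \<in> Gm n \<Longrightarrow> g t = (\<Sum>\<theta>\<in>L. d \<theta> * \<theta> t)"
    using assms(2) unfolding character_sum_def by blast
  define m where "m = (\<lambda>p :: ((nat \<Rightarrow> complex) \<Rightarrow> complex) \<times> ((nat \<Rightarrow> complex) \<Rightarrow> complex). \<lambda>t. fst p t * snd p t)"
  define e where "e \<psi> = (\<Sum>p | p \<in> K \<times> L \<and> m p = \<psi>. c (fst p) * d (snd p))" for \<psi>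
  have "f t * g t = (\<Sum>\<psi>\<in>m ` (K \<times> L). e \<psi> * \<psi> t)" if t: "t \<in> Gm n" for t
  proof -
    have "f t * g t = (\<Sum>p\<in>K \<times> L. c (fst p) * d (snd p) * m p t)"
      unfolding K(3)[OF t] L(3)[OF t] sum_product sum.cartesian_product
      by (rule sum.cong) (auto simp: m_def)
    also have "\<dots> = (\<Sum>\<psi>\<in>m ` (K \<times> L). \<Sum>p | p \<in> K \<times> L \<and> m p = \<psi>. c (fst p) * d (snd p) * m p t)"
      by (rule sum.image_gen) (use K L in auto)
    also have "\<dots> = (\<Sum>\<psi>\<in>m ` (K \<times> L). e \<psi> * \<psi> t)"
      unfolding e_def sum_distrib_right by (intro sum.cong refl) auto
    finally show ?thesis .
  qed
  moreover have "m ` (K \<times> L) \<subseteq> characters n"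
  proof
    fix \<psi> assume "\<psi> \<in> m ` (K \<times> L)"
    then obtain p where p: "p \<in> K \<times> L" "\<psi> = m p" by blast
    then have "fst p \<in> characters n" "snd p \<in> characters n"
      using K(2) L(2) by auto
    then show "\<psi> \<in> characters n"
      by (simp add: characters_def p(2) m_def)
  qed
  ultimately show ?thesis
    unfolding character_sum_def using K(1) L(1) by (intro exI[of _ "m ` (K \<times> L)"] exI[of _ e]) simp
qed

lemma laurent_character_sum:
  assumes "f \<in> laurent n"
  shows "character_sum n f"
  using assms unfolding laurent_def
proof induction
  case (fun_algebra_gen f)
  then consider i where "i < n" "f = (\<lambda>t. t i)" | i where "i < n" "f = (\<lambda>t. inverse (t i))" by blast
  then show ?case
  proof cases
    case 1 then show ?thesis by (intro character_sum_scaled[of n f 1 f]) simp_all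
  next
    case 2 then show ?thesis by (intro character_sum_scaled[of n f 1 f]) simp_all
  qed
next
  case (fun_algebra_const c)
  show ?case by (rule character_sum_scaled[of n _ c "\<lambda>_. 1"]) simp_all
qed (simp_all add: character_sum_add character_sum_mult)

abbreviation weight_vectors :: "nat \<Rightarrow> ((nat \<Rightarrow> complex) \<Rightarrow> complex^8^8) \<Rightarrow> octonion set" where
  "weight_vectors n \<rho> \<equiv> {x. \<exists>\<theta>\<in>characters n. \<forall>t\<in>Gm n. \<rho> t *v x = \<theta> t *s x}"

text \<open>
  Expand \<open>\<rho> t = \<Sum> \<theta> t A\<^sub>\<theta>\<close> with coefficient matrices \<open>A\<^sub>\<theta>\<close>.  By independence of characters,
  \<open>\<rho> (s t) = \<rho> s \<rho> t\<close> gives \<open>\<rho> s A\<^sub>\<theta> = \<theta> s A\<^sub>\<theta>\<close>, so the image of \<open>A\<^sub>\<theta>\<close> consists of eigenvectors;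
  and the \<open>A\<^sub>\<theta>\<close> add up to the identity.
\<close>

lemma eigenvectors_span:
  fixes \<rho> :: "(nat \<Rightarrow> complex) \<Rightarrow> complex^8^8"
  assumes hom: "\<And>s t. s \<in> Gm n \<Longrightarrow> t \<in> Gm n \<Longrightarrow> \<rho> (\<lambda>i. s i * t i) = \<rho> s ** \<rho> t"
    and one: "\<rho> (\<lambda>_. 1) = mat 1"
    and reg: "\<And>i j. character_sum n (\<lambda>t. \<rho> t $ i $ j)"
  shows "vec.span (weight_vectors n \<rho>) = UNIV"
proof -
  obtain K c where K: "finite K" "K \<subseteq> characters n"
    "\<And>p t. p \<in> UNIV \<Longrightarrow> t \<in> Gm n \<Longrightarrow> \<rho> t $ fst p $ snd p = (\<Sum>\<theta>\<in>K. c p \<theta> * \<theta> t)"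
    by (rule character_sum_common[of "UNIV :: (8 \<times> 8) set" n "\<lambda>p t. \<rho> t $ fst p $ snd p"]) (use reg in auto)
  define A :: "((nat \<Rightarrow> complex) \<Rightarrow> complex) \<Rightarrow> complex^8^8" where "A \<theta> = (\<chi> i j. c (i, j) \<theta>)" for \<theta>
  have \<rho>: "\<rho> t $ i $ j = (\<Sum>\<theta>\<in>K. A \<theta> $ i $ j * \<theta> t)" if "t \<in> Gm n" for t i j
    using K(3)[of "(i, j)" t] that by (simp add: A_def)
  have ch: "\<theta> (\<lambda>i. s i * t i) = \<theta> s * \<theta> t" "\<theta> (\<lambda>_. 1) = 1" if "\<theta> \<in> K" "s \<in> Gm n" "t \<in> Gm n" for \<theta> s t
    using that K(2) unfolding characters_def by blast+
  have eig: "(\<rho> s ** A \<theta>) $ i $ j = \<theta> s * A \<theta> $ i $ j" if "\<theta> \<in> K" and s: "s \<in> Gm n" for \<theta> s i j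
  proof -
    have "(\<rho> s ** A \<theta>) $ i $ j - \<theta> s * A \<theta> $ i $ j = 0"
    proof -
      have "\<forall>t\<in>Gm n. (\<Sum>\<theta>\<in>K. ((\<rho> s ** A \<theta>) $ i $ j - \<theta> s * A \<theta> $ i $ j) * \<theta> t) = 0"
      proof
      fix t assume t: "t \<in> Gm n"
        have "(\<rho> s ** \<rho> t) $ i $ j = (\<Sum>k\<in>UNIV. \<Sum>\<theta>\<in>K. \<rho> s $ i $ k * A \<theta> $ k $ j * \<theta> t)"
          by (simp add: matrix_matrix_mult_def \<rho>[OF t] sum_distrib_left mult_ac)
        also have "\<dots> = (\<Sum>\<theta>\<in>K. (\<rho> s ** A \<theta>) $ i $ j * \<theta> t)"
          by (subst sum.swap) (simp add: matrix_matrix_mult_def sum_distrib_right)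
        finally have "(\<Sum>\<theta>\<in>K. (\<rho> s ** A \<theta>) $ i $ j * \<theta> t) = (\<Sum>\<theta>\<in>K. A \<theta> $ i $ j * \<theta> (\<lambda>i. s i * t i))"
          using \<rho>[OF Gm_mult[OF s t], of i j] by (simp add: hom[OF s t])
        then show "(\<Sum>\<theta>\<in>K. ((\<rho> s ** A \<theta>) $ i $ j - \<theta> s * A \<theta> $ i $ j) * \<theta> t) = 0"
          proof -
            assume "(\<Sum>\<theta>\<in>K. (\<rho> s ** A \<theta>) $ i $ j * \<theta> t) = (\<Sum>\<theta>\<in>K. A \<theta> $ i $ j * \<theta> (\<lambda>i. s i * t i))"
            also have "\<dots> = (\<Sum>\<theta>\<in>K. \<theta> s * A \<theta> $ i $ j * \<theta> t)"
              by (intro sum.cong refl) (simp add: ch(1)[OF _ s t])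
            finally show ?thesis
              by (simp add: left_diff_distrib sum_subtractf)
          qed
      qed
      then show ?thesis
        using characters_independent[OF K(1,2), of "\<lambda>\<theta>. (\<rho> s ** A \<theta>) $ i $ j - \<theta> s * A \<theta> $ i $ j"] that(1) by blast
    qed
    then show ?thesis by simp
  qed
  have "x \<in> vec.span (weight_vectors n \<rho>)" for x
  proof -
    have "mat 1 $ i $ j = (\<Sum>\<theta>\<in>K. A \<theta> $ i $ j)" for i j
    proof -
      have "(\<Sum>\<theta>\<in>K. A \<theta> $ i $ j * \<theta> (\<lambda>_. 1)) = (\<Sum>\<theta>\<in>K. A \<theta> $ i $ j)"
        by (intro sum.cong refl) (simp add: ch(2)[OF _ Gm_one Gm_one])
      then show ?thesis
        using \<rho>[OF Gm_one, of i j] one by simp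
    qed
    then have "mat 1 = (\<Sum>\<theta>\<in>K. A \<theta>)"
      by (simp add: vec_eq_iff sum_component)
    then have "x = (\<Sum>\<theta>\<in>K. A \<theta>) *v x"
      by (metis matrix_vector_mul_lid)
    also have "\<dots> = (\<Sum>\<theta>\<in>K. A \<theta> *v x)"
      by (induction K rule: infinite_finite_induct) (simp_all add: matrix_vector_mult_add_rdistrib)
    also have "\<dots> \<in> vec.span (weight_vectors n \<rho>)"
    proof (intro vec.span_sum vec.span_base CollectI)
      fix \<theta> assume \<theta>: "\<theta> \<in> K"
      have "\<rho> t ** A \<theta> = cscale (\<theta> t) (A \<theta>)" if "t \<in> Gm n" for t
        using eig[OF \<theta> that] by (simp add: vec_eq_iff cscale_nth)
      moreover have "cscale k B *v x = k *s (B *v x)" for k B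
        by (simp add: vec_eq_iff matrix_vector_mult_def cscale_nth sum_distrib_left mult_ac)
      ultimately have "\<forall>t\<in>Gm n. \<rho> t *v (A \<theta> *v x) = \<theta> t *s (A \<theta> *v x)"
        by (simp add: matrix_vector_mul_assoc)
      then show "\<exists>\<theta>'\<in>characters n. \<forall>t\<in>Gm n. \<rho> t *v (A \<theta> *v x) = \<theta>' t *s (A \<theta> *v x)"
        using \<theta> K(2) by blast
    qed
    finally show ?thesis .
  qed
  then show ?thesis by blast
qed

lemma det3_linear:
  "det3 (p + p') q r = det3 p q r + det3 p' q r" "det3 (c *s p) q r = c * det3 p q r"
  "det3 p (q + q') r = det3 p q r + det3 p q' r" "det3 p (c *s q) r = c * det3 p q r"
  "det3 p q (r + r') = det3 p q r + det3 p q r'" "det3 p q (c *s r) = c * det3 p q r"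
  by (simp_all add: det3_def algebra_simps)

text \<open>
  A trilinear form that vanishes on a spanning set vanishes.
\<close>

lemma det3_nonzero_on_spanning:
  assumes "vec.span E = UNIV"
  obtains p q r where "p \<in> E" "q \<in> E" "r \<in> E" "det3 p q r \<noteq> 0"
proof (rule ccontr)
  assume *: "\<not> thesis"
  have zero: "det3 0 q r = 0" "det3 p 0 r = 0" "det3 p q 0 = 0" for p q r
    by (simp_all add: det3_def)
  have 3: "det3 p q r = 0" if "p \<in> E" "q \<in> E" for p q r
  proof -
    have "r \<in> vec.span E" using assms by simp
    then show ?thesis
    proof (induction rule: vec.span_induct)
      show "vec.subspace {r. det3 p q r = 0}"
        by (intro vec.subspaceI) (simp_all add: zero det3_linear)
    qed (use * \<open>\<And>p q r. p \<in> E \<Longrightarrow> q \<in> E \<Longrightarrow> r \<in> E \<Longrightarrow> det3 p q r \<noteq> 0 \<Longrightarrow> thesis\<close> \<open>p \<in> E\<close> \<open>q \<in> E\<close> in blast)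
  qed
  have 2: "det3 p q r = 0" if "p \<in> E" for p q r
  proof -
    have "q \<in> vec.span E" using assms by simp
    then show ?thesis
    proof (induction rule: vec.span_induct)
      show "vec.subspace {q. det3 p q r = 0}"
        by (intro vec.subspaceI) (simp_all add: zero det3_linear)
    qed (use 3 that in blast)
  qed
  have 1: "det3 p q r = 0" for p q r
  proof -
    have "p \<in> vec.span E" using assms by simp
    then show ?thesis
    proof (induction rule: vec.span_induct)
      show "vec.subspace {p. det3 p q r = 0}"
        by (intro vec.subspaceI) (simp_all add: zero det3_linear)
    qed (use 2 in blast)
  qed
  have "det3 (axis 2 1) (axis 3 1) (axis 4 1) = 1"
    by (simp add: det3_def axis_nth)
  then show False using 1 by simp
qed

lemma matrix_eq_axis:
  fixes A B :: "complex^8^8"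
  assumes "\<And>i. A *v axis i 1 = B *v axis i 1"
  shows "A = B"
proof -
  have "(M *v axis i 1) $ j = M$j$i" for M :: "complex^8^8" and i j
    by (simp add: matrix_vector_mult_def axis_def if_distrib cong: if_cong)
  then show ?thesis
    using assms by (metis vec_eq_iff)
qed

text \<open>
  The axes 5, 6, 7 are products of the axes 2, 3, 4, and \<open>axis 2 1\<close> times \<open>axis 5 1\<close> is
  the fixed idempotent \<open>axis 1 1\<close>; so \<open>B\<close> is diagonal with \<open>a b c = 1\<close>.
\<close>

lemma G2_diagonal:
  assumes B: "B \<in> G2" and h: "B *v h7 = h7"
    and eig: "B *v axis 2 1 = a *s axis 2 1" "B *v axis 3 1 = b *s axis 3 1" "B *v axis 4 1 = c *s axis 4 1"
  shows "a \<noteq> 0" "b \<noteq> 0" "B = torus2 a b"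
proof -
  have ax: "axis 1 1 = (1/2) *s (oone + h7)" "axis 8 1 = (1/2) *s (oone - h7)"
    by (simp_all add: octonion_eq_iff axis_nth)
  have 18: "B *v axis 1 1 = axis 1 1" "B *v axis 8 1 = axis 8 1"
    unfolding ax by (simp_all only: vector_scalar_commute matrix_vector_right_distrib
        matrix_vector_mult_diff_distrib G2_oone[OF B] h)
  have prod: "axis 5 1 = omul (axis 3 1) (axis 4 1)" "axis 6 1 = omul (axis 4 1) (axis 2 1)"
    "axis 7 1 = omul (axis 2 1) (axis 3 1)" "omul (axis 2 1) (axis 5 1) = axis 1 1"
    by (simp_all add: octonion_eq_iff axis_nth)
  have 567: "B *v axis 5 1 = (b * c) *s axis 5 1" "B *v axis 6 1 = (c * a) *s axis 6 1"
    "B *v axis 7 1 = (a * b) *s axis 7 1"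
    unfolding prod(1-3) by (simp_all add: G2_hom[OF B] eig omul_linear mult.commute)
  have "B *v axis 1 1 = (a * (b * c)) *s axis 1 1"
    unfolding prod(4)[symmetric] by (simp add: G2_hom[OF B] eig 567 omul_linear mult_ac)
  then have "(axis 1 1 :: octonion) = (a * (b * c)) *s axis 1 1"
    by (simp only: 18)
  then have abc: "a * (b * c) = 1"
    by (auto simp: octonion_eq_iff axis_nth)
  then show a: "a \<noteq> 0" and b: "b \<noteq> 0" by auto
  have inv: "b * c = inverse a" "c = inverse (a * b)" "c * a = inverse b"
    using abc a b by (simp_all add: field_simps)
  have w: "torus2 a b *v axis i 1 = weights a b $ i *s axis i 1" for i
    by (simp add: torus2_mult_vec vec_eq_iff axis_nth)
  have "\<forall>i. B *v axis i 1 = torus2 a b *v axis i 1"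
    unfolding w forall_8
    by (simp add: weights_def 18 567[unfolded inv(1) inv(3)] eig(1,2) eig(3)[unfolded inv(2)])
  then show "B = torus2 a b"
    by (intro matrix_eq_axis) blast
qed

text \<open>
  Automorphisms that fix \<open>h7\<close> preserve its Peirce decomposition and act on the 3-space of the
  coordinates 2, 3, 4.  Eigenvectors span this space too, so three of them have determinant 1 after
  rescaling, and the automorphism \<open>sl3\<close> with these columns moves the coordinate axes to them.
\<close>

lemma diagonalise_fixing_h7:
  fixes \<rho> :: "'p \<Rightarrow> complex^8^8"
  assumes G2: "\<And>t. t \<in> P \<Longrightarrow> \<rho> t \<in> G2" and h: "\<And>t. t \<in> P \<Longrightarrow> \<rho> t *v h7 = h7"
    and span: "vec.span {x. \<exists>\<theta>. \<forall>t\<in>P. \<rho> t *v x = \<theta> t *s x} = UNIV"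
  obtains g where "g \<in> G2" "\<And>t. t \<in> P \<Longrightarrow> \<exists>a b. a \<noteq> 0 \<and> b \<noteq> 0 \<and> \<rho> t ** g = g ** torus2 a b"
proof -
  define E where "E = {x. \<exists>\<theta>. \<forall>t\<in>P. \<rho> t *v x = \<theta> t *s x}"
  have spanE: "vec.span E = UNIV"
    unfolding E_def by (rule span)
  define pU where "pU x = omul (axis 1 1) (omul x (axis 8 1))" for x
  have pU_nth: "pU x $ 1 = 0" "pU x $ 2 = x $ 2" "pU x $ 3 = x $ 3" "pU x $ 4 = x $ 4"
    "pU x $ 5 = 0" "pU x $ 6 = 0" "pU x $ 7 = 0" "pU x $ 8 = 0" for x
    by (simp_all add: pU_def axis_nth)
  have ax: "axis 1 1 = (1/2) *s (oone + h7)" "axis 8 1 = (1/2) *s (oone - h7)"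
    by (simp_all add: octonion_eq_iff axis_nth)
  have fix18: "\<rho> t *v axis 1 1 = axis 1 1" "\<rho> t *v axis 8 1 = axis 8 1" if "t \<in> P" for t
    unfolding ax by (simp_all only: vector_scalar_commute matrix_vector_right_distrib
        matrix_vector_mult_diff_distrib G2_oone[OF G2[OF that]] h[OF that])
  have pU_E: "c *s pU x \<in> E" if x: "x \<in> E" for x c
  proof -
    obtain \<theta> where \<theta>: "\<And>t. t \<in> P \<Longrightarrow> \<rho> t *v x = \<theta> t *s x"
      using x unfolding E_def by blast
    have "\<rho> t *v (c *s pU x) = \<theta> t *s (c *s pU x)" if t: "t \<in> P" for t
      by (simp add: pU_def vector_scalar_commute G2_hom[OF G2[OF t]] fix18[OF t] \<theta>[OF t] omul_linear mult.commute)
    then show ?thesis unfolding E_def by (intro CollectI exI[of _ \<theta>] ballI)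
  qed
  obtain p0 q0 r0 where pqr0: "p0 \<in> E" "q0 \<in> E" "r0 \<in> E" "det3 p0 q0 r0 \<noteq> 0"
    using det3_nonzero_on_spanning[OF spanE] by blast
  define p q r where "p = inverse (det3 p0 q0 r0) *s pU p0" and "q = 1 *s pU q0" and "r = 1 *s pU r0"
  have E: "p \<in> E" "q \<in> E" "r \<in> E"
    unfolding p_def q_def r_def by (intro pU_E pqr0)+
  have "det3 (pU p0) (pU q0) (pU r0) = det3 p0 q0 r0"
    by (simp add: det3_def pU_nth)
  then have det: "det3 p q r = 1"
    unfolding p_def q_def r_def using pqr0(4) by (simp add: det3_linear)
  obtain g where g: "g \<in> G2" "\<And>x. g *v x = sl3 p q r x"
    using G2_sl3[OF det] by blast
  obtain g' where g': "g' \<in> G2" "g ** g' = mat 1" "g' ** g = mat 1"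
    using G2_inverse[OF g(1)] by blast
  have g_ax: "g *v axis 2 1 = p" "g *v axis 3 1 = q" "g *v axis 4 1 = r" "g *v h7 = h7"
    unfolding g(2) by (simp_all add: octonion_eq_iff sl3_def axis_nth p_def q_def r_def pU_nth)
  have g'_pqr: "g' *v p = axis 2 1" "g' *v q = axis 3 1" "g' *v r = axis 4 1" "g' *v h7 = h7"
    by (simp_all flip: g_ax(1-3) add: matrix_vector_mul_assoc g') (metis g_ax(4) g'(3) matrix_vector_mul_assoc matrix_vector_mul_lid)
  have "\<exists>a b. a \<noteq> 0 \<and> b \<noteq> 0 \<and> \<rho> t ** g = g ** torus2 a b" if t: "t \<in> P" for t
  proof -
    obtain a b c where abc: "\<rho> t *v p = a *s p" "\<rho> t *v q = b *s q" "\<rho> t *v r = c *s r"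
      using E t unfolding E_def by blast
    define B where "B = g' ** (\<rho> t ** g)"
    have B: "B *v x = g' *v (\<rho> t *v (g *v x))" for x
      by (simp add: B_def matrix_vector_mul_assoc)
    have "B \<in> G2"
      unfolding B_def by (intro G2_mult g g' G2 t)
    moreover have "B *v h7 = h7" "B *v axis 2 1 = a *s axis 2 1" "B *v axis 3 1 = b *s axis 3 1"
      "B *v axis 4 1 = c *s axis 4 1"
      by (simp_all add: B g_ax abc h[OF t] vector_scalar_commute g'_pqr)
    ultimately have "a \<noteq> 0" "b \<noteq> 0" "B = torus2 a b"
      using G2_diagonal by blast+
    moreover have "g ** B = \<rho> t ** g"
      by (simp add: B_def matrix_mul_assoc g')
    ultimately show ?thesis by metis
  qed
  then show ?thesis using that g(1) by blast
qed

lemma onorm2_commutator: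
  assumes "x \<in> V7" "y \<in> V7"
  shows "onorm2 (omul x y - omul y x) = 4 * onorm2 x * onorm2 y - (obil x y)\<^sup>2"
proof -
  have "x$8 = - x$1" "y$8 = - y$1"
    using assms by (simp_all add: V7_def add_eq_0_iff)
  then show ?thesis
    by (simp add: onorm2_def obil_def power2_eq_square) (simp add: algebra_simps)
qed

lemma imag_linear: "imag (x + y) = imag x + imag y" "imag (c *s x) = c *s imag x"
  by (simp_all add: octonion_eq_iff imag_def field_simps)

text \<open>
  A nontrivial torus of automorphisms has an eigenvector \<open>x\<close> in \<open>V7\<close> with a nontrivial character.
  Isometry forces \<open>n(x) = \<theta>(s)\<^sup>2 n(x)\<close>, and as \<open>\<theta>(s)\<^sup>2 = \<theta>(s\<^sup>2)\<close> takes a value other than 1, \<open>x\<close> is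
  null.  Some eigenvector \<open>y\<close> of \<open>V7\<close> pairs with \<open>x\<close> nontrivially; it has the inverse character,
  so the commutator \<open>x y - y x\<close> is fixed, and its norm is minus the square of the pairing.  The use
  of square roots is essential: an elementary abelian 2-group of automorphisms need not fix any
  nonzero imaginary octonion.
\<close>

lemma fixed_unit_vector:
  fixes \<rho> :: "(nat \<Rightarrow> complex) \<Rightarrow> complex^8^8"
  assumes G2: "\<And>t. t \<in> Gm n \<Longrightarrow> \<rho> t \<in> G2"
    and hom: "\<And>s t. s \<in> Gm n \<Longrightarrow> t \<in> Gm n \<Longrightarrow> \<rho> (\<lambda>i. s i * t i) = \<rho> s ** \<rho> t"
    and span: "vec.span (weight_vectors n \<rho>) = UNIV"
  obtains h where "h \<in> V7" "onorm2 h = -1" "\<And>t. t \<in> Gm n \<Longrightarrow> \<rho> t *v h = h"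
proof -
  define E where "E = weight_vectors n \<rho>"
  have null: "onorm2 x = 0"
    if \<theta>: "\<theta> \<in> characters n" and eig: "\<And>t. t \<in> Gm n \<Longrightarrow> \<rho> t *v x = \<theta> t *s x"
      and t0: "t0 \<in> Gm n" "\<theta> t0 \<noteq> 1" for x \<theta> t0
  proof -
    obtain s where s: "s \<in> Gm n" "t0 = (\<lambda>i. s i * s i)"
      using Gm_sqrt[OF t0(1)] by blast
    have "\<theta> t0 = (\<theta> s)\<^sup>2"
      using \<theta> s unfolding characters_def power2_eq_square by blast
    moreover have "onorm2 x = (\<theta> s)\<^sup>2 * onorm2 x"
      using G2_preserves(3)[OF G2[OF s(1)], of x] by (simp add: eig[OF s(1)] onorm2_scale)
    ultimately show ?thesis using t0(2) by simp
  qed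
  show ?thesis
  proof (cases "\<forall>x\<in>E. \<forall>t\<in>Gm n. \<rho> t *v x = x")
    case True
    have "\<rho> t *v x = x" if t: "t \<in> Gm n" for t x
    proof -
      have "x \<in> vec.span E" using span by (simp add: E_def)
      then show ?thesis
      proof (induction rule: vec.span_induct)
        show "vec.subspace {x. \<rho> t *v x = x}"
          by (intro vec.subspaceI) (simp_all add: matrix_vector_right_distrib vector_scalar_commute)
      qed (use True t in blast)
    qed
    then show ?thesis
      using that[of h7] by (simp add: V7_def onorm2_def)
  next
    case False
    then obtain x0 t0 \<theta> where x0: "t0 \<in> Gm n" "\<rho> t0 *v x0 \<noteq> x0" "\<theta> \<in> characters n"
      "\<And>t. t \<in> Gm n \<Longrightarrow> \<rho> t *v x0 = \<theta> t *s x0"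
      unfolding E_def by blast
    define x where "x = imag x0"
    have imag_eig: "\<rho> t *v imag z = k *s imag z" if "t \<in> Gm n" "\<rho> t *v z = k *s z" for t z k
      using that by (simp add: G2_preserves(2)[OF G2] imag_linear)
    have x: "x \<in> V7" "\<And>t. t \<in> Gm n \<Longrightarrow> \<rho> t *v x = \<theta> t *s x"
      unfolding x_def using imag_eig x0(4) by (simp_all add: imag_V7)
    have "\<rho> t0 *v x \<noteq> x"
    proof
      assume "\<rho> t0 *v x = x"
      moreover have "x0 = x + ((x0$1 + x0$8) / 2) *s oone"
        by (simp add: x_def imag_def)
      ultimately show False
        using x0(2) by (metis G2_oone[OF G2[OF x0(1)]] matrix_vector_right_distrib vector_scalar_commute)
    qed
    then have \<theta>t0: "\<theta> t0 \<noteq> 1" and xnz: "x \<noteq> 0"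
      using x(2)[OF x0(1)] by auto
    have "\<exists>y0\<in>E. obil x (imag y0) \<noteq> 0"
    proof (rule ccontr)
      assume *: "\<not> ?thesis"
      have zero: "obil x (imag z) = 0" for z
      proof -
        have "z \<in> vec.span E" using span by (simp add: E_def)
        then show ?thesis
        proof (induction rule: vec.span_induct)
          have "imag 0 = 0" by (simp add: octonion_eq_iff imag_def)
          then show "vec.subspace {z. obil x (imag z) = 0}"
            by (intro vec.subspaceI) (simp_all add: imag_linear obil_linear)
        qed (use * in blast)
      qed
      have "x = 0"
        using V7_dual_expansion(1)[OF x(1)] by (simp add: zero)
      then show False using xnz by simp
    qed
    then obtain y0 \<psi> where y0: "\<psi> \<in> characters n" "\<And>t. t \<in> Gm n \<Longrightarrow> \<rho> t *v y0 = \<psi> t *s y0"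
      "obil x (imag y0) \<noteq> 0"
      unfolding E_def by blast
    \<comment> \<open>normalised so that \<open>x y + y x = 1\<close>\<close>
    define k where "k = - inverse (obil x (imag y0))"
    define y where "y = k *s imag y0"
    have y: "y \<in> V7" "\<rho> t *v y = \<psi> t *s y" if "t \<in> Gm n" for t
    proof -
      have "\<rho> t *v imag y0 = \<psi> t *s imag y0"
        by (rule imag_eig[OF that y0(2)[OF that]])
      then show "\<rho> t *v y = \<psi> t *s y"
        by (simp add: y_def vector_scalar_commute mult.commute)
    qed (simp add: y_def imag_V7 V7_scale)
    have xy: "obil x y = -1"
      using y0(3) by (simp add: y_def k_def obil_linear)
    have inv: "\<theta> t * \<psi> t = 1" if t: "t \<in> Gm n" for t
    proof -
      have "obil (\<rho> t *v x) (\<rho> t *v y) = -1"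
        using G2_obil[OF G2[OF t]] xy by simp
      then show ?thesis
        by (simp add: x(2)[OF t] y(2)[OF t] obil_linear xy mult.commute)
    qed
    have "\<psi> t0 \<noteq> 1"
      using inv[OF x0(1)] \<theta>t0 by auto
    then have null_xy: "onorm2 x = 0" "onorm2 y = 0"
      using null[OF x0(3) x(2) x0(1) \<theta>t0] null[OF y0(1) y(2) x0(1)] by auto
    show ?thesis
    proof (rule that[of "omul x y - omul y x"])
      show "omul x y - omul y x \<in> V7"
        by (simp add: V7_def algebra_simps)
      show "onorm2 (omul x y - omul y x) = -1"
        by (simp add: onorm2_commutator[OF x(1) y(1)[OF Gm_one]] null_xy xy)
      show "\<rho> t *v (omul x y - omul y x) = omul x y - omul y x" if t: "t \<in> Gm n" for t
      proof -
        have "\<psi> t * \<theta> t = 1"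
          by (subst mult.commute) (rule inv[OF t])
        then show ?thesis
          by (simp add: matrix_vector_mult_diff_distrib G2_hom[OF G2[OF t]] x(2)[OF t] y(2)[OF t]
              omul_linear inv[OF t])
      qed
    qed
  qed
qed

text \<open>
  Move the fixed unit vector to \<open>h7\<close> and diagonalise there.
\<close>

lemma torus_conjugate_diagonal:
  fixes \<rho> :: "(nat \<Rightarrow> complex) \<Rightarrow> complex^8^8"
  assumes G2: "\<And>t. t \<in> Gm n \<Longrightarrow> \<rho> t \<in> G2"
    and hom: "\<And>s t. s \<in> Gm n \<Longrightarrow> t \<in> Gm n \<Longrightarrow> \<rho> (\<lambda>i. s i * t i) = \<rho> s ** \<rho> t"
    and reg: "\<And>i j. character_sum n (\<lambda>t. \<rho> t $ i $ j)"
  obtains g where "g \<in> G2" "\<And>t. t \<in> Gm n \<Longrightarrow> \<exists>a b. a \<noteq> 0 \<and> b \<noteq> 0 \<and> \<rho> t ** g = g ** torus2 a b"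
proof -
  have one: "\<rho> (\<lambda>_. 1) = mat 1"
  proof -
    obtain B where B: "B ** \<rho> (\<lambda>_. 1) = mat 1"
      using G2_inverse[OF G2[OF Gm_one]] by blast
    have "\<rho> (\<lambda>_. 1) ** \<rho> (\<lambda>_. 1) = \<rho> (\<lambda>_. 1)"
      using hom[OF Gm_one Gm_one] by simp
    then have "B ** (\<rho> (\<lambda>_. 1) ** \<rho> (\<lambda>_. 1)) = mat 1"
      using B by simp
    then show ?thesis
      by (simp add: matrix_mul_assoc B)
  qed
  have span: "vec.span (weight_vectors n \<rho>) = UNIV"
    by (rule eigenvectors_span) (simp_all add: hom one reg)
  obtain h where h: "h \<in> V7" "onorm2 h = -1" "\<And>t. t \<in> Gm n \<Longrightarrow> \<rho> t *v h = h"
    using fixed_unit_vector[OF G2 hom span] by blast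
  obtain A where A: "A \<in> G2" "A *v h = h7"
    using G2_transitive_unit[OF h(1,2)] by (auto simp: G2_related_def)
  obtain A' where A': "A' \<in> G2" "A ** A' = mat 1" "A' ** A = mat 1"
    using G2_inverse[OF A(1)] by blast
  have A'h: "A' *v h7 = h"
    by (simp add: A'(3) matrix_vector_mul_assoc flip: A(2))
  define \<sigma> where "\<sigma> t = A ** \<rho> t ** A'" for t
  have \<sigma>: "\<sigma> t *v x = A *v (\<rho> t *v (A' *v x))" for t x
    unfolding \<sigma>_def by (simp only: matrix_vector_mul_assoc matrix_mul_assoc)
  have "x \<in> vec.span {x. \<exists>\<theta>. \<forall>t\<in>Gm n. \<sigma> t *v x = \<theta> t *s x}" (is "_ \<in> ?S") for x
  proof -
    have "A' *v x \<in> vec.span (weight_vectors n \<rho>)"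
      unfolding span by (rule UNIV_I)
    then have "A *v (A' *v x) \<in> ?S"
    proof (induction rule: vec.span_induct)
      show "vec.subspace {z. A *v z \<in> ?S}"
        by (intro vec.subspaceI)
          (simp_all add: matrix_vector_right_distrib vector_scalar_commute vec.span_zero vec.span_add vec.span_scale)
    next
      fix z assume "z \<in> weight_vectors n \<rho>"
      then obtain \<theta> where \<theta>: "\<forall>t\<in>Gm n. \<rho> t *v z = \<theta> t *s z" by blast
      have "\<forall>t\<in>Gm n. \<sigma> t *v (A *v z) = \<theta> t *s (A *v z)"
        using \<theta> by (simp add: \<sigma> matrix_vector_mul_assoc[of A' A] A' vector_scalar_commute)
      then show "A *v z \<in> ?S"
        by (intro vec.span_base CollectI exI[of _ \<theta>])
    qed
    then show ?thesis
      by (simp add: matrix_vector_mul_assoc A')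
  qed
  then have span': "vec.span {x. \<exists>\<theta>. \<forall>t\<in>Gm n. \<sigma> t *v x = \<theta> t *s x} = UNIV" by blast
  have \<sigma>_h7: "\<sigma> t \<in> G2" "\<sigma> t *v h7 = h7" if "t \<in> Gm n" for t
  proof -
    show "\<sigma> t \<in> G2"
      unfolding \<sigma>_def by (intro G2_mult A A' G2 that)
    show "\<sigma> t *v h7 = h7"
      by (simp add: \<sigma> A'h h(3)[OF that] A(2))
  qed
  obtain g where g: "g \<in> G2" "\<And>t. t \<in> Gm n \<Longrightarrow> \<exists>a b. a \<noteq> 0 \<and> b \<noteq> 0 \<and> \<sigma> t ** g = g ** torus2 a b"
  proof (rule diagonalise_fixing_h7[of "Gm n" \<sigma>])
    show "vec.span {x. \<exists>\<theta>. \<forall>t\<in>Gm n. \<sigma> t *v x = \<theta> t *s x} = UNIV" by (rule span')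
  qed (simp_all add: \<sigma>_h7)
  show ?thesis
  proof (rule that[of "A' ** g"])
    show "A' ** g \<in> G2" by (intro G2_mult A' g)
    fix t assume "t \<in> Gm n"
    then obtain a b where ab: "a \<noteq> 0" "b \<noteq> 0" "\<sigma> t ** g = g ** torus2 a b"
      using g(2) by blast
    have "\<rho> t ** (A' ** g) = A' ** (\<sigma> t ** g)"
      by (simp add: \<sigma>_def matrix_mul_assoc A')
    then show "\<exists>a b. a \<noteq> 0 \<and> b \<noteq> 0 \<and> \<rho> t ** (A' ** g) = A' ** g ** torus2 a b"
      using ab by (intro exI[of _ a] exI[of _ b]) (simp add: matrix_mul_assoc)
  qed
qed

section \<open>Maximal tori\<close>

text \<open>
  The standard torus of \<open>G2 \<times> G2\<close>, conjugated; \<open>k\<close> stands for the inverse of \<open>g\<close>.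
\<close>

definition conj_torus :: "(complex^8^8) \<times> (complex^8^8) \<Rightarrow> (complex^8^8) \<times> (complex^8^8) \<Rightarrow> (nat \<Rightarrow> complex) \<Rightarrow> (complex^8^8) \<times> (complex^8^8)" where
  "conj_torus g k t = (fst g ** torus2 (t 0) (t 1) ** fst k, snd g ** torus2 (t 2) (t 3) ** snd k)"

lemma torus2_mult: "torus2 a b ** torus2 c d = torus2 (a * c) (b * d)"
proof -
  have "weights a b $ i * weights c d $ i = weights (a * c) (b * d) $ i" for i
  proof -
    have "\<forall>i. weights a b $ i * weights c d $ i = weights (a * c) (b * d) $ i"
      by (simp add: forall_8 weights_def)
    then show ?thesis by blast
  qed
  then show ?thesis
    by (simp add: matrix_eq torus2_mult_vec flip: matrix_vector_mul_assoc) (simp add: vec_eq_iff flip: mult.assoc)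
qed

lemma laurent_weights:
  assumes "i < n" "j < n"
  shows "(\<lambda>t. weights (t i) (t j) $ k) \<in> laurent n"
proof -
  have gen: "(\<lambda>t. t i) \<in> laurent n" "(\<lambda>t. inverse (t i)) \<in> laurent n" if "i < n" for i
    unfolding laurent_def by (rule fun_algebra_gen; use that in blast)+
  have mult: "(\<lambda>t. f t * g t) \<in> laurent n" if "f \<in> laurent n" "g \<in> laurent n" for f g
    using that unfolding laurent_def by (rule fun_algebra_mult)
  have "(\<lambda>t. 1) \<in> laurent n"
    unfolding laurent_def by (rule fun_algebra_const)
  then have "\<forall>k. (\<lambda>t. weights (t i) (t j) $ k) \<in> laurent n"
    unfolding forall_8 weights_def vector_8 inverse_mult_distrib
    using gen[OF assms(1)] gen[OF assms(2)] mult by blast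
  then show ?thesis by blast
qed

lemma conj_torus2_nth: "(A ** torus2 a b ** B) $ i $ j = (\<Sum>k\<in>UNIV. A$i$k * weights a b $ k * B$k$j)"
proof -
  have "(A ** torus2 a b) $ i $ k = A$i$k * weights a b $ k" for k
    by (simp add: torus2_def matrix_matrix_mult_def if_distrib if_distribR cong: if_cong)
  then show ?thesis
    by (simp add: matrix_matrix_mult_def[of _ B])
qed

lemma matrix_triple_nth: "(A ** M ** B) $ i $ j = (\<Sum>k\<in>UNIV. (\<Sum>l\<in>UNIV. A$i$l * M$l$k) * B$k$j)"
  by (simp add: matrix_matrix_mult_def)

lemma torus_in_G2xG2_conj_torus:
  assumes g: "g \<in> G2 \<times> G2" "k \<in> G2 \<times> G2"
    and inv: "fst k ** fst g = mat 1" "snd k ** snd g = mat 1"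
  shows "torus_in_G2xG2 (conj_torus g k ` Gm 4)"
proof -
  have kg: "M ** fst k ** (fst g ** N) = M ** N" "M ** snd k ** (snd g ** N) = M ** N" for M N
    using inv by (metis matrix_mul_assoc matrix_mul_rid)+
  have nz: "t 0 \<noteq> 0" "t 1 \<noteq> 0" "t 2 \<noteq> 0" "t 3 \<noteq> 0" if "t \<in> Gm 4" for t
    using that by (simp_all add: Gm_def)
  have sub: "conj_torus g k ` Gm 4 \<subseteq> G2 \<times> G2"
    using g nz by (auto simp: conj_torus_def intro!: G2_mult torus2_G2)
  have hom: "conj_torus g k (\<lambda>i. s i * t i) = (fst (conj_torus g k s) ** fst (conj_torus g k t),
      snd (conj_torus g k s) ** snd (conj_torus g k t))" for s t
  proof -
    have "fst g ** torus2 (s 0 * t 0) (s 1 * t 1) ** fst k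
        = (fst g ** torus2 (s 0) (s 1) ** fst k) ** (fst g ** (torus2 (t 0) (t 1) ** fst k))"
      unfolding kg by (simp only: matrix_mul_assoc flip: torus2_mult)
    moreover have "snd g ** torus2 (s 2 * t 2) (s 3 * t 3) ** snd k
        = (snd g ** torus2 (s 2) (s 3) ** snd k) ** (snd g ** (torus2 (t 2) (t 3) ** snd k))"
      unfolding kg by (simp only: matrix_mul_assoc flip: torus2_mult)
    ultimately show ?thesis
      by (simp add: conj_torus_def matrix_mul_assoc)
  qed
  have reg: "\<exists>h\<in>laurent 4. \<forall>t\<in>Gm 4. f (conj_torus g k t) = h t" if "f \<in> pair_poly" for f
    using that unfolding pair_poly_def
  proof induction
    case (fun_algebra_gen f)
    have const: "(\<lambda>_. c) \<in> laurent 4" for c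
      unfolding laurent_def by (rule fun_algebra_const)
    have entry: "(\<lambda>t. \<Sum>l\<in>UNIV. A$i$l * weights (t p) (t q) $ l * B$l$j) \<in> laurent 4" if "p < 4" "q < 4" for A B :: "complex^8^8" and i j p q
      unfolding laurent_def
      by (intro fun_algebra_sum fun_algebra_mult; simp add: laurent_weights[OF that] const flip: laurent_def)
    have "\<exists>(A :: complex^8^8) (B :: complex^8^8) i j p q. (\<forall>t. f (conj_torus g k t) = (\<Sum>l\<in>UNIV. A$i$l * weights (t p) (t q) $ l * B$l$j)) \<and> p < 4 \<and> q < (4::nat)"
      using fun_algebra_gen
    proof (elim UnE CollectE exE conjE)
      fix i j assume f: "f = (\<lambda>t. fst t $ i $ j)"
      show ?thesis
        by (rule exI[of _ "fst g"], rule exI[of _ "fst k"], rule exI[of _ i], rule exI[of _ j], rule exI[of _ 0], rule exI[of _ 1])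
          (simp add: f conj_torus_def conj_torus2_nth)
    next
      fix i j assume f: "f = (\<lambda>t. snd t $ i $ j)"
      show ?thesis
        by (rule exI[of _ "snd g"], rule exI[of _ "snd k"], rule exI[of _ i], rule exI[of _ j], rule exI[of _ 2], rule exI[of _ 3])
          (simp add: f conj_torus_def conj_torus2_nth)
    qed
    then obtain A B :: "complex^8^8" and i j p q where f: "\<forall>t. f (conj_torus g k t) = (\<Sum>l\<in>UNIV. A$i$l * weights (t p) (t q) $ l * B$l$j)"
      and pq: "p < 4" "q < (4::nat)" by blast
    show ?case
      by (rule bexI[OF _ entry[OF pq, of A i B j]]) (simp add: f)
  next
    case (fun_algebra_const c)
    have "(\<lambda>_. c) \<in> laurent 4"
      unfolding laurent_def by (rule fun_algebra.fun_algebra_const)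
    then show ?case by (rule rev_bexI) simp
  next
    case (fun_algebra_add f f')
    then obtain h h' where h: "h \<in> laurent 4" "\<forall>t\<in>Gm 4. f (conj_torus g k t) = h t"
      "h' \<in> laurent 4" "\<forall>t\<in>Gm 4. f' (conj_torus g k t) = h' t" by blast
    have "(\<lambda>t. h t + h' t) \<in> laurent 4"
      using h unfolding laurent_def by (intro fun_algebra.fun_algebra_add)
    then show ?case by (rule rev_bexI) (simp add: h)
  next
    case (fun_algebra_mult f f')
    then obtain h h' where h: "h \<in> laurent 4" "\<forall>t\<in>Gm 4. f (conj_torus g k t) = h t"
      "h' \<in> laurent 4" "\<forall>t\<in>Gm 4. f' (conj_torus g k t) = h' t" by blast
    have "(\<lambda>t. h t * h' t) \<in> laurent 4"
      using h unfolding laurent_def by (intro fun_algebra.fun_algebra_mult)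
    then show ?case by (rule rev_bexI) (simp add: h)
  qed
  have inv_reg: "\<exists>f\<in>pair_poly. \<forall>t\<in>Gm 4. f (conj_torus g k t) = t i" if i: "i < 4" for i
  proof -
    have unconj: "fst k ** fst (conj_torus g k t) ** fst g = torus2 (t 0) (t 1)"
      "snd k ** snd (conj_torus g k t) ** snd g = torus2 (t 2) (t 3)" for t
    proof -
      have "fst k ** fst (conj_torus g k t) ** fst g = (fst k ** fst g) ** torus2 (t 0) (t 1) ** (fst k ** fst g)"
        by (simp only: conj_torus_def fst_conv matrix_mul_assoc)
      then show "fst k ** fst (conj_torus g k t) ** fst g = torus2 (t 0) (t 1)"
        by (simp add: inv)
      have "snd k ** snd (conj_torus g k t) ** snd g = (snd k ** snd g) ** torus2 (t 2) (t 3) ** (snd k ** snd g)"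
        by (simp only: conj_torus_def snd_conv matrix_mul_assoc)
      then show "snd k ** snd (conj_torus g k t) ** snd g = torus2 (t 2) (t 3)"
        by (simp add: inv)
    qed
    have entries: "(\<lambda>t. fst t $ i $ j) \<in> pair_poly" "(\<lambda>t. snd t $ i $ j) \<in> pair_poly" for i j
      unfolding pair_poly_def by (rule fun_algebra_gen; blast)+
    have poly: "(\<lambda>t. (A ** fst t ** B) $ i $ j) \<in> pair_poly" "(\<lambda>t. (A ** snd t ** B) $ i $ j) \<in> pair_poly" for A B i j
      unfolding matrix_triple_nth pair_poly_def
      by (intro fun_algebra_sum fun_algebra_mult fun_algebra_const finite entries[unfolded pair_poly_def])+
    have t2: "torus2 a b $ 2 $ 2 = a" "torus2 a b $ 3 $ 3 = b" for a b
      by (simp_all add: torus2_def weights_def)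
    consider "i = 0" | "i = 1" | "i = 2" | "i = 3" using i by linarith
    then show ?thesis
    proof cases
      case 1 then show ?thesis by (intro bexI[OF _ poly(1)[of "fst k" "fst g" 2 2]]) (simp add: unconj t2)
    next
      case 2 then show ?thesis by (intro bexI[OF _ poly(1)[of "fst k" "fst g" 3 3]]) (simp add: unconj t2)
    next
      case 3 then show ?thesis by (intro bexI[OF _ poly(2)[of "snd k" "snd g" 2 2]]) (simp add: unconj t2)
    next
      case 4 then show ?thesis by (intro bexI[OF _ poly(2)[of "snd k" "snd g" 3 3]]) (simp add: unconj t2)
    qed
  qed
  show ?thesis
    unfolding torus_in_G2xG2_def
    by (intro conjI sub exI[of _ 4] exI[of _ "conj_torus g k"] refl ballI allI impI hom reg inv_reg)
qed

lemma G2_factor_conjugate: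
  assumes G2: "\<And>t. t \<in> Gm n \<Longrightarrow> \<pi> (\<phi> t) \<in> G2"
    and hom: "\<And>s t. s \<in> Gm n \<Longrightarrow> t \<in> Gm n \<Longrightarrow> \<pi> (\<phi> (\<lambda>i. s i * t i)) = \<pi> (\<phi> s) ** \<pi> (\<phi> t)"
    and reg: "\<And>i j. \<exists>h\<in>laurent n. \<forall>t\<in>Gm n. \<pi> (\<phi> t) $ i $ j = h t"
  obtains g k where "g \<in> G2" "k \<in> G2" "g ** k = mat 1" "k ** g = mat 1"
    "\<And>t. t \<in> Gm n \<Longrightarrow> \<exists>a b. a \<noteq> 0 \<and> b \<noteq> 0 \<and> \<pi> (\<phi> t) = g ** torus2 a b ** k"
proof -
  have char: "character_sum n (\<lambda>t. \<pi> (\<phi> t) $ i $ j)" for i j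
  proof -
    obtain h where h: "h \<in> laurent n" "\<forall>t\<in>Gm n. \<pi> (\<phi> t) $ i $ j = h t"
      using reg by blast
    show ?thesis
      using laurent_character_sum[OF h(1)] h(2) unfolding character_sum_def by simp
  qed
  obtain g where g: "g \<in> G2" "\<And>t. t \<in> Gm n \<Longrightarrow> \<exists>a b. a \<noteq> 0 \<and> b \<noteq> 0 \<and> \<pi> (\<phi> t) ** g = g ** torus2 a b"
    by (rule torus_conjugate_diagonal[of n "\<lambda>t. \<pi> (\<phi> t)"]) (simp_all add: G2 hom char)
  obtain k where k: "k \<in> G2" "g ** k = mat 1" "k ** g = mat 1"
    using G2_inverse[OF g(1)] by blast
  have "\<exists>a b. a \<noteq> 0 \<and> b \<noteq> 0 \<and> \<pi> (\<phi> t) = g ** torus2 a b ** k" if t: "t \<in> Gm n" for t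
  proof -
    obtain a b where ab: "a \<noteq> 0" "b \<noteq> 0" "\<pi> (\<phi> t) ** g = g ** torus2 a b"
      using g(2)[OF t] by blast
    have "\<pi> (\<phi> t) = \<pi> (\<phi> t) ** g ** k"
      by (simp add: k flip: matrix_mul_assoc)
    then show ?thesis using ab by metis
  qed
  then show ?thesis using that g(1) k by blast
qed

text \<open>
  Both projections of \<open>T\<close> to \<open>G2\<close> are conjugate to diagonal groups.  Hence \<open>T\<close> is contained in a
  conjugate of the standard torus, and by maximality it is equal to it.
\<close>

lemma maximal_torus_conjugate:
  assumes T: "maximal_torus_in_G2xG2 T"
  obtains g k where "g \<in> G2 \<times> G2" "k \<in> G2 \<times> G2" "fst g ** fst k = mat 1" "snd g ** snd k = mat 1"
    "fst k ** fst g = mat 1" "snd k ** snd g = mat 1" "T = conj_torus g k ` Gm 4"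
proof -
  have "torus_in_G2xG2 T"
    using T unfolding maximal_torus_in_G2xG2_def by (rule conjunct1)
  note torus = this[unfolded torus_in_G2xG2_def]
  note sub = conjunct1[OF torus] and ex = conjunct2[OF torus]
  obtain n \<phi> where \<phi>: "\<phi> ` Gm n = T"
    and hom': "\<forall>s\<in>Gm n. \<forall>t\<in>Gm n. \<phi> (\<lambda>i. s i * t i) = (fst (\<phi> s) ** fst (\<phi> t), snd (\<phi> s) ** snd (\<phi> t))"
    and reg': "\<forall>f\<in>pair_poly. \<exists>g\<in>laurent n. \<forall>t\<in>Gm n. f (\<phi> t) = g t"
    using ex by (elim exE conjE)
  have hom: "\<phi> (\<lambda>i. s i * t i) = (fst (\<phi> s) ** fst (\<phi> t), snd (\<phi> s) ** snd (\<phi> t))"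
    if "s \<in> Gm n" "t \<in> Gm n" for s t
    using hom' that by simp
  have reg: "\<exists>g\<in>laurent n. \<forall>t\<in>Gm n. f (\<phi> t) = g t" if "f \<in> pair_poly" for f
    using bspec[OF reg' that] .
  have in_G2: "fst (\<phi> t) \<in> G2" "snd (\<phi> t) \<in> G2" if "t \<in> Gm n" for t
    using sub \<phi> that by (auto simp: mem_Times_iff)
  have entries: "(\<lambda>t. fst t $ i $ j) \<in> pair_poly" "(\<lambda>t. snd t $ i $ j) \<in> pair_poly" for i j
    unfolding pair_poly_def by (rule fun_algebra_gen; blast)+
  obtain g1 k1 where 1: "g1 \<in> G2" "k1 \<in> G2" "g1 ** k1 = mat 1" "k1 ** g1 = mat 1"
    "\<And>t. t \<in> Gm n \<Longrightarrow> \<exists>a b. a \<noteq> 0 \<and> b \<noteq> 0 \<and> fst (\<phi> t) = g1 ** torus2 a b ** k1"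
    by (rule G2_factor_conjugate[of n fst \<phi>]) (use in_G2 hom reg[OF entries(1)] in auto)
  obtain g2 k2 where 2: "g2 \<in> G2" "k2 \<in> G2" "g2 ** k2 = mat 1" "k2 ** g2 = mat 1"
    "\<And>t. t \<in> Gm n \<Longrightarrow> \<exists>a b. a \<noteq> 0 \<and> b \<noteq> 0 \<and> snd (\<phi> t) = g2 ** torus2 a b ** k2"
    by (rule G2_factor_conjugate[of n snd \<phi>]) (use in_G2 hom reg[OF entries(2)] in auto)
  let ?T = "conj_torus (g1, g2) (k1, k2) ` Gm 4"
  have "T \<subseteq> ?T"
  proof
    fix p assume "p \<in> T"
    then obtain t where t: "t \<in> Gm n" "p = \<phi> t" using \<phi> by blast
    obtain a b where ab: "a \<noteq> 0" "b \<noteq> 0" "fst (\<phi> t) = g1 ** torus2 a b ** k1"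
      using 1(5)[OF t(1)] by blast
    obtain c d where cd: "c \<noteq> 0" "d \<noteq> 0" "snd (\<phi> t) = g2 ** torus2 c d ** k2"
      using 2(5)[OF t(1)] by blast
    define s :: "nat \<Rightarrow> complex" where "s i = (if i = 0 then a else if i = 1 then b else if i = 2 then c else if i = 3 then d else 1)" for i
    have "s \<in> Gm 4"
      using ab cd by (simp add: Gm_def s_def)
    moreover have "p = conj_torus (g1, g2) (k1, k2) s"
      by (simp add: conj_torus_def s_def t(2) prod_eq_iff ab cd)
    ultimately show "p \<in> ?T" by blast
  qed
  moreover have "torus_in_G2xG2 ?T"
    using 1 2 by (intro torus_in_G2xG2_conj_torus) simp_all
  ultimately have "T = ?T"
    using T unfolding maximal_torus_in_G2xG2_def by blast
  then show ?thesis
    using that[of "(g1, g2)" "(k1, k2)"] 1 2 by simp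
qed

section \<open>Fixed points\<close>

definition torus2_fixed :: "spinor set set" where
  "torus2_fixed = {p \<in> DG. \<forall>t\<in>Gm 4. act (torus2 (t 0) (t 1), torus2 (t 2) (t 3)) ` p = p}"

text \<open>
  The coordinates whose weights are short roots; the coordinates 1 and 8 have weight 0.
\<close>

definition root_indices :: "8 set" where
  "root_indices = {2, 3, 4, 5, 6, 7}"

lemma axis_tensor_fixed:
  assumes "i \<in> root_indices" "j \<in> root_indices"
  shows "Delta.span {tensor (axis i 1) (axis j 1)} \<in> torus2_fixed"
    and "Delta.span {tensor (axis i 1) (axis j 1)} \<in> Q5xQ5"
proof -
  have null: "axis i 1 \<in> V7" "onorm2 (axis i 1) = 0" "axis i 1 \<noteq> (0 :: octonion)" if "i \<in> root_indices" for i
    using that by (auto simp: root_indices_def V7_def onorm2_def axis_nth octonion_eq_iff)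
  show Q: "Delta.span {tensor (axis i 1) (axis j 1)} \<in> Q5xQ5"
    unfolding Q5xQ5_def using null[OF assms(1)] null[OF assms(2)] by blast
  have fixed: "act (torus2 a b, torus2 c d) ` Delta.span {tensor (axis i 1) (axis j 1)} = Delta.span {tensor (axis i 1) (axis j 1)}"
    if "a \<noteq> 0" "b \<noteq> 0" "c \<noteq> 0" "d \<noteq> 0" for a b c d
  proof -
    have nz: "\<forall>i. weights a b $ i \<noteq> 0" "\<forall>i. weights c d $ i \<noteq> 0"
      using that by (simp_all add: forall_8 weights_def)
    have "act (torus2 a b, torus2 c d) (tensor (axis i 1) (axis j 1))
        = cscale (weights a b $ i * weights c d $ j) (tensor (axis i 1) (axis j 1))"
      by (simp add: vec_eq_iff act_torus2 cscale_nth tensor_nth axis_nth)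
    then show ?thesis
      using nz by (simp add: act_image_line span_line_scale)
  qed
  have "act (torus2 (t 0) (t 1), torus2 (t 2) (t 3)) ` Delta.span {tensor (axis i 1) (axis j 1)}
      = Delta.span {tensor (axis i 1) (axis j 1)}" if "t \<in> Gm 4" for t
    using that by (intro fixed) (simp_all add: Gm_def)
  then show "Delta.span {tensor (axis i 1) (axis j 1)} \<in> torus2_fixed"
    using Q Q5xQ5_subset_DG unfolding torus2_fixed_def by blast
qed

text \<open>
  The parameters 8 and 1/2 give the distinct weights 8, 1/2, 1/4, 1/8, 2, 4 and 1 on \<open>V7\<close>.
\<close>

lemma regular_weights_separate:
  fixes i j :: 8
  assumes "weights 8 (1/2) $ i = weights 8 (1/2) $ j"
  shows "i = j \<or> (i \<notin> root_indices \<and> j \<notin> root_indices)"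
  using assms exhaust_8[of i] exhaust_8[of j]
  by (elim disjE) (simp_all add: weights_def root_indices_def)

lemma not_root_index: "i \<notin> root_indices \<longleftrightarrow> i = 1 \<or> i = 8"
  using exhaust_8[of i] by (auto simp: root_indices_def)

lemma DG_space_column_row_V7:
  assumes "M \<in> DG_space" "j \<in> root_indices"
  shows "column j M \<in> V7" "row j M \<in> V7"
proof -
  obtain A c where A: "A \<in> V7_tensor_V7" "M = A + cscale c zspin"
    using DG_space_decompose[OF assms(1)] by blast
  have "column j M = column j A" "row j M = row j A"
    using assms(2) by (auto simp: A(2) vec_eq_iff cscale_nth zspin_nth root_indices_def)
  then show "column j M \<in> V7" "row j M \<in> V7"
    using A(1) by (simp_all add: V7_tensor_V7_def)
qed

text \<open>
  The entries of a spinor whose line is fixed all have the same pair of weights.  If both weights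
  are nonzero, only one entry is left.  If exactly one of them is zero, the spinor is a tensor of a
  coordinate axis and a multiple of \<open>h7\<close>, which is not pure because \<open>h7\<close> is not null.  If both are
  zero, \<open>not_pure_weight_zero\<close> applies.
\<close>

lemma torus2_fixed_cases:
  assumes "p \<in> torus2_fixed"
  obtains i j where "i \<in> root_indices" "j \<in> root_indices" "p = Delta.span {tensor (axis i 1) (axis j 1)}"
proof -
  have p: "p \<in> DG" and fixed: "\<And>t. t \<in> Gm 4 \<Longrightarrow> act (torus2 (t 0) (t 1), torus2 (t 2) (t 3)) ` p = p"
    using assms by (auto simp: torus2_fixed_def)
  obtain M where M: "M \<noteq> 0" "p = Delta.span {M}" "pure_spinor M" "M \<in> DG_space"
    using DG_cases[OF p] by blast
  obtain a b where ab: "M$a$b \<noteq> 0"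
    using M(1) by (auto simp: vec_eq_iff)
  have scalar: "\<exists>k. \<forall>i j. weights x y $ i * M$i$j * weights z w $ j = k * M$i$j"
    if nz: "x \<noteq> 0" "y \<noteq> 0" "z \<noteq> 0" "w \<noteq> 0" for x y z w
  proof -
    define t :: "nat \<Rightarrow> complex" where "t i = (if i = 0 then x else if i = 1 then y else if i = 2 then z else if i = 3 then w else 1)" for i
    have "t \<in> Gm 4" using nz by (simp add: Gm_def t_def)
    then have "act (torus2 x y, torus2 z w) ` p = p"
      using fixed[of t] by (simp add: t_def)
    then have "act (torus2 x y, torus2 z w) M \<in> p"
      using M(2) Delta.span_base[of M "{M}"] by blast
    then obtain k where "act (torus2 x y, torus2 z w) M = cscale k M"
      by (auto simp: M(2) span_line)
    then have "weights x y $ i * M$i$j * weights z w $ j = k * M$i$j" for i j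
      by (metis act_torus2 cscale_nth)
    then show ?thesis by blast
  qed
  have one: "weights 1 1 $ i = 1" for i
  proof -
    have "\<forall>i. weights 1 1 $ i = 1" by (simp add: forall_8 weights_def)
    then show ?thesis by blast
  qed
  have row_w: "weights 8 (1/2) $ i = weights 8 (1/2) $ a" if nz: "M$i$j \<noteq> 0" for i j
  proof -
    obtain c where "\<forall>i j. weights 8 (1/2) $ i * M$i$j * weights 1 1 $ j = c * M$i$j"
      using scalar[of 8 "1/2" 1 1] by auto
    then have c: "weights 8 (1/2) $ i * M$i$j = c * M$i$j" for i j
      by (simp only: one mult_1_right)
    show ?thesis using c[of i j] c[of a b] nz ab by simp
  qed
  have col_w: "weights 8 (1/2) $ j = weights 8 (1/2) $ b" if nz: "M$i$j \<noteq> 0" for i j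
  proof -
    obtain c where "\<forall>i j. weights 1 1 $ i * M$i$j * weights 8 (1/2) $ j = c * M$i$j"
      using scalar[of 1 1 8 "1/2"] by auto
    then have c: "M$i$j * weights 8 (1/2) $ j = c * M$i$j" for i j
      by (simp only: one mult_1_left)
    show ?thesis using c[of i j] c[of a b] nz ab by simp
  qed
  have row0: "M$i$j = 0" if "i \<noteq> a" "i \<in> root_indices \<or> a \<in> root_indices" for i j
    using row_w[of i j] regular_weights_separate[of i a] that by blast
  have col0: "M$i$j = 0" if "j \<noteq> b" "j \<in> root_indices \<or> b \<in> root_indices" for i j
    using col_w[of i j] regular_weights_separate[of j b] that by blast
  consider "a \<in> root_indices" "b \<in> root_indices" | "a \<in> root_indices" "b \<notin> root_indices"
    | "a \<notin> root_indices" "b \<in> root_indices" | "a \<notin> root_indices" "b \<notin> root_indices" by blast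
  then show ?thesis
  proof cases
    case 1
    have "M = cscale (M$a$b) (tensor (axis a 1) (axis b 1))"
      using 1 row0 col0 by (auto simp: vec_eq_iff cscale_nth tensor_nth axis_nth)
    then have "p = Delta.span {tensor (axis a 1) (axis b 1)}"
      using span_line_scale[OF ab] M(2) by metis
    then show ?thesis using that 1 by blast
  next
    case 2
    have V: "row a M \<in> V7" using DG_space_column_row_V7[OF M(4) 2(1)] by blast
    have "M = tensor (axis a 1) (row a M)"
      using 2 row0 by (auto simp: vec_eq_iff tensor_nth axis_nth)
    then have "onorm2 (row a M) = 0"
      using pure_spinor_tensorD M(1,3) by metis
    moreover have "M$a$2 = 0" "M$a$3 = 0" "M$a$4 = 0" "M$a$5 = 0" "M$a$6 = 0" "M$a$7 = 0"
      using 2(2) by (auto intro!: col0 simp: root_indices_def)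
    ultimately have "M$a$1 = 0 \<and> M$a$8 = 0"
      using V by (auto simp: onorm2_def V7_def)
    moreover have "b = 1 \<or> b = 8" using 2(2) not_root_index by simp
    ultimately show ?thesis using ab by auto
  next
    case 3
    have V: "column b M \<in> V7" using DG_space_column_row_V7[OF M(4) 3(2)] by blast
    have "M = tensor (column b M) (axis b 1)"
      using 3 col0 by (auto simp: vec_eq_iff tensor_nth axis_nth)
    then have "onorm2 (column b M) = 0"
      using pure_spinor_tensorD M(1,3) by metis
    moreover have "M$2$b = 0" "M$3$b = 0" "M$4$b = 0" "M$5$b = 0" "M$6$b = 0" "M$7$b = 0"
      using 3(1) by (auto intro!: row0 simp: root_indices_def)
    ultimately have "M$1$b = 0 \<and> M$8$b = 0"
      using V by (auto simp: onorm2_def V7_def)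
    moreover have "a = 1 \<or> a = 8" using 3(1) not_root_index by simp
    ultimately show ?thesis using ab by auto
  next
    case 4
    obtain A c where A: "A \<in> V7_tensor_V7" "M = A + cscale c zspin"
      using DG_space_decompose[OF M(4)] by blast
    have rows: "M$i$j = 0" if "i \<in> root_indices \<or> j \<in> root_indices" for i j
      using that 4 row0[of i j] col0[of j i] by blast
    have "A$i$1 + A$i$8 = 0" "A$1$i + A$8$i = 0" for i
      using A(1) by (simp_all add: V7_tensor_V7_def V7_def)
    then have A8: "A$i$8 = - A$i$1" "A$8$i = - A$1$i" for i
      by (simp_all add: add_eq_0_iff)
    have "\<forall>i j. M$i$j = (cscale (A$1$1) (tensor h7 h7) + cscale c zspin) $ i $ j"
    proof -
      have "M$1$1 = A$1$1 + c" "M$1$8 = - A$1$1 + c" "M$8$1 = - A$1$1 + c" "M$8$8 = A$1$1 + c"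
        using A8(1)[of 1] A8(2)[of 1] A8(1)[of 8] by (simp_all add: A(2) cscale_nth zspin_nth)
      then show ?thesis
        unfolding forall_8 by (simp add: rows root_indices_def cscale_nth tensor_nth zspin_nth)
    qed
    then have "M = cscale (A$1$1) (tensor h7 h7) + cscale c zspin"
      by (simp add: vec_eq_iff)
    then have "M = 0"
      using not_pure_weight_zero M(3) by (metis Delta.scale_zero_left add_0)
    then show ?thesis using M(1) by blast
  qed
qed

lemma card_torus2_fixed: "card torus2_fixed = 36"
proof -
  let ?f = "\<lambda>(i, j). Delta.span {tensor (axis i 1) (axis j 1)}"
  have fixed_eq: "torus2_fixed = ?f ` (root_indices \<times> root_indices)"
  proof (intro equalityI subsetI)
    fix p assume "p \<in> torus2_fixed"
    then obtain i j where "i \<in> root_indices" "j \<in> root_indices" "p = ?f (i, j)"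
      using torus2_fixed_cases[of p] by auto
    then show "p \<in> ?f ` (root_indices \<times> root_indices)" by blast
  next
    fix p assume "p \<in> ?f ` (root_indices \<times> root_indices)"
    then show "p \<in> torus2_fixed" using axis_tensor_fixed(1) by auto
  qed
  have inj: "inj_on ?f (root_indices \<times> root_indices)"
  proof (rule inj_onI, clarify)
    fix i j k l :: 8
    assume eq: "Delta.span {tensor (axis i 1) (axis j 1)} = Delta.span {tensor (axis k 1) (axis l 1)}"
    have nz: "tensor (axis k 1) (axis l 1) \<noteq> (0 :: spinor)"
      by (intro tensor_nonzero) (simp_all add: axis_eq_0_iff)
    obtain c where c: "c \<noteq> 0" "tensor (axis k 1) (axis l 1) = cscale c (tensor (axis i 1) (axis j 1))"
      using span_lineD[OF eq nz] by blast
    then have "tensor (axis k 1) (axis l 1) $ i $ j \<noteq> 0"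
      by (simp add: cscale_nth tensor_nth axis_nth)
    then show "i = k \<and> j = l"
      by (simp add: tensor_nth axis_nth split: if_splits)
  qed
  have "card root_indices = 6"
    by (simp add: root_indices_def)
  then show ?thesis
    unfolding fixed_eq card_image[OF inj] by (simp add: card_cartesian_product)
qed

theorem proposition13:
  fixes T :: "((complex^8^8) \<times> (complex^8^8)) set"
  assumes "maximal_torus_in_G2xG2 T"
  shows "card {p \<in> DG. \<forall>t\<in>T. act t ` p = p} = 36 \<and>
    {Y \<in> orbits (act ` (G2 \<times> G2)) DG. zariski_closed Y} = {Q5xQ5} \<and>
    {p \<in> DG. \<forall>t\<in>T. act t ` p = p} \<subseteq> Q5xQ5"
proof -
  obtain g k where gk: "g \<in> G2 \<times> G2" "k \<in> G2 \<times> G2" "fst g ** fst k = mat 1" "snd g ** snd k = mat 1"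
    "fst k ** fst g = mat 1" "snd k ** snd g = mat 1" and T: "T = conj_torus g k ` Gm 4"
    using maximal_torus_conjugate[OF assms] by blast
  have gk_act: "act g ` act k ` q = q" "act k ` act g ` q = q" for q
    using gk by (simp_all add: image_image act_comp act_one)
  have conj: "act (conj_torus g k t) ` q = act g ` act (torus2 (t 0) (t 1), torus2 (t 2) (t 3)) ` act k ` q" for t q
    by (simp add: conj_torus_def image_image act_comp matrix_mul_assoc)
  have fixed: "{p \<in> DG. \<forall>t\<in>T. act t ` p = p} = (\<lambda>q. act g ` q) ` torus2_fixed"
  proof (intro equalityI subsetI)
    fix p assume "p \<in> {p \<in> DG. \<forall>t\<in>T. act t ` p = p}"
    then have p: "p \<in> DG" "\<And>t. t \<in> Gm 4 \<Longrightarrow> act (conj_torus g k t) ` p = p"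
      by (auto simp: T)
    have "act (torus2 (t 0) (t 1), torus2 (t 2) (t 3)) ` act k ` p = act k ` p" if "t \<in> Gm 4" for t
      using arg_cong[OF p(2)[OF that], of "(`) (act k)"] unfolding conj gk_act .
    then have "act k ` p \<in> torus2_fixed"
      using DG_act[OF gk(2) p(1)] by (simp add: torus2_fixed_def)
    then show "p \<in> (\<lambda>q. act g ` q) ` torus2_fixed"
      using gk_act(1)[of p] by (metis image_eqI)
  next
    fix p assume "p \<in> (\<lambda>q. act g ` q) ` torus2_fixed"
    then obtain q where q: "q \<in> torus2_fixed" "p = act g ` q" by (rule imageE)
    have "act (conj_torus g k t) ` p = p" if "t \<in> Gm 4" for t
      using q(1) that unfolding conj q(2) gk_act torus2_fixed_def by simp
    moreover have "p \<in> DG"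
      using q DG_act[OF gk(1)] by (simp add: torus2_fixed_def)
    ultimately show "p \<in> {p \<in> DG. \<forall>t\<in>T. act t ` p = p}"
      by (simp add: T)
  qed
  have "inj_on (\<lambda>q. act g ` q) torus2_fixed"
    by (metis gk_act(2) inj_onI)
  then have "card {p \<in> DG. \<forall>t\<in>T. act t ` p = p} = 36"
    by (simp only: fixed card_image card_torus2_fixed)
  moreover have "{p \<in> DG. \<forall>t\<in>T. act t ` p = p} \<subseteq> Q5xQ5"
    unfolding fixed
  proof (intro image_subsetI)
    fix q assume "q \<in> torus2_fixed"
    then have "q \<in> {h ` null_line | h. h \<in> act ` (G2 \<times> G2)}"
      unfolding Q5xQ5_orbit using torus2_fixed_cases[of q] axis_tensor_fixed(2) by auto
    then obtain t where t: "t \<in> G2 \<times> G2" "q = act t ` null_line" by blast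
    have "act g ` q = act (fst g ** fst t, snd g ** snd t) ` null_line"
      by (simp add: t(2) image_image act_comp)
    moreover have "(fst g ** fst t, snd g ** snd t) \<in> G2 \<times> G2"
      using gk(1) t(1) by (auto intro: G2_mult)
    ultimately show "act g ` q \<in> Q5xQ5"
      unfolding Q5xQ5_orbit[symmetric] by blast
  qed
  ultimately show ?thesis
    using closed_G2_orbits by blast
qed

end
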